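(* Let $d$ be a distance measure between propositional interpretations. If the problem of determining, given an interpretation $I$, a formula $K$ and a number $x$, whether $d(I,K)\leq x$ is in the complexity class $\Pi^p_i$ or in $\Sigma^p_i$, then the problem of deciding, given two consistent propositional formulae $K_1,K_2$ and a satisfiable formula $R$, whether $R$ is obtainable from $\{K_1,K_2\}$ with a weighted sum of the distances $d$ is in $\Pi^p_{i+1}$.
   Context: $\Sigma^p_i,\Pi^p_i$ are the classes of the polynomial hierarchy. $d$ assigns nonnegative integers to pairs of interpretations over the same finite set of variables. For a consistent formula $K$, $d(I,K)=\min\{d(I,J) : J\models K\}$. Given positive integer weights $w_1,w_2$, the weighted distance of $I$ is $w_1 d(I,K_1)+w_2 d(I,K_2)$, and the result of merging $K_1,K_2$ with these weights is the formula (up to equivalence) whose models are exactly the interpretations of minimal weighted distance. $R$ is obtainable from $\{K_1,K_2\}$ if there exist positive integers $w_1,w_2$ such that $R$ is equivalent to the result of merging $K_1,K_2$ with weights $w_1,w_2$.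
   Formalization: The formal theorem additionally assumes that the values d(I,J) have polynomially many bits in the size of I; without such a bound the claim fails, since a query d(I,K) ≤ x may need an x far longer than the rest of the input. *)

theory Defs
  imports "HOL-Computational_Algebra.Polynomial"
begin

section \<open>Deterministic multi-tape Turing machines\<close>

text \<open>
  States and tape symbols are initial segments of the natural numbers. Symbol 0 is the blank;
  symbols 1 and 2 stand for the input bits \<open>False\<close> and \<open>True\<close>. State 0 is the start state, state 1
  is the accepting and state 2 the rejecting halting state. Tapes are infinite in both directions;
  a tape is its contents together with the head position.
\<close>

datatype move = MoveLeft | Stay | MoveRight

record tm =
  num_tapes :: nat
  num_symbols :: nat
  num_states :: nat
  delta :: "nat \<Rightarrow> nat list \<Rightarrow> nat \<times> (nat \<times> move) list"

definition wf_tm :: "tm \<Rightarrow> bool" where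
  "wf_tm M \<longleftrightarrow>
     1 \<le> num_tapes M \<and> 3 \<le> num_symbols M \<and> 3 \<le> num_states M \<and>
     (\<forall>q rs. q < num_states M \<and> length rs = num_tapes M \<and> set rs \<subseteq> {..<num_symbols M} \<longrightarrow>
        fst (delta M q rs) < num_states M \<and>
        length (snd (delta M q rs)) = num_tapes M \<and>
        fst ` set (snd (delta M q rs)) \<subseteq> {..<num_symbols M})"

type_synonym tape = "(int \<Rightarrow> nat) \<times> int"
type_synonym config = "nat \<times> tape list"

fun move_head :: "move \<Rightarrow> int \<Rightarrow> int" where
  "move_head MoveLeft h = h - 1"
| "move_head Stay h = h"
| "move_head MoveRight h = h + 1"

fun update_tape :: "nat \<times> move \<Rightarrow> tape \<Rightarrow> tape" where
  "update_tape (s, m) (c, h) = (c(h := s), move_head m h)"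

definition tm_step :: "tm \<Rightarrow> config \<Rightarrow> config" where
  "tm_step M cf =
     (if fst cf \<in> {1, 2} then cf
      else let (q, acts) = delta M (fst cf) (map (\<lambda>(c, h). c h) (snd cf))
           in (q, map2 update_tape acts (snd cf)))"

definition blank_tape :: tape where
  "blank_tape = (\<lambda>_. 0, 0)"

definition input_tape :: "bool list \<Rightarrow> tape" where
  "input_tape xs =
     (\<lambda>j. if 0 \<le> j \<and> j < int (length xs) then (if xs ! nat j then 2 else 1) else 0, 0)"

definition init_config :: "tm \<Rightarrow> bool list \<Rightarrow> config" where
  "init_config M xs = (0, input_tape xs # replicate (num_tapes M - 1) blank_tape)"

definition tm_state_after :: "tm \<Rightarrow> bool list \<Rightarrow> nat \<Rightarrow> nat" where
  "tm_state_after M xs t = fst ((tm_step M ^^ t) (init_config M xs))"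

section \<open>The polynomial hierarchy\<close>

type_synonym language = "bool list set"

definition P_class :: "language set" where
  "P_class = {L. \<exists>M (p :: nat poly). wf_tm M \<and>
     (\<forall>xs. \<exists>t \<le> poly p (length xs). tm_state_after M xs t = (if xs \<in> L then 1 else 2))}"

definition delimit :: "bool list \<Rightarrow> bool list" where
  "delimit xs = concat (map (\<lambda>b. [True, b]) xs) @ [False]"

definition pair_code :: "bool list \<Rightarrow> bool list \<Rightarrow> bool list" where
  "pair_code xs u = delimit xs @ u"

text \<open>
  \<open>Sigma_p (Suc i)\<close> consists of the languages obtained by polynomially bounded existential
  quantification from languages of \<open>Pi_p i\<close>, that is, from complements of languages of \<open>Sigma_p i\<close>.
\<close>

primrec Sigma_p :: "nat \<Rightarrow> language set" where
  "Sigma_p 0 = P_class"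
| "Sigma_p (Suc i) = {L. \<exists>L' (p :: nat poly). - L' \<in> Sigma_p i \<and>
     (\<forall>xs. xs \<in> L \<longleftrightarrow> (\<exists>u. length u \<le> poly p (length xs) \<and> pair_code xs u \<in> L'))}"

definition Pi_p :: "nat \<Rightarrow> language set" where
  "Pi_p i = {L. - L \<in> Sigma_p i}"

text \<open>
  A decision problem whose instances are restricted (here: to encodings of consistent formulae) is
  given by its positive and its negative instances; other strings are unconstrained.
\<close>

type_synonym problem = "language \<times> language"

definition problem_in :: "problem \<Rightarrow> language set \<Rightarrow> bool" where
  "problem_in A C \<longleftrightarrow> (\<exists>L\<in>C. fst A \<subseteq> L \<and> snd A \<inter> L = {})"

section \<open>Propositional formulae and merging\<close>

datatype form = Falsum | Atom nat | Neg form | Conj form form | Disj form form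

primrec vars :: "form \<Rightarrow> nat set" where
  "vars Falsum = {}"
| "vars (Atom v) = {v}"
| "vars (Neg F) = vars F"
| "vars (Conj F G) = vars F \<union> vars G"
| "vars (Disj F G) = vars F \<union> vars G"

text \<open>An interpretation over a finite set \<open>X\<close> of variables is the subset of its true variables.\<close>

primrec sat :: "nat set \<Rightarrow> form \<Rightarrow> bool" where
  "sat I Falsum \<longleftrightarrow> False"
| "sat I (Atom v) \<longleftrightarrow> v \<in> I"
| "sat I (Neg F) \<longleftrightarrow> \<not> sat I F"
| "sat I (Conj F G) \<longleftrightarrow> sat I F \<and> sat I G"
| "sat I (Disj F G) \<longleftrightarrow> sat I F \<or> sat I G"

definition models :: "nat set \<Rightarrow> form \<Rightarrow> nat set set" where
  "models X F = {I. I \<subseteq> X \<and> sat I F}"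

definition consistent_over :: "nat set \<Rightarrow> form \<Rightarrow> bool" where
  "consistent_over X F \<longleftrightarrow> vars F \<subseteq> X \<and> models X F \<noteq> {}"

text \<open>\<open>d X I J\<close> is the distance between the interpretations \<open>I\<close> and \<open>J\<close> over \<open>X\<close>.\<close>

type_synonym distance = "nat set \<Rightarrow> nat set \<Rightarrow> nat set \<Rightarrow> nat"

definition form_dist :: "distance \<Rightarrow> nat set \<Rightarrow> nat set \<Rightarrow> form \<Rightarrow> nat" where
  "form_dist d X I K = Min (d X I ` models X K)"

definition weighted_dist ::
  "distance \<Rightarrow> nat set \<Rightarrow> nat \<Rightarrow> nat \<Rightarrow> form \<Rightarrow> form \<Rightarrow> nat set \<Rightarrow> nat" where
  "weighted_dist d X w1 w2 K1 K2 I = w1 * form_dist d X I K1 + w2 * form_dist d X I K2"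

definition merge_models ::
  "distance \<Rightarrow> nat set \<Rightarrow> nat \<Rightarrow> nat \<Rightarrow> form \<Rightarrow> form \<Rightarrow> nat set set" where
  "merge_models d X w1 w2 K1 K2 =
     {I. I \<subseteq> X \<and> (\<forall>J. J \<subseteq> X \<longrightarrow> weighted_dist d X w1 w2 K1 K2 I \<le> weighted_dist d X w1 w2 K1 K2 J)}"

definition obtainable :: "distance \<Rightarrow> nat set \<Rightarrow> form \<Rightarrow> form \<Rightarrow> form \<Rightarrow> bool" where
  "obtainable d X K1 K2 R \<longleftrightarrow>
     (\<exists>w1 w2. 0 < w1 \<and> 0 < w2 \<and> models X R = merge_models d X w1 w2 K1 K2)"

section \<open>Encodings and decision problems\<close>

text \<open>Binary notation, least significant bit first.\<close>

fun nat_code :: "nat \<Rightarrow> bool list" where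
  "nat_code n = (if n = 0 then [] else odd n # nat_code (n div 2))"

declare nat_code.simps [simp del]

definition var_code :: "nat \<Rightarrow> bool list" where
  "var_code v = delimit (nat_code v)"

text \<open>Formulae are written in postfix notation.\<close>

primrec form_code :: "form \<Rightarrow> bool list" where
  "form_code Falsum = [False, False, False]"
| "form_code (Atom v) = [False, False, True] @ var_code v"
| "form_code (Neg F) = form_code F @ [False, True, False]"
| "form_code (Conj F G) = form_code F @ form_code G @ [False, True, True]"
| "form_code (Disj F G) = form_code F @ form_code G @ [True, False, False]"

definition vars_code :: "nat set \<Rightarrow> bool list" where
  "vars_code X = concat (map var_code (sorted_list_of_set X))"

definition interp_code :: "nat set \<Rightarrow> nat set \<Rightarrow> bool list" where
  "interp_code X I = concat (map (\<lambda>v. var_code v @ [v \<in> I]) (sorted_list_of_set X))"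

definition tuple_code :: "bool list list \<Rightarrow> bool list" where
  "tuple_code xss = concat (map delimit xss)"

definition dist_code :: "nat set \<Rightarrow> nat set \<Rightarrow> form \<Rightarrow> nat \<Rightarrow> bool list" where
  "dist_code X I K x = tuple_code [interp_code X I, form_code K, nat_code x]"

definition dist_problem :: "distance \<Rightarrow> problem" where
  "dist_problem d =
     ({dist_code X I K x | X I K x.
         finite X \<and> I \<subseteq> X \<and> consistent_over X K \<and> form_dist d X I K \<le> x},
      {dist_code X I K x | X I K x.
         finite X \<and> I \<subseteq> X \<and> consistent_over X K \<and> \<not> form_dist d X I K \<le> x})"

definition obtain_code :: "nat set \<Rightarrow> form \<Rightarrow> form \<Rightarrow> form \<Rightarrow> bool list" where
  "obtain_code X K1 K2 R = tuple_code [vars_code X, form_code K1, form_code K2, form_code R]"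

definition obtain_problem :: "distance \<Rightarrow> problem" where
  "obtain_problem d =
     ({obtain_code X K1 K2 R | X K1 K2 R.
         finite X \<and> consistent_over X K1 \<and> consistent_over X K2 \<and> consistent_over X R \<and>
         obtainable d X K1 K2 R},
      {obtain_code X K1 K2 R | X K1 K2 R.
         finite X \<and> consistent_over X K1 \<and> consistent_over X K2 \<and> consistent_over X R \<and>
         \<not> obtainable d X K1 K2 R})"

text \<open>
  The values of \<open>d\<close> have polynomially many bits. Without such a bound, a query "distance at most
  \<open>x\<close>" may need an \<open>x\<close> far longer than the rest of the input, and the complexity of these queries
  then gives no bound on the complexity of obtainability.
\<close>

definition poly_size_distance :: "distance \<Rightarrow> bool" where
  "poly_size_distance d \<longleftrightarrow> (\<exists>p :: nat poly. \<forall>X I J. finite X \<and> I \<subseteq> X \<and> J \<subseteq> X \<longrightarrow>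
     length (nat_code (d X I J)) \<le> poly p (length (interp_code X I)))"

end

(*
  Over the points (d(I,K1), d(I,K2)) the condition that R be the result of merging is a system of
  homogeneous linear constraints on (w1, w2), one for each model I of R and each interpretation J.
  In the ratio w1/w2 each of them describes a ray, the whole line or nothing, so by Helly's theorem
  on the line unsolvability is witnessed by two of them, and positive rational solutions scale to
  integers. Hence non-obtainability has a short certificate: two pairs of interpretations with
  bounds on their distances from K1 and K2. A certificate is checked by positive and negative
  distance queries, a cross multiplication and evaluations of R. Both kinds of queries lie in
  Sigma_(i+1), which is closed under conjunction, disjunction and bounded existential
  quantification.

  The closure properties need functions computable in polynomial time. Programs on stacks, compiled
  to Turing machines, yield a class of functions closed under composition, pairing and polynomially
  bounded iteration, in which everything else is expressed.
*)
theory Submission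
  imports Defs
begin

section \<open>Polynomial bounds\<close>

text \<open>For a model \<open>I\<close> of \<open>R\<close> and any \<open>J\<close>, optimality of
  \<open>I\<close> bounds the ratio w1/w2 from below when the distance to \<open>K2\<close> drops
  and the one to \<open>K1\<close> grows from \<open>I\<close> to \<open>J\<close>, and from above
  in the opposite case; the bound is strict if \<open>J\<close> is no model of \<open>R\<close>.
  This is why a refutation has one pair of each kind. Queries certify bounds on distances and not
  exact differences, so soundness of the test for incompatibility is proved for one-sided bounds.
  The distance problem is a promise problem, and a language deciding it is arbitrary on other words.
  On an instance, queries are therefore built from certificates by functions whose values are always
  codes of the promised kind. The hierarchy starts from machines, and closing its base level under
  preimages and Boolean combinations means running given machines as subroutines. Hence programs are
  translated to machines and machines back to programs. Stores have infinitely many tapes, each seen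
  from its head: a tape is then a stack, and programs for different numbers of tapes compose
  directly.\<close>

lemma poly_nat_mono: "m \<le> n \<Longrightarrow> poly p m \<le> poly p n" for p :: "nat poly"
  by (induction p) (auto intro!: add_mono mult_mono)

text \<open>The bounded function takes the word and not its length, so the running time of a
  composition can be \<open>T (f x)\<close> without any monotonicity of \<open>T\<close>.\<close>

definition poly_bounded :: "(bool list \<Rightarrow> nat) \<Rightarrow> bool" where
  "poly_bounded h \<longleftrightarrow> (\<exists>p :: nat poly. \<forall>x. h x \<le> poly p (length x))"

lemma poly_bounded_mono: "poly_bounded h \<Longrightarrow> (\<And>x. g x \<le> h x) \<Longrightarrow> poly_bounded g"
  unfolding poly_bounded_def by (meson le_trans)

lemma poly_bounded_length: "poly_bounded length"
  unfolding poly_bounded_def by (rule exI[of _ "[:0, 1:]"]) simp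

lemma poly_bounded_const: "poly_bounded (\<lambda>x. c)"
  unfolding poly_bounded_def by (rule exI[of _ "[:c:]"]) simp

lemma poly_bounded_add: "poly_bounded g \<Longrightarrow> poly_bounded h \<Longrightarrow> poly_bounded (\<lambda>x. g x + h x)"
  unfolding poly_bounded_def by (metis add_mono poly_add)

lemma poly_bounded_mult: "poly_bounded g \<Longrightarrow> poly_bounded h \<Longrightarrow> poly_bounded (\<lambda>x. g x * h x)"
  unfolding poly_bounded_def by (metis mult_le_mono poly_mult)

lemma poly_bounded_Suc: "poly_bounded g \<Longrightarrow> poly_bounded (\<lambda>x. Suc (g x))"
  using poly_bounded_add[OF poly_bounded_const[of 1]] by simp

lemma poly_bounded_poly:
  assumes "poly_bounded g" shows "poly_bounded (\<lambda>x. poly p (g x))"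
proof -
  from assms obtain q where q: "\<And>x. g x \<le> poly q (length x)"
    unfolding poly_bounded_def by blast
  have "poly p (g x) \<le> poly (pcompose p q) (length x)" for x
    using poly_nat_mono[OF q[of x]] by (simp add: poly_pcompose)
  then show ?thesis
    unfolding poly_bounded_def by blast
qed

lemma poly_bounded_comp:
  assumes "poly_bounded h" "poly_bounded (\<lambda>x. length (f x))"
  shows "poly_bounded (\<lambda>x. h (f x))"
proof -
  from assms(1) obtain p where "\<And>x. h x \<le> poly p (length x)"
    unfolding poly_bounded_def by blast
  then show ?thesis
    by (intro poly_bounded_mono[OF poly_bounded_poly[OF assms(2), of p]])
qed

lemmas poly_bounded_intros =
  poly_bounded_length poly_bounded_const poly_bounded_add poly_bounded_mult poly_bounded_Suc
  poly_bounded_poly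

section \<open>Structured programs on tapes\<close>

text \<open>A tape as seen from its head, which is at position 0.\<close>

type_synonym rtape = "int \<Rightarrow> nat"
type_synonym store = "nat \<Rightarrow> rtape"

definition rel_tape :: "tape \<Rightarrow> rtape" where
  "rel_tape T = (\<lambda>j. fst T (snd T + j))"

fun offset :: "move \<Rightarrow> int" where
  "offset MoveLeft = - 1"
| "offset Stay = 0"
| "offset MoveRight = 1"

definition rel_update :: "nat \<times> move \<Rightarrow> rtape \<Rightarrow> rtape" where
  "rel_update a T = (\<lambda>j. (T(0 := fst a)) (j + offset (snd a)))"

lemma rel_tape_update: "rel_tape (update_tape a T) = rel_update a (rel_tape T)"
proof -
  obtain s m c h where [simp]: "a = (s, m)" "T = (c, h)" by (metis surj_pair)
  show ?thesis
    by (cases m) (auto simp: rel_tape_def rel_update_def fun_eq_iff algebra_simps)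
qed

lemma rel_update_Stay [simp]: "rel_update (T 0, Stay) T = T"
  by (auto simp: rel_update_def)

lemma rel_update_Stay0 [simp]: "rel_update (s, Stay) T 0 = s"
  by (auto simp: rel_update_def)

text \<open>Guards and steps are arbitrary functions of the symbols under all heads;
  \<open>wf_prog\<close> confines them to finitely many tapes and symbols.\<close>

datatype prog =
    Step "(nat \<Rightarrow> nat) \<Rightarrow> nat \<Rightarrow> nat \<times> move"
  | Seq prog prog
  | Cond "(nat \<Rightarrow> nat) \<Rightarrow> bool" prog prog
  | While "(nat \<Rightarrow> nat) \<Rightarrow> bool" prog

definition reads :: "store \<Rightarrow> nat \<Rightarrow> nat" where
  "reads \<sigma> = (\<lambda>i. \<sigma> i 0)"

definition act :: "(nat \<Rightarrow> nat \<times> move) \<Rightarrow> store \<Rightarrow> store" where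
  "act a \<sigma> = (\<lambda>i. rel_update (a i) (\<sigma> i))"

lemma rel_update_reads: "rel_update (reads \<sigma> j, Stay) (\<sigma> j) = \<sigma> j"
  by (simp add: reads_def)

text \<open>The counter is exactly the number of steps of the compiled code: one for each step and
  each evaluation of a guard, none for sequencing.\<close>

inductive exec :: "prog \<Rightarrow> store \<Rightarrow> nat \<Rightarrow> store \<Rightarrow> bool" where
  Step: "exec (Step f) \<sigma> 1 (act (f (reads \<sigma>)) \<sigma>)"
| Seq: "exec c \<sigma> t \<tau> \<Longrightarrow> exec d \<tau> u \<rho> \<Longrightarrow> exec (Seq c d) \<sigma> (t + u) \<rho>"
| CondT: "P (reads \<sigma>) \<Longrightarrow> exec c \<sigma> t \<tau> \<Longrightarrow> exec (Cond P c d) \<sigma> (Suc t) \<tau>"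
| CondF: "\<not> P (reads \<sigma>) \<Longrightarrow> exec d \<sigma> t \<tau> \<Longrightarrow> exec (Cond P c d) \<sigma> (Suc t) \<tau>"
| WhileF: "\<not> P (reads \<sigma>) \<Longrightarrow> exec (While P c) \<sigma> 1 \<sigma>"
| WhileT: "P (reads \<sigma>) \<Longrightarrow> exec c \<sigma> t \<tau> \<Longrightarrow> exec (While P c) \<tau> u \<rho> \<Longrightarrow>
    exec (While P c) \<sigma> (Suc (t + u)) \<rho>"

definition runs :: "prog \<Rightarrow> store \<Rightarrow> nat \<Rightarrow> store \<Rightarrow> bool" where
  "runs c \<sigma> T \<tau> \<longleftrightarrow> (\<exists>t\<le>T. exec c \<sigma> t \<tau>)"

lemma runs_mono: "runs c \<sigma> T \<tau> \<Longrightarrow> T \<le> T' \<Longrightarrow> runs c \<sigma> T' \<tau>"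
  unfolding runs_def by (meson le_trans)

lemma runs_cong: "runs c \<sigma> T \<tau> \<Longrightarrow> T \<le> T' \<Longrightarrow> \<tau> = \<tau>' \<Longrightarrow> runs c \<sigma> T' \<tau>'"
  using runs_mono by simp

lemma runs_Step: "act (f (reads \<sigma>)) \<sigma> = \<tau> \<Longrightarrow> runs (Step f) \<sigma> 1 \<tau>"
  unfolding runs_def using exec.Step by blast

lemma runs_Seq: "runs c \<sigma> t \<tau> \<Longrightarrow> runs d \<tau> u \<rho> \<Longrightarrow> runs (Seq c d) \<sigma> (t + u) \<rho>"
  unfolding runs_def by (meson add_mono exec.Seq)

lemma runs_CondT: "P (reads \<sigma>) \<Longrightarrow> runs c \<sigma> t \<tau> \<Longrightarrow> runs (Cond P c d) \<sigma> (Suc t) \<tau>"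
  unfolding runs_def by (meson Suc_le_mono exec.CondT)

lemma runs_CondF: "\<not> P (reads \<sigma>) \<Longrightarrow> runs d \<sigma> t \<tau> \<Longrightarrow> runs (Cond P c d) \<sigma> (Suc t) \<tau>"
  unfolding runs_def by (meson Suc_le_mono exec.CondF)

lemma runs_WhileF: "\<not> P (reads \<sigma>) \<Longrightarrow> runs (While P c) \<sigma> 1 \<sigma>"
  unfolding runs_def by (meson exec.WhileF le_refl)

lemma runs_WhileT: "P (reads \<sigma>) \<Longrightarrow> runs c \<sigma> t \<tau> \<Longrightarrow> runs (While P c) \<tau> u \<rho> \<Longrightarrow>
    runs (While P c) \<sigma> (Suc (t + u)) \<rho>"
  unfolding runs_def by (meson Suc_le_mono add_mono exec.WhileT)

definition local_guard :: "nat \<Rightarrow> ((nat \<Rightarrow> nat) \<Rightarrow> bool) \<Rightarrow> bool" where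
  "local_guard K P \<longleftrightarrow> (\<forall>r r'. (\<forall>j<K. r j = r' j) \<longrightarrow> P r = P r')"

lemma local_guardD: "local_guard K P \<Longrightarrow> (\<And>j. j < K \<Longrightarrow> r j = r' j) \<Longrightarrow> P r = P r'"
  unfolding local_guard_def by blast

text \<open>\<open>K\<close> bounds the tapes that are inspected or changed, \<open>S\<close> the
  symbols that are written anew. Writing back the symbol just read is always allowed, so that
  leaving a tape alone is well formed for any reading, even one outside the alphabet.\<close>

primrec wf_prog :: "nat \<Rightarrow> nat \<Rightarrow> prog \<Rightarrow> bool" where
  "wf_prog K S (Step f) \<longleftrightarrow>
     (\<forall>r j. (K \<le> j \<longrightarrow> f r j = (r j, Stay)) \<and> (fst (f r j) < S \<or> fst (f r j) = r j)) \<and>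
     (\<forall>r r'. (\<forall>j<K. r j = r' j) \<longrightarrow> (\<forall>j<K. f r j = f r' j))"
| "wf_prog K S (Seq c d) \<longleftrightarrow> wf_prog K S c \<and> wf_prog K S d"
| "wf_prog K S (Cond P c d) \<longleftrightarrow> local_guard K P \<and> wf_prog K S c \<and> wf_prog K S d"
| "wf_prog K S (While P c) \<longleftrightarrow> local_guard K P \<and> wf_prog K S c"

lemma local_guard_mono: "local_guard K P \<Longrightarrow> K \<le> K' \<Longrightarrow> local_guard K' P"
  unfolding local_guard_def by (meson le_trans less_le_trans)

lemma wf_prog_mono:
  assumes "wf_prog K S c" "K \<le> K'" "S \<le> S'" shows "wf_prog K' S' c"
  using assms(1)
proof (induction c)
  case (Step f)
  have *: "K \<le> j \<Longrightarrow> f r j = (r j, Stay)" "fst (f r j) < S \<or> fst (f r j) = r j"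
    "(\<And>j. j < K \<Longrightarrow> r j = r' j) \<Longrightarrow> j < K \<Longrightarrow> f r j = f r' j" for r r' j
    using Step by simp_all
  show ?case
    unfolding wf_prog.simps
  proof (intro conjI allI impI)
    fix r r' :: "nat \<Rightarrow> nat" and j
    show "K' \<le> j \<Longrightarrow> f r j = (r j, Stay)" using *(1) assms(2) by simp
    show "fst (f r j) < S' \<or> fst (f r j) = r j" using *(2)[of r j] assms(3) by linarith
    assume "\<forall>j<K'. r j = r' j" "j < K'"
    then show "f r j = f r' j" using *(1)[of j r] *(1)[of j r'] *(3)[of r r' j] assms(2)
      by (cases "j < K") auto
  qed
qed (use assms(2) in \<open>auto intro: local_guard_mono\<close>)

section \<open>From programs to Turing machines\<close>

text \<open>
  \<open>code c a b\<close> is the transition function of a machine that executes \<open>c\<close> from its entry state \<open>a\<close>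
  and leaves to state \<open>b\<close>; it occupies the states from \<open>a\<close> to \<open>a + code_size c - 1\<close>.
\<close>

primrec code_size :: "prog \<Rightarrow> nat" where
  "code_size (Step f) = 1"
| "code_size (Seq c d) = code_size c + code_size d"
| "code_size (Cond P c d) = 1 + code_size c + code_size d"
| "code_size (While P c) = 1 + code_size c"

definition idle :: "(nat \<Rightarrow> nat) \<Rightarrow> nat \<Rightarrow> nat \<times> move" where
  "idle r j = (r j, Stay)"

primrec code :: "prog \<Rightarrow> nat \<Rightarrow> nat \<Rightarrow> nat \<Rightarrow> (nat \<Rightarrow> nat) \<Rightarrow> nat \<times> (nat \<Rightarrow> nat \<times> move)" where
  "code (Step f) a b q r = (b, f r)"
| "code (Seq c d) a b q r =
    (if q < a + code_size c then code c a (a + code_size c) q r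
     else code d (a + code_size c) b q r)"
| "code (Cond P c d) a b q r =
    (if q = a then (if P r then a + 1 else a + 1 + code_size c, idle r)
     else if q < a + 1 + code_size c then code c (a + 1) b q r
     else code d (a + 1 + code_size c) b q r)"
| "code (While P c) a b q r =
    (if q = a then (if P r then a + 1 else b, idle r) else code c (a + 1) a q r)"

definition machine_step ::
  "(nat \<Rightarrow> (nat \<Rightarrow> nat) \<Rightarrow> nat \<times> (nat \<Rightarrow> nat \<times> move)) \<Rightarrow> nat \<times> store \<Rightarrow> nat \<times> store" where
  "machine_step D = (\<lambda>(q, \<sigma>). (fst (D q (reads \<sigma>)), act (snd (D q (reads \<sigma>))) \<sigma>))"

lemma act_idle [simp]: "act (idle (reads \<sigma>)) \<sigma> = \<sigma>"
  by (auto simp: act_def idle_def reads_def)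

lemma code_size_pos: "0 < code_size c"
  by (induction c) auto

text \<open>\<open>D\<close> belongs to the whole machine and is constrained only on the states that
  \<open>c\<close> occupies, so the parts of a program can lie side by side. The exit
  \<open>b\<close> is arbitrary because the body of a loop leaves to the entry of the loop.\<close>

lemma code_correct:
  assumes "exec c \<sigma> t \<tau>" "\<And>q. a \<le> q \<Longrightarrow> q < a + code_size c \<Longrightarrow> D q = code c a b q"
  shows "(machine_step D ^^ t) (a, \<sigma>) = (b, \<tau>)"
  using assms
proof (induction arbitrary: a b)
  case (Step f \<sigma>)
  then show ?case by (simp add: machine_step_def)
next
  case (Seq c \<sigma> t \<tau> d u \<rho>)
  let ?m = "a + code_size c"
  have "(machine_step D ^^ t) (a, \<sigma>) = (?m, \<tau>)"
    using Seq.prems by (intro Seq.IH(1)) (auto simp: fun_eq_iff)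
  moreover have "(machine_step D ^^ u) (?m, \<tau>) = (b, \<rho>)"
    using Seq.prems by (intro Seq.IH(2)) (auto simp: fun_eq_iff)
  ultimately show ?case
    by (simp add: add.commute[of t] funpow_add)
next
  case (CondT P \<sigma> c t \<tau> d)
  have "machine_step D (a, \<sigma>) = (a + 1, \<sigma>)"
    using CondT.prems[of a] CondT.hyps by (simp add: machine_step_def)
  moreover have "(machine_step D ^^ t) (a + 1, \<sigma>) = (b, \<tau>)"
    using CondT.prems by (intro CondT.IH) (auto simp: fun_eq_iff)
  ultimately show ?case
    by (simp add: funpow_Suc_right del: funpow.simps)
next
  case (CondF P \<sigma> d t \<tau> c)
  have "machine_step D (a, \<sigma>) = (a + 1 + code_size c, \<sigma>)"
    using CondF.prems[of a] CondF.hyps by (simp add: machine_step_def)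
  moreover have "(machine_step D ^^ t) (a + 1 + code_size c, \<sigma>) = (b, \<tau>)"
    using CondF.prems by (intro CondF.IH) (auto simp: fun_eq_iff)
  ultimately show ?case
    by (simp add: funpow_Suc_right del: funpow.simps)
next
  case (WhileF P \<sigma> c)
  then show ?case by (simp add: machine_step_def)
next
  case (WhileT P \<sigma> c t \<tau> u \<rho>)
  have "machine_step D (a, \<sigma>) = (a + 1, \<sigma>)"
    using WhileT.prems[of a] WhileT.hyps by (simp add: machine_step_def)
  moreover have "(machine_step D ^^ t) (a + 1, \<sigma>) = (a, \<tau>)"
    using WhileT.prems by (intro WhileT.IH(1)) (auto simp: fun_eq_iff)
  moreover have "(machine_step D ^^ u) (a, \<tau>) = (b, \<rho>)"
    using WhileT.prems by (intro WhileT.IH(2)) auto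
  ultimately show ?case
    by (simp add: funpow_Suc_right add.commute[of t] funpow_add del: funpow.simps)
qed

lemma code_wf:
  assumes "wf_prog K S c" "a \<le> q" "q < a + code_size c" "code c a b q r = (q', acts)"
  shows "(a \<le> q' \<and> q' < a + code_size c \<or> q' = b) \<and> (\<forall>j. fst (acts j) < S \<or> fst (acts j) = r j)"
  using assms
proof (induction c arbitrary: a b q r q' acts)
  case (Step f)
  then show ?case by auto
next
  case (Seq c d)
  show ?case
  proof (cases "q < a + code_size c")
    case True
    then show ?thesis
      using Seq.IH(1)[of a q "a + code_size c" r q' acts] Seq.prems code_size_pos[of d] by auto
  next
    case False
    then show ?thesis
      using Seq.IH(2)[of "a + code_size c" q b r q' acts] Seq.prems by auto
  qed
next
  case (Cond P c d)
  consider "q = a" | "q \<noteq> a" "q < a + 1 + code_size c" | "q \<ge> a + 1 + code_size c"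
    by linarith
  then show ?case
  proof cases
    case 1
    then show ?thesis
      using Cond.prems code_size_pos[of c] code_size_pos[of d] by (auto simp: idle_def)
  next
    case 2
    then show ?thesis
      using Cond.IH(1)[of "a + 1" q b r q' acts] Cond.prems by auto
  next
    case 3
    then show ?thesis
      using Cond.IH(2)[of "a + 1 + code_size c" q b r q' acts] Cond.prems by auto
  qed
next
  case (While P c)
  show ?case
  proof (cases "q = a")
    case True
    then show ?thesis
      using While.prems code_size_pos[of c] by (auto simp: idle_def split: if_splits)
  next
    case False
    then show ?thesis
      using While.IH[of "a + 1" q a r q' acts] While.prems by auto
  qed
qed

text \<open>Makes the padding of readings by 0 harmless: a machine with \<open>K\<close> tapes sees
  only the first \<open>K\<close> symbols of a store.\<close>

lemma code_local:
  assumes "wf_prog K S c" "\<And>j. j < K \<Longrightarrow> r j = r' j"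
  shows "fst (code c a b q r) = fst (code c a b q r') \<and>
    (\<forall>j<K. snd (code c a b q r) j = snd (code c a b q r') j)"
  using assms
proof (induction c arbitrary: a b)
  case (Step f)
  then show ?case by simp
next
  case (Cond P c d)
  moreover have "P r = P r'"
    using Cond.prems by (intro local_guardD) auto
  ultimately show ?case by (simp add: idle_def)
next
  case (While P c)
  moreover have "P r = P r'"
    using While.prems by (intro local_guardD) auto
  ultimately show ?case by (simp add: idle_def)
qed auto

text \<open>The layout of an input tape in coordinates relative to a head on the first cell. Read as
  a stack, its top is under the head.\<close>

definition list_tape :: "bool list \<Rightarrow> rtape" where
  "list_tape xs = (\<lambda>j. if 0 \<le> j \<and> j < int (length xs) then (if xs ! nat j then 2 else 1) else 0)"

definition list_store :: "(nat \<Rightarrow> bool list) \<Rightarrow> store" where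
  "list_store v = (\<lambda>i. list_tape (v i))"

definition input_store :: "bool list \<Rightarrow> store" where
  "input_store x = list_store ((\<lambda>_. [])(0 := x))"

definition pad_reads :: "nat list \<Rightarrow> nat \<Rightarrow> nat" where
  "pad_reads rs j = (if j < length rs then rs ! j else 0)"

text \<open>State 0 only jumps to the code, which starts at state 3, past the halting states.\<close>

definition prog_delta ::
    "prog \<Rightarrow> ((nat \<Rightarrow> nat) \<Rightarrow> bool) \<Rightarrow> nat \<Rightarrow> (nat \<Rightarrow> nat) \<Rightarrow> nat \<times> (nat \<Rightarrow> nat \<times> move)" where
  "prog_delta c P q r =
     (if q = 0 then (3, idle r)
      else if q < 3 then (q, idle r)
      else if q < 3 + code_size c then code c 3 (3 + code_size c) q r
      else (if P r then 1 else 2, idle r))"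

text \<open>The states are the three special ones, those of the code, and one in which
  \<open>P\<close> gives the verdict.\<close>

definition prog_tm :: "nat \<Rightarrow> nat \<Rightarrow> prog \<Rightarrow> ((nat \<Rightarrow> nat) \<Rightarrow> bool) \<Rightarrow> tm" where
  "prog_tm K S c P = \<lparr>num_tapes = K, num_symbols = S, num_states = 4 + code_size c,
     delta = (\<lambda>q rs. let (q', a) = prog_delta c P q (pad_reads rs) in (q', map a [0..<K]))\<rparr>"

lemma wf_prog_tm:
  assumes "wf_prog K S c" "0 < K" "3 \<le> S"
  shows "wf_tm (prog_tm K S c P)"
proof -
  have "fst (prog_delta c P q (pad_reads rs)) < 4 + code_size c \<and>
     (\<forall>j<K. fst (snd (prog_delta c P q (pad_reads rs)) j) < S)"
    if "q < 4 + code_size c" "length rs = K" "set rs \<subseteq> {..<S}" for q rs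
  proof -
    have r: "pad_reads rs j < S" for j
      using that assms(3) by (auto simp: pad_reads_def subset_iff)
    show ?thesis
    proof (cases "3 \<le> q \<and> q < 3 + code_size c")
      case True
      obtain q' acts where e: "code c 3 (3 + code_size c) q (pad_reads rs) = (q', acts)"
        by fastforce
      show ?thesis
        using code_wf[OF assms(1) _ _ e] True e r by (force simp: prog_delta_def)
    next
      case False
      then show ?thesis
        using r that by (auto simp: prog_delta_def idle_def)
    qed
  qed
  then show ?thesis
    using assms by (auto simp: wf_tm_def prog_tm_def Let_def split: prod.splits) (metis fst_conv snd_conv)+
qed

definition represents :: "nat \<Rightarrow> config \<Rightarrow> nat \<times> store \<Rightarrow> bool" where
  "represents K cf ms \<longleftrightarrow> fst cf = fst ms \<and> length (snd cf) = K \<and>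
     (\<forall>j<K. rel_tape (snd cf ! j) = snd ms j)"

lemma prog_delta_local:
  assumes "wf_prog K S c" "local_guard K P" "\<And>j. j < K \<Longrightarrow> r j = r' j"
  shows "fst (prog_delta c P q r) = fst (prog_delta c P q r') \<and>
    (\<forall>j<K. snd (prog_delta c P q r) j = snd (prog_delta c P q r') j)"
  using code_local[OF assms(1,3)] local_guardD[OF assms(2), of r r'] assms(3)
  by (simp add: prog_delta_def idle_def)

lemma represents_step:
  assumes "wf_prog K S c" "local_guard K P" "represents K cf ms" "fst ms \<notin> {1, 2}"
  shows "represents K (tm_step (prog_tm K S c P) cf) (machine_step (prog_delta c P) ms)"
proof -
  obtain q ts \<sigma> where [simp]: "cf = (q, ts)" "ms = (q, \<sigma>)" and l: "length ts = K"
    and ts: "\<And>j. j < K \<Longrightarrow> rel_tape (ts ! j) = \<sigma> j"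
    using assms(3) by (cases cf; cases ms) (auto simp: represents_def)
  let ?r = "pad_reads (map (\<lambda>(c, h). c h) ts)"
  have "?r j = reads \<sigma> j" if "j < K" for j
    using that l ts[OF that, symmetric]
    by (simp add: pad_reads_def reads_def rel_tape_def split: prod.splits)
  then have *: "fst (prog_delta c P q ?r) = fst (prog_delta c P q (reads \<sigma>))"
    "\<And>j. j < K \<Longrightarrow> snd (prog_delta c P q ?r) j = snd (prog_delta c P q (reads \<sigma>)) j"
    using prog_delta_local[OF assms(1,2)] by blast+
  have "tm_step (prog_tm K S c P) cf =
      (fst (prog_delta c P q ?r), map2 update_tape (map (snd (prog_delta c P q ?r)) [0..<K]) ts)"
    using assms(4) by (simp add: tm_step_def prog_tm_def Let_def split: prod.splits)
  then show ?thesis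
    using * l ts by (simp add: represents_def machine_step_def act_def rel_tape_update)
qed

lemma machine_halted:
  "fst ms \<in> {1, 2} \<Longrightarrow> fst ((machine_step (prog_delta c P) ^^ t) ms) = fst ms"
  by (induction t) (auto simp: machine_step_def prog_delta_def split: prod.splits)

lemma represents_steps:
  assumes "wf_prog K S c" "local_guard K P" "represents K cf ms"
  shows "fst ((tm_step (prog_tm K S c P) ^^ t) cf) = fst ((machine_step (prog_delta c P) ^^ t) ms)"
  using assms(3)
proof (induction t arbitrary: cf ms)
  case 0
  then show ?case by (simp add: represents_def)
next
  case (Suc t)
  show ?case
  proof (cases "fst ms \<in> {1, 2}")
    case True
    then have "tm_step (prog_tm K S c P) cf = cf"
      using Suc.prems by (auto simp: represents_def tm_step_def)
    then have "(tm_step (prog_tm K S c P) ^^ Suc t) cf = (tm_step (prog_tm K S c P) ^^ t) cf"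
      by (simp add: funpow_Suc_right del: funpow.simps)
    then show ?thesis
      using Suc.IH[OF Suc.prems] machine_halted[OF True] by metis
  next
    case False
    show ?thesis
      using Suc.IH[OF represents_step[OF assms(1,2) Suc.prems False]]
      by (simp add: funpow_Suc_right del: funpow.simps)
  qed
qed

lemma rel_tape_input: "rel_tape (input_tape x) = list_tape x"
  by (simp add: rel_tape_def input_tape_def list_tape_def)

lemma rel_tape_blank: "rel_tape blank_tape = list_tape []"
  by (auto simp: rel_tape_def blank_tape_def list_tape_def)

lemma represents_init:
  assumes "0 < num_tapes M"
  shows "represents (num_tapes M) (init_config M x) (0, input_store x)"
  using assms
  by (auto simp: represents_def init_config_def input_store_def list_store_def nth_Cons
      rel_tape_input rel_tape_blank split: nat.splits)

lemma prog_decides_P: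
  assumes wf: "wf_prog K S c" "local_guard K P" "0 < K" "3 \<le> S"
    and T: "poly_bounded T" and run: "\<And>x. \<exists>\<tau>. runs c (input_store x) (T x) \<tau> \<and> (P (reads \<tau>) \<longleftrightarrow> x \<in> A)"
  shows "A \<in> P_class"
proof -
  let ?M = "prog_tm K S c P" and ?D = "prog_delta c P"
  \<comment> \<open>The 2 pays for the jump out of state 0 and for the evaluation of
    \<open>P\<close>.\<close>
  obtain p where p: "\<And>x. T x + 2 \<le> poly p (length x)"
    using poly_bounded_add[OF T poly_bounded_const[of 2]] unfolding poly_bounded_def by blast
  have "\<exists>t \<le> poly p (length x). tm_state_after ?M x t = (if x \<in> A then 1 else 2)" for x
  proof -
    obtain \<tau> t where t: "t \<le> T x" and e: "exec c (input_store x) t \<tau>"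
      and P: "P (reads \<tau>) \<longleftrightarrow> x \<in> A"
      using run[of x] unfolding runs_def by blast
    have "machine_step ?D (0, input_store x) = (3, input_store x)"
      by (simp add: machine_step_def prog_delta_def)
    moreover have "(machine_step ?D ^^ t) (3, input_store x) = (3 + code_size c, \<tau>)"
      using e by (rule code_correct) (auto simp: prog_delta_def fun_eq_iff)
    moreover have "machine_step ?D (3 + code_size c, \<tau>) = (if x \<in> A then 1 else 2, \<tau>)"
      using P by (simp add: machine_step_def prog_delta_def)
    ultimately have "(machine_step ?D ^^ Suc (Suc t)) (0, input_store x)
        = (if x \<in> A then 1 else 2, \<tau>)"
      by (subst funpow.simps(2), subst funpow_Suc_right) simp
    then have "fst ((machine_step ?D ^^ Suc (Suc t)) (0, input_store x)) = (if x \<in> A then 1 else 2)"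
      by (simp only: fst_conv)
    moreover have "represents K (init_config ?M x) (0, input_store x)"
      using represents_init[of ?M x] wf(3) by (simp add: prog_tm_def)
    ultimately have "tm_state_after ?M x (Suc (Suc t)) = (if x \<in> A then 1 else 2)"
      unfolding tm_state_after_def by (simp only: represents_steps[OF wf(1,2)])
    moreover have "Suc (Suc t) \<le> poly p (length x)"
      using p[of x] t by linarith
    ultimately show ?thesis by blast
  qed
  then have "wf_tm ?M \<and> (\<forall>x. \<exists>t\<le>poly p (length x). tm_state_after ?M x t = (if x \<in> A then 1 else 2))"
    using wf_prog_tm[OF wf(1,3,4)] by simp
  then show ?thesis
    unfolding P_class_def by blast
qed

section \<open>From Turing machines to programs\<close>

text \<open>The machine runs on the \<open>k\<close> tapes from tape \<open>b\<close> on; its state is kept in a cell of the next tape.\<close>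

definition tm_prog :: "tm \<Rightarrow> nat \<Rightarrow> prog" where
  "tm_prog M b = (let k = num_tapes M; s = b + k in
     While (\<lambda>r. r s \<notin> {1, 2})
      (Step (\<lambda>r j.
         let rs = map r [b..<s] in
         if r s < num_states M \<and> set rs \<subseteq> {..<num_symbols M} then
           if j = s then (fst (delta M (r s) rs), Stay)
           else if b \<le> j \<and> j < s then snd (delta M (r s) rs) ! (j - b)
           else (r j, Stay)
         else (r j, Stay))))"

text \<open>\<open>delta\<close> is constrained on legal arguments only, so the program tests
  legality and otherwise leaves all tapes alone. As the state is stored like a symbol,
  \<open>S\<close> must also bound the number of states.\<close>

lemma wf_tm_prog:
  assumes "wf_tm M" "b + num_tapes M < K" "num_states M \<le> S" "num_symbols M \<le> S"
  shows "wf_prog K S (tm_prog M b)"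
proof -
  have map_eq: "map r [b..<b + num_tapes M] = map r' [b..<b + num_tapes M]"
    if "\<forall>j<K. r j = r' j" for r r' :: "nat \<Rightarrow> nat"
    using that assms(2) by simp
  have sym: "fst (delta M q (map r [b..<b + num_tapes M])) < S"
    "b \<le> j \<Longrightarrow> j < b + num_tapes M \<Longrightarrow>
      fst (snd (delta M q (map r [b..<b + num_tapes M])) ! (j - b)) < S"
    if q: "q < num_states M" "set (map r [b..<b + num_tapes M]) \<subseteq> {..<num_symbols M}"
    for q j and r :: "nat \<Rightarrow> nat"
  proof -
    let ?d = "delta M q (map r [b..<b + num_tapes M])"
    have "length (map r [b..<b + num_tapes M]) = num_tapes M" by simp
    then have *: "fst ?d < num_states M" "length (snd ?d) = num_tapes M"
      "fst ` set (snd ?d) \<subseteq> {..<num_symbols M}"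
      using assms(1) q unfolding wf_tm_def by blast+
    show "fst ?d < S" using *(1) assms(3) by linarith
    assume "b \<le> j" "j < b + num_tapes M"
    then have "snd ?d ! (j - b) \<in> set (snd ?d)" using *(2) by (intro nth_mem) linarith
    then have "fst (snd ?d ! (j - b)) < num_symbols M" using *(3) by blast
    then show "fst (snd ?d ! (j - b)) < S" using assms(4) by linarith
  qed
  have s: "b + num_tapes M < K" by fact
  show ?thesis
    unfolding tm_prog_def Let_def wf_prog.simps
  proof (intro conjI allI impI, goal_cases)
    case 1
    then show ?case using s by (simp add: local_guard_def)
  next
    case (2 r j)
    then show ?case using s by simp
  next
    case (3 r j)
    then show ?case
      using sym(1)[of "r (b + num_tapes M)" r] sym(2)[of "r (b + num_tapes M)" r j]
      by (simp del: set_map)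
  next
    case (4 r r' j)
    have "r (b + num_tapes M) = r' (b + num_tapes M)" "r j = r' j"
      using 4 s by blast+
    then show ?case
      using map_eq[OF 4(1)] by (simp only:)
  qed
qed

text \<open>The invariant under which the legality test of \<open>tm_prog\<close> succeeds.\<close>

definition valid_config :: "tm \<Rightarrow> config \<Rightarrow> bool" where
  "valid_config M cf \<longleftrightarrow> fst cf < num_states M \<and> length (snd cf) = num_tapes M \<and>
     (\<forall>T\<in>set (snd cf). \<forall>j. fst T j < num_symbols M)"

lemma valid_reads:
  "valid_config M (q, ts) \<Longrightarrow> set (map (\<lambda>(c, h). c h) ts) \<subseteq> {..<num_symbols M}"
  by (fastforce simp: valid_config_def)

lemma valid_step:
  assumes "wf_tm M" "valid_config M cf"
  shows "valid_config M (tm_step M cf)"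
proof (cases "fst cf \<in> {1, 2}")
  case True
  then show ?thesis using assms(2) by (simp add: tm_step_def)
next
  case False
  obtain q ts where [simp]: "cf = (q, ts)" by fastforce
  let ?rs = "map (\<lambda>(c, h). c h) ts"
  obtain q' acts where d: "delta M q ?rs = (q', acts)" by fastforce
  have q': "q' < num_states M" "length acts = num_tapes M" "fst ` set acts \<subseteq> {..<num_symbols M}"
    using assms valid_reads[of M q ts] d unfolding wf_tm_def valid_config_def
    by (metis \<open>cf = (q, ts)\<close> fst_conv length_map snd_conv)+
  have "fst (update_tape a T) j < num_symbols M"
    if "(a, T) \<in> set (zip acts ts)" for a T j
  proof -
    have T: "fst a < num_symbols M" "\<forall>j. fst T j < num_symbols M"
      using set_zip_leftD[OF that] set_zip_rightD[OF that] q'(3) assms(2)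
      by (auto simp: valid_config_def)
    obtain s m c h where "a = (s, m)" "T = (c, h)" by (metis surj_pair)
    then show ?thesis using T by simp
  qed
  then show ?thesis
    using False q' assms(2) d by (auto simp: tm_step_def valid_config_def)
qed

text \<open>Each simulated step costs a test of the state and a step; the final 1 is the test that
  ends the loop. Apart from the verdict nothing is said about the tapes of the machine, but all
  others are unchanged, so another machine can run next to it.\<close>

lemma tm_prog_correct:
  assumes M: "wf_tm M" and "(tm_step M ^^ t) (q, ts) = (q', ts')" "q' \<in> {1, 2}"
    and "valid_config M (q, ts)"
    and "\<And>j. j < num_tapes M \<Longrightarrow> rel_tape (ts ! j) = \<sigma> (b + j)"
    and "\<sigma> (b + num_tapes M) 0 = q"
  shows "\<exists>\<tau>. runs (tm_prog M b) \<sigma> (2 * t + 1) \<tau> \<and> \<tau> (b + num_tapes M) 0 = q' \<and>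
    (\<forall>j. j < b \<or> b + num_tapes M < j \<longrightarrow> \<tau> j = \<sigma> j)"
  using assms(2-)
proof (induction t arbitrary: q ts \<sigma>)
  case 0
  have "runs (tm_prog M b) \<sigma> 1 \<sigma>"
    unfolding tm_prog_def Let_def using 0 by (intro runs_WhileF) (auto simp: reads_def)
  then show ?case using 0 by (intro exI[of _ \<sigma>]) auto
next
  case (Suc t)
  let ?k = "num_tapes M"
  show ?case
  proof (cases "q \<in> {1, 2}")
    case True
    \<comment> \<open>The machine has halted before the steps are used up; its configuration then
      stays fixed.\<close>
    then have "tm_step M (q, ts) = (q, ts)" by (simp add: tm_step_def)
    then have "(tm_step M ^^ t) (q, ts) = (q', ts')"
      using Suc.prems(1) by (simp add: funpow_Suc_right del: funpow.simps)
    from Suc.IH[OF this Suc.prems(2-5)] obtain \<tau> where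
      "runs (tm_prog M b) \<sigma> (2 * t + 1) \<tau>" "\<tau> (b + ?k) 0 = q'"
      "\<forall>j. j < b \<or> b + ?k < j \<longrightarrow> \<tau> j = \<sigma> j" by blast
    then show ?thesis by (intro exI[of _ \<tau>]) (auto elim: runs_mono)
  next
    case False
    let ?rs = "map (\<lambda>(c, h). c h) ts"
    obtain q1 acts where d: "delta M q ?rs = (q1, acts)" by fastforce
    have ts: "q < num_states M" "length ts = ?k" "set ?rs \<subseteq> {..<num_symbols M}"
      using Suc.prems(3) valid_reads[OF Suc.prems(3)] by (auto simp: valid_config_def)
    have acts: "length acts = ?k"
      using M ts d unfolding wf_tm_def by (metis length_map snd_conv)
    have rs: "map (reads \<sigma>) [b..<b + ?k] = ?rs"
    proof (rule nth_equalityI)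
      fix j assume "j < length (map (reads \<sigma>) [b..<b + ?k])"
      then have "j < ?k" by simp
      then show "map (reads \<sigma>) [b..<b + ?k] ! j = ?rs ! j"
        using ts(2) Suc.prems(4)[of j, symmetric]
        by (simp add: reads_def rel_tape_def split: prod.splits)
    qed (use ts in simp)
    have s: "reads \<sigma> (b + ?k) = q" using Suc.prems(5) by (simp add: reads_def)
    define ts1 where "ts1 = map2 update_tape acts ts"
    define \<sigma>1 where "\<sigma>1 = (\<lambda>j. if j = b + ?k then rel_update (q1, Stay) (\<sigma> j)
      else if b \<le> j \<and> j < b + ?k then rel_update (acts ! (j - b)) (\<sigma> j) else \<sigma> j)"
    have step: "tm_step M (q, ts) = (q1, ts1)"
      using False d by (simp add: tm_step_def ts1_def)
    have "(tm_step M ^^ t) (q1, ts1) = (q', ts')"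
      using Suc.prems(1) step by (simp add: funpow_Suc_right del: funpow.simps)
    moreover have "valid_config M (q1, ts1)"
      using valid_step[OF M Suc.prems(3)] step by simp
    moreover have "rel_tape (ts1 ! j) = \<sigma>1 (b + j)" if "j < ?k" for j
      using that acts ts(2) Suc.prems(4)[OF that]
      by (simp add: ts1_def \<sigma>1_def rel_tape_update)
    moreover have "\<sigma>1 (b + ?k) 0 = q1" by (simp add: \<sigma>1_def)
    ultimately obtain \<tau> where \<tau>: "runs (tm_prog M b) \<sigma>1 (2 * t + 1) \<tau>" "\<tau> (b + ?k) 0 = q'"
      "\<forall>j. j < b \<or> b + ?k < j \<longrightarrow> \<tau> j = \<sigma>1 j"
      using Suc.IH[OF _ Suc.prems(2), of q1 ts1 \<sigma>1] by blast
    have "runs (tm_prog M b) \<sigma> (Suc (1 + (2 * t + 1))) \<tau>"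
      unfolding tm_prog_def Let_def
    proof (rule runs_WhileT[where \<tau> = \<sigma>1], goal_cases)
      case 1
      then show ?case using False s by simp
    next
      case 2
      then show ?case
        unfolding \<sigma>1_def using ts d s
        by (intro runs_Step ext) (simp add: act_def rs s rel_update_reads del: set_map)
    next
      case 3
      then show ?case using \<tau>(1) unfolding tm_prog_def Let_def .
    qed
    then show ?thesis
      using \<tau>(2,3) by (intro exI[of _ \<tau>]) (auto simp: \<sigma>1_def)
  qed
qed

section \<open>Programs on stacks\<close>

definition top_true :: "bool list \<Rightarrow> bool" where
  "top_true xs \<longleftrightarrow> xs \<noteq> [] \<and> hd xs"

lemma top_true_simps [simp]: "\<not> top_true []" "top_true (b # xs) \<longleftrightarrow> b"
  by (simp_all add: top_true_def)

lemma list_tape_0: "list_tape xs 0 = (case xs of [] \<Rightarrow> 0 | b # _ \<Rightarrow> if b then 2 else 1)"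
  by (simp add: list_tape_def split: list.splits)

lemma runs_list_cong:
  assumes "runs c \<sigma> T (list_store v)" "T \<le> T'" "\<And>i. v i = w i"
  shows "runs c \<sigma> T' (list_store w)"
proof -
  have "v = w" using assms(3) by (rule ext)
  then show ?thesis using runs_mono[OF assms(1,2)] by simp
qed

lemma reads_nonempty: "reads (list_store v) i \<noteq> 0 \<longleftrightarrow> v i \<noteq> []"
  by (simp add: reads_def list_store_def list_tape_0 split: list.splits)

lemma reads_true: "reads (list_store v) i = 2 \<longleftrightarrow> top_true (v i)"
  by (simp add: reads_def list_store_def list_tape_0 split: list.splits)

definition pop :: "nat \<Rightarrow> prog" where
  "pop i = Step (\<lambda>r. (\<lambda>j. (r j, Stay))(i := (0, MoveRight)))"

text \<open>Two steps, because a machine writes before it moves: the old top is written back while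
  the head moves left.\<close>

definition push :: "nat \<Rightarrow> bool \<Rightarrow> prog" where
  "push i b = Seq (Step (\<lambda>r. (\<lambda>j. (r j, Stay))(i := (r i, MoveLeft))))
                  (Step (\<lambda>r. (\<lambda>j. (r j, Stay))(i := (if b then 2 else 1, Stay))))"

text \<open>On an empty stack the head just moves over blanks, so popping is total, like
  \<open>tl\<close>.\<close>

lemma list_tape_pop: "rel_update (0, MoveRight) (list_tape xs) = list_tape (tl xs)"
proof (cases xs)
  case (Cons b ys)
  then show ?thesis
    by (auto simp: rel_update_def list_tape_def fun_eq_iff nth_Cons' nat_add_distrib)
qed (auto simp: rel_update_def list_tape_def)

lemma list_tape_push:
  "rel_update (if b then 2 else 1, Stay) (rel_update (list_tape xs 0, MoveLeft) (list_tape xs))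
     = list_tape (b # xs)"
  by (auto simp: rel_update_def list_tape_def fun_eq_iff nth_Cons' nat_diff_distrib)

lemma runs_pop: "runs (pop i) (list_store v) 1 (list_store (v(i := tl (v i))))"
  unfolding pop_def
  by (rule runs_Step) (auto simp: act_def list_store_def fun_eq_iff list_tape_pop reads_def)

lemma runs_push: "runs (push i b) (list_store v) 2 (list_store (v(i := b # v i)))"
proof -
  let ?s = "(list_store v)(i := rel_update (list_tape (v i) 0, MoveLeft) (list_tape (v i)))"
  have "runs (push i b) (list_store v) (1 + 1) (list_store (v(i := b # v i)))"
    unfolding push_def
  proof (rule runs_Seq[OF runs_Step runs_Step])
    show "act (((\<lambda>j. (reads (list_store v) j, Stay))
        (i := (reads (list_store v) i, MoveLeft)))) (list_store v) = ?s"
      by (auto simp: act_def list_store_def fun_eq_iff reads_def)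
    show "act (((\<lambda>j. (reads ?s j, Stay))(i := (if b then 2 else 1, Stay)))) ?s
        = list_store (v(i := b # v i))"
      using list_tape_push[of b "v i"]
      by (auto simp: act_def list_store_def reads_def)
  qed
  then show ?thesis by (rule runs_mono) simp
qed

lemma wf_pop [simp]: "i < K \<Longrightarrow> 0 < S \<Longrightarrow> wf_prog K S (pop i)"
  by (auto simp: pop_def)

lemma wf_push [simp]: "i < K \<Longrightarrow> 3 \<le> S \<Longrightarrow> wf_prog K S (push i b)"
  by (auto simp: push_def)

lemma local_guard_read [simp]:
  "i < K \<Longrightarrow> local_guard K (\<lambda>r. r i \<noteq> a)" "i < K \<Longrightarrow> local_guard K (\<lambda>r. r i = a)"
  by (auto simp: local_guard_def)

definition if_nonempty :: "nat \<Rightarrow> prog \<Rightarrow> prog \<Rightarrow> prog" where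
  "if_nonempty i c d = Cond (\<lambda>r. r i \<noteq> 0) c d"

definition if_true :: "nat \<Rightarrow> prog \<Rightarrow> prog \<Rightarrow> prog" where
  "if_true i c d = Cond (\<lambda>r. r i = 2) c d"

definition while_nonempty :: "nat \<Rightarrow> prog \<Rightarrow> prog" where
  "while_nonempty i c = While (\<lambda>r. r i \<noteq> 0) c"

lemma wf_control [simp]:
  "i < K \<Longrightarrow> wf_prog K S (if_nonempty i c d) \<longleftrightarrow> wf_prog K S c \<and> wf_prog K S d"
  "i < K \<Longrightarrow> wf_prog K S (if_true i c d) \<longleftrightarrow> wf_prog K S c \<and> wf_prog K S d"
  "i < K \<Longrightarrow> wf_prog K S (while_nonempty i c) \<longleftrightarrow> wf_prog K S c"
  by (simp_all add: if_nonempty_def if_true_def while_nonempty_def local_guard_def)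

lemma runs_if_nonempty:
  assumes "v i \<noteq> [] \<Longrightarrow> runs c (list_store v) t \<tau>" "v i = [] \<Longrightarrow> runs d (list_store v) t \<tau>"
  shows "runs (if_nonempty i c d) (list_store v) (Suc t) \<tau>"
  unfolding if_nonempty_def using assms reads_nonempty[of v i]
  by (cases "v i = []") (auto intro: runs_CondT runs_CondF)

lemma runs_if_true:
  assumes "top_true (v i) \<Longrightarrow> runs c (list_store v) t \<tau>"
    "\<not> top_true (v i) \<Longrightarrow> runs d (list_store v) t \<tau>"
  shows "runs (if_true i c d) (list_store v) (Suc t) \<tau>"
  unfolding if_true_def using assms reads_true[of v i]
  by (cases "top_true (v i)") (auto intro: runs_CondT runs_CondF)

lemma runs_while_empty: "v i = [] \<Longrightarrow> runs (while_nonempty i c) (list_store v) 1 (list_store v)"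
  unfolding while_nonempty_def using reads_nonempty[of v i] by (intro runs_WhileF) auto

lemma runs_while_step:
  "v i \<noteq> [] \<Longrightarrow> runs c (list_store v) t \<tau> \<Longrightarrow> runs (while_nonempty i c) \<tau> u \<rho> \<Longrightarrow>
    runs (while_nonempty i c) (list_store v) (Suc (t + u)) \<rho>"
  unfolding while_nonempty_def using reads_nonempty[of v i] by (intro runs_WhileT) auto

definition clear :: "nat \<Rightarrow> prog" where
  "clear i = while_nonempty i (pop i)"

lemma runs_clear: "runs (clear i) (list_store v) (2 * length (v i) + 1) (list_store (v(i := [])))"
proof (induction "v i" arbitrary: v)
  case Nil
  then show ?case using runs_while_empty[of v i "pop i"] by (simp add: clear_def fun_upd_idem)
next
  case (Cons b xs)
  let ?w = "v(i := tl (v i))"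
  have "runs (clear i) (list_store ?w) (2 * length (?w i) + 1) (list_store (?w(i := [])))"
    using Cons.hyps(2)[symmetric] by (intro Cons.hyps(1)) simp
  then have "runs (clear i) (list_store v)
      (Suc (1 + (2 * length (?w i) + 1))) (list_store (?w(i := [])))"
    unfolding clear_def
    using Cons.hyps(2)[symmetric] by (intro runs_while_step[OF _ runs_pop]) auto
  then show ?case
    by (rule runs_cong) (use Cons.hyps(2)[symmetric] in auto)
qed

lemma wf_clear [simp]: "i < K \<Longrightarrow> 0 < S \<Longrightarrow> wf_prog K S (clear i)"
  by (simp add: clear_def)

section \<open>Moving and copying stacks\<close>

definition reverse_move :: "nat \<Rightarrow> nat \<Rightarrow> prog" where
  "reverse_move i j = while_nonempty i
     (if_true i (Seq (pop i) (push j True)) (Seq (pop i) (push j False)))"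

text \<open>Per bit: one test of the loop, one of the bit, one step to pop and two to push. The last
  1 is the failing test. The other loops are counted alike.\<close>

lemma runs_reverse_move:
  assumes "i \<noteq> j"
  shows "runs (reverse_move i j) (list_store v) (5 * length (v i) + 1)
    (list_store (v(i := [], j := rev (v i) @ v j)))"
proof (induction "v i" arbitrary: v)
  case Nil
  then show ?case
    using runs_while_empty[of v i] by (simp add: reverse_move_def fun_upd_idem)
next
  case (Cons b xs)
  let ?w = "v(i := tl (v i), j := b # v j)"
  have "runs (Seq (pop i) (push j b)) (list_store v) (1 + 2) (list_store ?w)"
    using runs_Seq[OF runs_pop runs_push, of i j b v] assms by simp
  then have step: "runs (if_true i (Seq (pop i) (push j True)) (Seq (pop i) (push j False)))
      (list_store v) (Suc (1 + 2)) (list_store ?w)"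
    using Cons.hyps(2)[symmetric] by (intro runs_if_true) auto
  have "runs (reverse_move i j) (list_store ?w) (5 * length (?w i) + 1)
      (list_store (?w(i := [], j := rev (?w i) @ ?w j)))"
    using Cons.hyps(2)[symmetric] assms by (intro Cons.hyps(1)) auto
  moreover have "?w(i := [], j := rev (?w i) @ ?w j) = v(i := [], j := rev (v i) @ v j)"
    using Cons.hyps(2)[symmetric] assms by (auto simp: fun_eq_iff)
  moreover have "length (?w i) = length xs" "length (v i) = Suc (length xs)"
    using Cons.hyps(2)[symmetric] assms by auto
  ultimately have "runs (reverse_move i j) (list_store v) (Suc (Suc (1 + 2) + (5 * length xs + 1)))
      (list_store (v(i := [], j := rev (v i) @ v j)))"
    unfolding reverse_move_def using step Cons.hyps(2)[symmetric]
    by (intro runs_while_step) auto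
  then show ?case
    by (rule runs_cong) (simp_all add: \<open>length (v i) = _\<close>)
qed

lemma wf_reverse_move [simp]: "i < K \<Longrightarrow> j < K \<Longrightarrow> 3 \<le> S \<Longrightarrow> wf_prog K S (reverse_move i j)"
  by (simp add: reverse_move_def)

definition reverse_copy :: "nat \<Rightarrow> nat \<Rightarrow> nat \<Rightarrow> prog" where
  "reverse_copy i j k = while_nonempty i
     (if_true i (Seq (pop i) (Seq (push j True) (push k True)))
                (Seq (pop i) (Seq (push j False) (push k False))))"

lemma runs_reverse_copy:
  assumes "i \<noteq> j" "i \<noteq> k" "j \<noteq> k"
  shows "runs (reverse_copy i j k) (list_store v) (7 * length (v i) + 1)
    (list_store (v(i := [], j := rev (v i) @ v j, k := rev (v i) @ v k)))"
proof (induction "v i" arbitrary: v)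
  case Nil
  then show ?case
    using runs_while_empty[of v i] by (simp add: reverse_copy_def fun_upd_idem)
next
  case (Cons b xs)
  let ?w = "v(i := tl (v i), j := b # v j, k := b # v k)"
  have "runs (Seq (pop i) (Seq (push j b) (push k b))) (list_store v) (1 + (2 + 2)) (list_store ?w)"
    using runs_Seq[OF runs_pop runs_Seq[OF runs_push runs_push], of i j b k b v] assms by simp
  then have step: "runs (if_true i (Seq (pop i) (Seq (push j True) (push k True)))
                (Seq (pop i) (Seq (push j False) (push k False))))
      (list_store v) (Suc (1 + (2 + 2))) (list_store ?w)"
    using Cons.hyps(2)[symmetric] by (intro runs_if_true) auto
  have "runs (reverse_copy i j k) (list_store ?w) (7 * length (?w i) + 1)
      (list_store (?w(i := [], j := rev (?w i) @ ?w j, k := rev (?w i) @ ?w k)))"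
    using Cons.hyps(2)[symmetric] assms by (intro Cons.hyps(1)) auto
  moreover have "?w(i := [], j := rev (?w i) @ ?w j, k := rev (?w i) @ ?w k)
      = v(i := [], j := rev (v i) @ v j, k := rev (v i) @ v k)"
    using Cons.hyps(2)[symmetric] assms by (auto simp: fun_eq_iff)
  moreover have "length (?w i) = length xs" "length (v i) = Suc (length xs)"
    using Cons.hyps(2)[symmetric] assms by auto
  ultimately have "runs (reverse_copy i j k) (list_store v)
      (Suc (Suc (1 + (2 + 2)) + (7 * length xs + 1)))
      (list_store (v(i := [], j := rev (v i) @ v j, k := rev (v i) @ v k)))"
    unfolding reverse_copy_def using step Cons.hyps(2)[symmetric]
    by (intro runs_while_step) auto
  then show ?case
    by (rule runs_cong) (simp_all add: \<open>length (v i) = _\<close>)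
qed

lemma wf_reverse_copy [simp]:
  "i < K \<Longrightarrow> j < K \<Longrightarrow> k < K \<Longrightarrow> 3 \<le> S \<Longrightarrow> wf_prog K S (reverse_copy i j k)"
  by (simp add: reverse_copy_def)

text \<open>The two reversals cancel, and the second one also refills the source.\<close>

definition copy :: "nat \<Rightarrow> nat \<Rightarrow> nat \<Rightarrow> prog" where
  "copy i t k = Seq (reverse_move i t) (reverse_copy t i k)"

lemma runs_copy:
  assumes "i \<noteq> t" "i \<noteq> k" "t \<noteq> k" "v t = []" "v k = []"
  shows "runs (copy i t k) (list_store v) (12 * length (v i) + 2) (list_store (v(k := v i)))"
proof -
  let ?w = "v(i := [], t := rev (v i) @ v t)"
  have "runs (copy i t k) (list_store v) ((5 * length (v i) + 1) + (7 * length (?w t) + 1))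
    (list_store (?w(t := [], i := rev (?w t) @ ?w i, k := rev (?w t) @ ?w k)))"
    unfolding copy_def
    by (rule runs_Seq[OF runs_reverse_move runs_reverse_copy]) (use assms in auto)
  moreover have "?w(t := [], i := rev (?w t) @ ?w i, k := rev (?w t) @ ?w k) = v(k := v i)"
    using assms by (auto simp: fun_eq_iff)
  ultimately show ?thesis using assms by simp
qed

lemma wf_copy [simp]: "i < K \<Longrightarrow> j < K \<Longrightarrow> k < K \<Longrightarrow> 3 \<le> S \<Longrightarrow> wf_prog K S (copy i j k)"
  by (simp add: copy_def)

section \<open>Functions computable in polynomial time\<close>

text \<open>
  The argument and the value are held by stack 0; the other stacks below \<open>K\<close> are empty before and
  after the computation, and those from \<open>K\<close> on are left alone.
\<close>

definition computes :: "prog \<Rightarrow> nat \<Rightarrow> (bool list \<Rightarrow> bool list) \<Rightarrow> (bool list \<Rightarrow> nat) \<Rightarrow> bool" where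
  "computes c K f T \<longleftrightarrow> 0 < K \<and> wf_prog K 3 c \<and>
     (\<forall>v. (\<forall>j. 0 < j \<and> j < K \<longrightarrow> v j = []) \<longrightarrow>
        runs c (list_store v) (T (v 0)) (list_store (v(0 := f (v 0)))))"

text \<open>The length of the values is bounded along with the time because a composition spends
  \<open>T (f x)\<close>, which is bounded through the length of \<open>f x\<close>.\<close>

definition fp :: "(bool list \<Rightarrow> bool list) \<Rightarrow> bool" where
  "fp f \<longleftrightarrow> poly_bounded (\<lambda>x. length (f x)) \<and> (\<exists>c K T. poly_bounded T \<and> computes c K f T)"

lemma computes_runs:
  assumes "computes c K f T" "\<And>j. 0 < j \<Longrightarrow> j < K \<Longrightarrow> v j = []" "v 0 = x" "w = v(0 := f x)"
  shows "runs c (list_store v) (T x) (list_store w)"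
proof -
  have "\<forall>j. 0 < j \<and> j < K \<longrightarrow> v j = []" using assms(2) by simp
  then have "runs c (list_store v) (T (v 0)) (list_store (v(0 := f (v 0))))"
    using spec[OF conjunct2[OF conjunct2[OF assms(1)[unfolded computes_def]]], of v]
    by (rule mp[rotated])
  then show ?thesis using assms(3,4) by simp
qed

lemma computes_wf: "computes c K f T \<Longrightarrow> K \<le> K' \<Longrightarrow> wf_prog K' 3 c"
  using wf_prog_mono[of K 3 c K' 3] by (simp add: computes_def)

lemma fpI:
  assumes "poly_bounded (\<lambda>x. length (f x))" "poly_bounded T" "0 < K" "wf_prog K 3 c"
    "\<And>v x. (\<And>j. 0 < j \<Longrightarrow> j < K \<Longrightarrow> v j = []) \<Longrightarrow> v 0 = x \<Longrightarrow>
      runs c (list_store v) (T x) (list_store (v(0 := f x)))"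
  shows "fp f"
proof -
  have "computes c K f T"
    unfolding computes_def using assms(3-5) by simp
  then show ?thesis
    unfolding fp_def using assms(1,2) by blast
qed

lemma fpD:
  "fp f \<Longrightarrow> \<exists>c K T. poly_bounded (\<lambda>x. length (f x)) \<and> poly_bounded T \<and> computes c K f T \<and> 0 < K"
  unfolding fp_def computes_def by blast

lemma fp_length: "fp f \<Longrightarrow> poly_bounded (\<lambda>x. length (f x))"
  by (simp add: fp_def)

lemma fp_comp:
  assumes "fp g" "fp f" shows "fp (\<lambda>x. g (f x))"
proof -
  obtain c K T where g: "poly_bounded (\<lambda>x. length (g x))" "poly_bounded T"
    "computes c K g T" "0 < K" using fpD[OF assms(1)] by blast
  obtain c' K' T' where f: "poly_bounded (\<lambda>x. length (f x))" "poly_bounded T'"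
    "computes c' K' f T'" "0 < K'" using fpD[OF assms(2)] by blast
  show ?thesis
  proof (rule fpI[where c = "Seq c' c" and K = "max K K'" and T = "\<lambda>x. T' x + T (f x)"])
    show "poly_bounded (\<lambda>x. T' x + T (f x))"
      using poly_bounded_comp[OF g(2) f(1)] f(2) by (rule poly_bounded_add[rotated])
    show "wf_prog (max K K') 3 (Seq c' c)"
      using computes_wf[OF g(3)] computes_wf[OF f(3)] by simp
    show "runs (Seq c' c) (list_store v) (T' x + T (f x)) (list_store (v(0 := g (f x))))"
      if "\<And>j. 0 < j \<Longrightarrow> j < max K K' \<Longrightarrow> v j = []" "v 0 = x" for v x
      using that
      by (intro runs_Seq[OF computes_runs[OF f(3), where w = "v(0 := f x)"] computes_runs[OF g(3)]])
        auto
    show "poly_bounded (\<lambda>x. length (g (f x)))"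
      by (rule poly_bounded_comp[OF g(1) f(1)])
    show "0 < max K K'" using g(4) by simp
  qed
qed

text \<open>There is no empty program; pushing and popping a bit takes its place.\<close>

lemma fp_id: "fp (\<lambda>x. x)"
proof (rule fpI[where c = "Seq (push 0 True) (pop 0)" and K = 1 and T = "\<lambda>_. 3"])
  show "runs (Seq (push 0 True) (pop 0)) (list_store v) 3 (list_store (v(0 := x)))"
    if "v 0 = x" for v x
    using runs_Seq[OF runs_push runs_pop, of 0 True 0 v] that by (elim runs_cong) auto
  show "poly_bounded (\<lambda>_. 3 :: nat)"
    by (intro poly_bounded_intros)
  show "poly_bounded length"
    by (rule poly_bounded_length)
  show "wf_prog 1 3 (Seq (push 0 True) (pop 0))" by simp
qed simp

lemma fp_Nil: "fp (\<lambda>x. [])"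
proof (rule fpI[where c = "clear 0" and K = 1 and T = "\<lambda>x. 2 * length x + 1"])
  show "runs (clear 0) (list_store v) (2 * length x + 1) (list_store (v(0 := [])))"
    if "v 0 = x" for v x
    using runs_clear[of 0 v] that by simp
  show "poly_bounded (\<lambda>x. 2 * length x + 1)"
    by (intro poly_bounded_intros)
qed (simp_all add: poly_bounded_const)

lemma fp_Cons_const: "fp (\<lambda>x. b # x)"
proof (rule fpI[where c = "push 0 b" and K = 1 and T = "\<lambda>x. 2"])
  show "runs (push 0 b) (list_store v) 2 (list_store (v(0 := b # x)))"
    if "v 0 = x" for v x
    using runs_push[of 0 b v] that by simp
  show "poly_bounded (\<lambda>x. 2 :: nat)"
    by (intro poly_bounded_intros)
  show "poly_bounded (\<lambda>x. length (b # x))"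
    unfolding list.size by (intro poly_bounded_intros)
qed simp_all

lemma fp_tl_arg: "fp tl"
proof (rule fpI[where c = "pop 0" and K = 1 and T = "\<lambda>x. 1"])
  show "runs (pop 0) (list_store v) 1 (list_store (v(0 := tl x)))"
    if "v 0 = x" for v x
    using runs_pop[of 0 v] that by simp
  show "poly_bounded (\<lambda>x. length (tl x))"
    by (rule poly_bounded_mono[OF poly_bounded_length]) simp
  show "poly_bounded (\<lambda>x. 1 :: nat)"
    by (rule poly_bounded_const)
  show "wf_prog 1 3 (pop 0)" by (rule wf_pop) auto
  show "(0::nat) < 1" by (rule zero_less_one)
qed

lemma fp_tl: "fp f \<Longrightarrow> fp (\<lambda>x. tl (f x))"
  using fp_comp[OF fp_tl_arg] .

lemma fp_Cons: "fp f \<Longrightarrow> fp (\<lambda>x. b # f x)"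
  using fp_comp[OF fp_Cons_const] .

text \<open>Stack \<open>K\<close> first keeps a copy of the argument and finally holds
  \<open>g x\<close>. Stack \<open>K + 1\<close> shelters \<open>g x\<close> while \<open>f\<close>
  is computed, and \<open>K + 2\<close> lets the argument return to stack 0 in the right order.
  \<open>K\<close> is left open so that it can be chosen beyond the stacks of a further
  program.\<close>

lemma fp_both:
  assumes "fp f" "fp g"
  obtains K0 T where "poly_bounded T" "0 < K0"
    "\<And>K. K0 \<le> K \<Longrightarrow> \<exists>c. wf_prog (K + 3) 3 c \<and>
      (\<forall>v x. (\<forall>j. 0 < j \<and> j < K + 3 \<longrightarrow> v j = []) \<longrightarrow> v 0 = x \<longrightarrow>
         runs c (list_store v) (T x) (list_store (v(0 := f x, K := g x))))"
proof -
  obtain cf Kf Tf where f: "poly_bounded (\<lambda>x. length (f x))" "poly_bounded Tf"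
    "computes cf Kf f Tf" "0 < Kf" using fpD[OF assms(1)] by blast
  obtain cg Kg Tg where g: "poly_bounded (\<lambda>x. length (g x))" "poly_bounded Tg"
    "computes cg Kg g Tg" "0 < Kg" using fpD[OF assms(2)] by blast
  define T where "T x = (12 * length x + 2) + (Tg x + ((5 * length (g x) + 1) +
    ((5 * length x + 1) + ((5 * length x + 1) + (Tf x + (5 * length (g x) + 1))))))" for x
  show ?thesis
  proof (rule that[of T "max Kf Kg"])
    show "poly_bounded T"
      unfolding T_def by (intro poly_bounded_intros f g)
    show "0 < max Kf Kg" using f(4) by simp
    fix K assume K: "max Kf Kg \<le> K"
    let ?c = "Seq (copy 0 (K + 1) K) (Seq cg (Seq (reverse_move 0 (K + 1))
      (Seq (reverse_move K (K + 2)) (Seq (reverse_move (K + 2) 0)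
      (Seq cf (reverse_move (K + 1) K))))))"
    show "\<exists>c. wf_prog (K + 3) 3 c \<and>
      (\<forall>v x. (\<forall>j. 0 < j \<and> j < K + 3 \<longrightarrow> v j = []) \<longrightarrow> v 0 = x \<longrightarrow>
         runs c (list_store v) (T x) (list_store (v(0 := f x, K := g x))))"
    proof (intro exI[of _ ?c] conjI allI impI)
      show "wf_prog (K + 3) 3 ?c"
        using computes_wf[OF f(3)] computes_wf[OF g(3)] K f(4) by simp
      fix v :: "nat \<Rightarrow> bool list" and x
      assume v: "\<forall>j. 0 < j \<and> j < K + 3 \<longrightarrow> v j = []" "v 0 = x"
      have K0: "0 < K" using K f(4) by linarith
      have r1: "runs (copy 0 (K + 1) K) (list_store v) (12 * length x + 2)
          (list_store (v(K := x)))"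
        using runs_copy[of 0 "K + 1" K v] v K0 by simp
      have r2: "runs cg (list_store (v(K := x))) (Tg x) (list_store (v(0 := g x, K := x)))"
        using v K0 K by (intro computes_runs[OF g(3)]) (auto simp: fun_eq_iff)
      have r3: "runs (reverse_move 0 (K + 1)) (list_store (v(0 := g x, K := x)))
          (5 * length (g x) + 1) (list_store (v(0 := [], K := x, K + 1 := rev (g x))))"
        using runs_reverse_move[of 0 "K + 1" "v(0 := g x, K := x)"] v K0
        by (simp add: fun_upd_twist)
      have r4: "runs (reverse_move K (K + 2)) (list_store (v(0 := [], K := x, K + 1 := rev (g x))))
          (5 * length x + 1) (list_store (v(0 := [], K + 1 := rev (g x), K + 2 := rev x)))"
      proof -
        have "v(0 := [], K := x, K + 1 := rev (g x), K := [], K + 2 := rev x)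
          = v(0 := [], K + 1 := rev (g x), K + 2 := rev x)"
          using v K0 by (auto simp: fun_eq_iff)
        then show ?thesis
          using runs_reverse_move[of K "K + 2" "v(0 := [], K := x, K + 1 := rev (g x))"] v K0
          by simp
      qed
      have r5: "runs (reverse_move (K + 2) 0) (list_store (v(0 := [], K + 1 := rev (g x), K + 2 := rev x)))
          (5 * length x + 1) (list_store (v(0 := x, K + 1 := rev (g x))))"
      proof -
        have "v(0 := [], K + 1 := rev (g x), K + 2 := rev x, K + 2 := [], 0 := x)
          = v(0 := x, K + 1 := rev (g x))"
          using v K0 by (auto simp: fun_eq_iff)
        then show ?thesis
          using runs_reverse_move[of "K + 2" 0 "v(0 := [], K + 1 := rev (g x), K + 2 := rev x)"] v K0
          by simp
      qed
      have r6: "runs cf (list_store (v(0 := x, K + 1 := rev (g x)))) (Tf x)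
          (list_store (v(0 := f x, K + 1 := rev (g x))))"
        using v K0 K by (intro computes_runs[OF f(3)]) (auto simp: fun_eq_iff)
      have r7: "runs (reverse_move (K + 1) K) (list_store (v(0 := f x, K + 1 := rev (g x))))
          (5 * length (g x) + 1) (list_store (v(0 := f x, K := g x)))"
      proof -
        have "v(0 := f x, K + 1 := rev (g x), K + 1 := [], K := g x) = v(0 := f x, K := g x)"
          using v K0 by (auto simp: fun_eq_iff)
        then show ?thesis
          using runs_reverse_move[of "K + 1" K "v(0 := f x, K + 1 := rev (g x))"] v K0
          by simp
      qed
      show "runs ?c (list_store v) (T x) (list_store (v(0 := f x, K := g x)))"
        unfolding T_def
        by (rule runs_Seq[OF r1 runs_Seq[OF r2 runs_Seq[OF r3 runs_Seq[OF r4 runs_Seq[OF r5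
          runs_Seq[OF r6 r7]]]]]])
    qed
  qed
qed

text \<open>A stack is built from its end: the closing \<open>False\<close> comes first, then the
  bits from last to first, each below its marker \<open>True\<close>. Hence stack \<open>i\<close>
  has to hold the word in reverse.\<close>

definition push_delimited :: "nat \<Rightarrow> nat \<Rightarrow> prog" where
  "push_delimited i j = Seq (push j False) (while_nonempty i
     (if_true i (Seq (pop i) (Seq (push j True) (push j True)))
                (Seq (pop i) (Seq (push j False) (push j True)))))"

lemma runs_push_delimited:
  assumes "i \<noteq> j"
  shows "runs (push_delimited i j) (list_store v) (7 * length (v i) + 3)
    (list_store (v(i := [], j := delimit (rev (v i)) @ v j)))"
proof -
  let ?loop = "while_nonempty i
     (if_true i (Seq (pop i) (Seq (push j True) (push j True)))
                (Seq (pop i) (Seq (push j False) (push j True))))"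
  have loop: "runs ?loop (list_store v) (7 * length (v i) + 1)
    (list_store (v(i := [], j := concat (map (\<lambda>b. [True, b]) (rev (v i))) @ v j)))" for v
  proof (induction "v i" arbitrary: v)
    case Nil
    then show ?case
      using runs_while_empty[of v i] by (simp add: fun_upd_idem)
  next
    case (Cons b xs)
    let ?w = "v(i := tl (v i), j := True # b # v j)"
    have "runs (Seq (pop i) (Seq (push j b) (push j True))) (list_store v) (1 + (2 + 2)) (list_store ?w)"
      using runs_Seq[OF runs_pop runs_Seq[OF runs_push runs_push], of i j b j True v] assms by simp
    then have step: "runs (if_true i (Seq (pop i) (Seq (push j True) (push j True)))
                  (Seq (pop i) (Seq (push j False) (push j True))))
        (list_store v) (Suc (1 + (2 + 2))) (list_store ?w)"
      using Cons.hyps(2)[symmetric] by (intro runs_if_true) auto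
    have "runs ?loop (list_store ?w) (7 * length (?w i) + 1)
        (list_store (?w(i := [], j := concat (map (\<lambda>b. [True, b]) (rev (?w i))) @ ?w j)))"
      using Cons.hyps(2)[symmetric] assms by (intro Cons.hyps(1)) auto
    moreover have "?w(i := [], j := concat (map (\<lambda>b. [True, b]) (rev (?w i))) @ ?w j)
        = v(i := [], j := concat (map (\<lambda>b. [True, b]) (rev (v i))) @ v j)"
      using Cons.hyps(2)[symmetric] assms by (auto simp: fun_eq_iff)
    moreover have "length (?w i) = length xs" "length (v i) = Suc (length xs)"
      using Cons.hyps(2)[symmetric] assms by auto
    ultimately have "runs ?loop (list_store v) (Suc (Suc (1 + (2 + 2)) + (7 * length xs + 1)))
        (list_store (v(i := [], j := concat (map (\<lambda>b. [True, b]) (rev (v i))) @ v j)))"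
      using step Cons.hyps(2)[symmetric]
      by (intro runs_while_step) auto
    then show ?case
    by (rule runs_cong) (simp_all add: \<open>length (v i) = _\<close>)
  qed
  let ?w = "v(j := False # v j)"
  have "v(j := False # v j, i := [], j := concat (map (\<lambda>b. [True, b]) (rev (?w i))) @ ?w j)
    = v(i := [], j := delimit (rev (v i)) @ v j)"
    using assms by (auto simp: fun_eq_iff delimit_def)
  moreover have "runs (push_delimited i j) (list_store v) (2 + (7 * length (?w i) + 1))
     (list_store (?w(i := [], j := concat (map (\<lambda>b. [True, b]) (rev (?w i))) @ ?w j)))"
    unfolding push_delimited_def
    by (rule runs_Seq[OF runs_push loop])
  ultimately show ?thesis using assms by (elim runs_cong) auto
qed

lemma wf_push_delimited [simp]:
  "i < K \<Longrightarrow> j < K \<Longrightarrow> wf_prog K 3 (push_delimited i j)"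
  by (simp add: push_delimited_def)

lemma length_delimit: "length (delimit xs) = 2 * length xs + 1"
  by (induction xs) (auto simp: delimit_def)

lemma length_pair_code: "length (pair_code x y) = 2 * length x + 1 + length y"
  by (simp add: pair_code_def length_delimit)

lemma fp_pair:
  assumes "fp f" "fp g" shows "fp (\<lambda>x. pair_code (f x) (g x))"
proof -
  \<comment> \<open>The functions are swapped because the second component is the plain tail of the
    code, onto which the first one is pushed.\<close>
  obtain K T where T: "poly_bounded T" and K: "0 < K" and
    ex: "\<exists>c. wf_prog (K + 3) 3 c \<and>
      (\<forall>v x. (\<forall>j. 0 < j \<and> j < K + 3 \<longrightarrow> v j = []) \<longrightarrow> v 0 = x \<longrightarrow>
         runs c (list_store v) (T x) (list_store (v(0 := g x, K := f x))))"
    using fp_both[OF assms(2,1)] by (metis le_refl)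
  then obtain c where c: "wf_prog (K + 3) 3 c"
    "\<And>v x. (\<And>j. 0 < j \<and> j < K + 3 \<Longrightarrow> v j = []) \<Longrightarrow> v 0 = x \<Longrightarrow>
         runs c (list_store v) (T x) (list_store (v(0 := g x, K := f x)))"
    by blast
  show ?thesis
  proof (rule fpI)
    show "poly_bounded (\<lambda>x. length (pair_code (f x) (g x)))"
      unfolding length_pair_code by (intro poly_bounded_intros fp_length assms)
    show "poly_bounded (\<lambda>x. T x + ((5 * length (f x) + 1) + (7 * length (f x) + 3)))"
      by (intro poly_bounded_intros fp_length assms T)
    show "wf_prog (K + 3) 3 (Seq c (Seq (reverse_move K (K + 1)) (push_delimited (K + 1) 0)))"
      using c(1) by simp
    fix v :: "nat \<Rightarrow> bool list" and x
    assume v: "\<And>j. 0 < j \<Longrightarrow> j < K + 3 \<Longrightarrow> v j = []" "v 0 = x"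
    let ?v1 = "v(0 := g x, K := f x)" and ?v2 = "v(0 := g x, K + 1 := rev (f x))"
    have r1: "runs c (list_store v) (T x) (list_store ?v1)" using c(2) v by blast
    have e2: "?v1(K := [], K + 1 := rev (?v1 K) @ ?v1 (K + 1)) = ?v2"
      using v K by (auto simp: fun_eq_iff)
    have r2: "runs (reverse_move K (K + 1)) (list_store ?v1) (5 * length (f x) + 1) (list_store ?v2)"
      using runs_reverse_move[of K "K + 1" ?v1, unfolded e2] K by simp
    have e3: "?v2(K + 1 := [], 0 := delimit (rev (?v2 (K + 1))) @ ?v2 0)
        = v(0 := pair_code (f x) (g x))"
      using v K by (auto simp: fun_eq_iff pair_code_def)
    have r3: "runs (push_delimited (K + 1) 0) (list_store ?v2) (7 * length (f x) + 3)
      (list_store (v(0 := pair_code (f x) (g x))))"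
      using runs_push_delimited[of "K + 1" 0 ?v2, unfolded e3] K by simp
    show "runs (Seq c (Seq (reverse_move K (K + 1)) (push_delimited (K + 1) 0))) (list_store v)
      (T x + ((5 * length (f x) + 1) + (7 * length (f x) + 3)))
      (list_store (v(0 := pair_code (f x) (g x))))"
      by (rule runs_Seq[OF r1 runs_Seq[OF r2 r3]])
  qed simp
qed

text \<open>\<open>Q\<close> and \<open>I\<close> stand for the two tests on a stack: of its top bit
  and for emptiness. The argument stays on stack 0 while the value of \<open>q\<close> is tested on
  stack \<open>K\<close>.\<close>

lemma fp_cond_machine:
  assumes "fp q" "fp f" "fp g"
    and W: "\<And>K c d. wf_prog (Suc K) 3 c \<Longrightarrow> wf_prog (Suc K) 3 d \<Longrightarrow> wf_prog (Suc K) 3 (I K c d)"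
    and I: "\<And>v i t c d \<tau>. (Q (v i) \<Longrightarrow> runs c (list_store v) t \<tau>) \<Longrightarrow>
      (\<not> Q (v i) \<Longrightarrow> runs d (list_store v) t \<tau>) \<Longrightarrow> runs (I i c d) (list_store v) (Suc t) \<tau>"
  shows "fp (\<lambda>x. if Q (q x) then f x else g x)"
proof -
  obtain cf Kf Tf where f: "poly_bounded (\<lambda>x. length (f x))" "poly_bounded Tf"
    "computes cf Kf f Tf" "0 < Kf" using fpD[OF assms(2)] by blast
  obtain cg Kg Tg where g: "poly_bounded (\<lambda>x. length (g x))" "poly_bounded Tg"
    "computes cg Kg g Tg" "0 < Kg" using fpD[OF assms(3)] by blast
  obtain K0 T where T: "poly_bounded T" and
    ex: "\<And>K. K0 \<le> K \<Longrightarrow> \<exists>c. wf_prog (K + 3) 3 c \<and>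
      (\<forall>v x. (\<forall>j. 0 < j \<and> j < K + 3 \<longrightarrow> v j = []) \<longrightarrow> v 0 = x \<longrightarrow>
         runs c (list_store v) (T x) (list_store (v(0 := x, K := q x))))"
    using fp_both[OF fp_id assms(1)] by metis
  define K where "K = max K0 (max Kf Kg)"
  have K: "0 < K" "Kf \<le> K" "Kg \<le> K" unfolding K_def using f(4) by auto
  obtain c where c: "wf_prog (K + 3) 3 c"
    "\<And>v x. (\<And>j. 0 < j \<and> j < K + 3 \<Longrightarrow> v j = []) \<Longrightarrow> v 0 = x \<Longrightarrow>
         runs c (list_store v) (T x) (list_store (v(0 := x, K := q x)))"
    using ex[of K] unfolding K_def by fastforce
  let ?c = "Seq c (I K (Seq (clear K) cf) (Seq (clear K) cg))"
  let ?T = "\<lambda>x. T x + Suc ((2 * length (q x) + 1) + (Tf x + Tg x))"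
  show ?thesis
  proof (rule fpI)
    show "poly_bounded (\<lambda>x. length (if Q (q x) then f x else g x))"
      by (rule poly_bounded_mono[OF poly_bounded_add[OF f(1) g(1)]]) simp
    show "poly_bounded ?T"
      by (intro poly_bounded_intros fp_length assms(1) T f g)
    have "wf_prog (Suc K) 3 (I K (Seq (clear K) cf) (Seq (clear K) cg))"
      using computes_wf[OF f(3)] computes_wf[OF g(3)] K by (intro W) auto
    then show "wf_prog (K + 3) 3 ?c"
      using c(1) wf_prog_mono[of "Suc K" 3 _ "K + 3" 3] by simp
    fix v :: "nat \<Rightarrow> bool list" and x
    assume v: "\<And>j. 0 < j \<Longrightarrow> j < K + 3 \<Longrightarrow> v j = []" "v 0 = x"
    let ?v1 = "v(0 := x, K := q x)" and ?y = "if Q (q x) then f x else g x"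
    have r1: "runs c (list_store v) (T x) (list_store ?v1)" using c(2) v by blast
    have e2: "?v1(K := []) = v" using v K by (auto simp: fun_eq_iff)
    have r2: "runs (clear K) (list_store ?v1) (2 * length (q x) + 1) (list_store v)"
      using runs_clear[of K ?v1, unfolded e2] by simp
    have rf: "runs cf (list_store v) (Tf x + Tg x) (list_store (v(0 := f x)))"
      using v K by (intro runs_mono[OF computes_runs[OF f(3)]]) auto
    have rg: "runs cg (list_store v) (Tf x + Tg x) (list_store (v(0 := g x)))"
      using v K by (intro runs_mono[OF computes_runs[OF g(3)]]) auto
    have r3: "runs (I K (Seq (clear K) cf) (Seq (clear K) cg)) (list_store ?v1)
       (Suc ((2 * length (q x) + 1) + (Tf x + Tg x))) (list_store (v(0 := ?y)))"
    proof (rule I)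
      assume "Q (?v1 K)"
      then show "runs (Seq (clear K) cf) (list_store ?v1) ((2 * length (q x) + 1) + (Tf x + Tg x))
          (list_store (v(0 := ?y)))"
        using runs_Seq[OF r2 rf] by simp
    next
      assume "\<not> Q (?v1 K)"
      then show "runs (Seq (clear K) cg) (list_store ?v1) ((2 * length (q x) + 1) + (Tf x + Tg x))
          (list_store (v(0 := ?y)))"
        using runs_Seq[OF r2 rg] by simp
    qed
    show "runs ?c (list_store v) (?T x) (list_store (v(0 := ?y)))"
      by (rule runs_Seq[OF r1 r3])
  qed simp
qed

lemma fp_if_top_true:
  "fp q \<Longrightarrow> fp f \<Longrightarrow> fp g \<Longrightarrow> fp (\<lambda>x. if top_true (q x) then f x else g x)"
  by (rule fp_cond_machine[where I = if_true]) (auto intro: runs_if_true)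

lemma fp_if_nonempty:
  "fp q \<Longrightarrow> fp f \<Longrightarrow> fp g \<Longrightarrow> fp (\<lambda>x. if q x \<noteq> [] then f x else g x)"
  by (rule fp_cond_machine[where I = if_nonempty]) (auto intro: runs_if_nonempty)

text \<open>The word \<open>g x\<close> on stack \<open>K\<close> is a unary counter. All
  intermediate values must be bounded, since iterating a polynomial-time function can make the
  length grow exponentially or faster.\<close>

lemma fp_funpow_bounded:
  assumes "fp s" "fp f" "fp g" and h: "poly_bounded h"
    and bound: "\<And>x n. n \<le> length (g x) \<Longrightarrow> length ((s ^^ n) (f x)) \<le> h x"
  shows "fp (\<lambda>x. (s ^^ length (g x)) (f x))"
proof -
  obtain cs Ks Ts where s: "poly_bounded (\<lambda>x. length (s x))" "poly_bounded Ts"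
    "computes cs Ks s Ts" "0 < Ks" using fpD[OF assms(1)] by blast
  obtain p where p: "\<And>y. Ts y \<le> poly p (length y)"
    using s(2) unfolding poly_bounded_def by blast
  obtain K0 T where T: "poly_bounded T" and
    ex: "\<And>K. K0 \<le> K \<Longrightarrow> \<exists>c. wf_prog (K + 3) 3 c \<and>
      (\<forall>v x. (\<forall>j. 0 < j \<and> j < K + 3 \<longrightarrow> v j = []) \<longrightarrow> v 0 = x \<longrightarrow>
         runs c (list_store v) (T x) (list_store (v(0 := f x, K := g x))))"
    using fp_both[OF assms(2,3)] by metis
  define K where "K = max K0 Ks"
  have K: "0 < K" "Ks \<le> K" unfolding K_def using s(4) by auto
  obtain c where c: "wf_prog (K + 3) 3 c"
    "\<And>v x. (\<And>j. 0 < j \<and> j < K + 3 \<Longrightarrow> v j = []) \<Longrightarrow> v 0 = x \<Longrightarrow>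
         runs c (list_store v) (T x) (list_store (v(0 := f x, K := g x)))"
    using ex[of K] unfolding K_def by fastforce
  let ?loop = "while_nonempty K (Seq (pop K) cs)"
  have loop: "runs ?loop (list_store (v(0 := y, K := ys)))
      (length ys * (poly p H + 2) + 1) (list_store (v(0 := (s ^^ length ys) y)))"
    if "\<And>j. 0 < j \<Longrightarrow> j \<le> K \<Longrightarrow> v j = []"
      "\<And>n. n \<le> length ys \<Longrightarrow> length ((s ^^ n) y) \<le> H" for v y H and ys :: "bool list"
    using that(2)
  proof (induction ys arbitrary: y)
    case Nil
    have "v(0 := y, K := []) = v(0 := y)" using that(1) K by (auto simp: fun_eq_iff)
    moreover have "runs ?loop (list_store (v(0 := y, K := []))) 1 (list_store (v(0 := y, K := [])))"
      by (rule runs_while_empty) simp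
    ultimately show ?case by (simp del: fun_upd_apply)
  next
    case (Cons b ys)
    let ?v = "v(0 := y, K := b # ys)"
    have r1: "runs (pop K) (list_store ?v) 1 (list_store (v(0 := y, K := ys)))"
      using runs_pop[of K ?v] by simp
    have "Ts y \<le> poly p H"
      using p[of y] poly_nat_mono[of "length y" H p] Cons.prems[of 0] by simp
    moreover have "runs cs (list_store (v(0 := y, K := ys))) (Ts y) (list_store (v(0 := s y, K := ys)))"
      using that(1) K by (intro computes_runs[OF s(3)]) (auto simp: fun_eq_iff)
    ultimately have r2: "runs cs (list_store (v(0 := y, K := ys))) (poly p H)
        (list_store (v(0 := s y, K := ys)))"
      by (rule runs_mono[rotated])
    have r3: "runs ?loop (list_store (v(0 := s y, K := ys))) (length ys * (poly p H + 2) + 1)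
        (list_store (v(0 := (s ^^ length ys) (s y))))"
      using Cons.prems[of "Suc _"]
      by (intro Cons.IH) (simp add: funpow_Suc_right del: funpow.simps)
    have "runs ?loop (list_store ?v) (Suc ((1 + poly p H) + (length ys * (poly p H + 2) + 1)))
        (list_store (v(0 := (s ^^ length ys) (s y))))"
      by (rule runs_while_step[OF _ runs_Seq[OF r1 r2] r3]) simp
    then show ?case
      by (rule runs_list_cong) (simp_all add: funpow_Suc_right del: funpow.simps)
  qed
  let ?T = "\<lambda>x. T x + (length (g x) * (poly p (h x) + 2) + 1)"
  show ?thesis
  proof (rule fpI)
    show "poly_bounded (\<lambda>x. length ((s ^^ length (g x)) (f x)))"
      by (rule poly_bounded_mono[OF h bound]) simp
    show "poly_bounded ?T"
      by (intro poly_bounded_intros T h fp_length assms(3))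
    show "wf_prog (K + 3) 3 (Seq c ?loop)"
      using c(1) computes_wf[OF s(3), of "K + 3"] K by simp
    fix v :: "nat \<Rightarrow> bool list" and x
    assume v: "\<And>j. 0 < j \<Longrightarrow> j < K + 3 \<Longrightarrow> v j = []" "v 0 = x"
    show "runs (Seq c ?loop) (list_store v) (?T x) (list_store (v(0 := (s ^^ length (g x)) (f x))))"
      using c(2)[of v x] loop[of v "g x" "f x" "h x"] v bound by (intro runs_Seq) auto
  qed simp
qed

section \<open>Decoding of pairs\<close>

fun pair_fst :: "bool list \<Rightarrow> bool list" where
  "pair_fst (True # b # xs) = b # pair_fst xs"
| "pair_fst _ = []"

fun pair_snd :: "bool list \<Rightarrow> bool list" where
  "pair_snd (True # b # xs) = pair_snd xs"
| "pair_snd (False # xs) = xs"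
| "pair_snd _ = []"

lemma pair_fst_pair [simp]: "pair_fst (pair_code x y) = x"
  by (induction x) (auto simp: pair_code_def delimit_def)

lemma pair_snd_pair [simp]: "pair_snd (pair_code x y) = y"
  by (induction x) (auto simp: pair_code_def delimit_def)

lemma length_pair_fst: "length (pair_fst x) \<le> length x"
  by (induction x rule: pair_fst.induct) auto

lemma length_pair_snd: "length (pair_snd x) \<le> length x"
  by (induction x rule: pair_snd.induct) auto

text \<open>Stack 1 holds one bit as long as decoding goes on, since the loop has to end with the
  second component still on stack 0. Stack 2 collects the first component in reverse. The inner test
  of stack 0 catches a marker without a bit after it.\<close>

definition unpair_loop :: prog where
  "unpair_loop = while_nonempty 1 (if_true 0
     (Seq (pop 0) (if_nonempty 0
        (if_true 0 (Seq (pop 0) (push 2 True)) (Seq (pop 0) (push 2 False))) (pop 1)))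
     (Seq (pop 0) (pop 1)))"

text \<open>Covers the closing \<open>False\<close> and also an exhausted word, where popping does
  nothing.\<close>

lemma runs_unpair_stop:
  assumes "\<not> top_true (v 0)" "v 1 = [True]"
  shows "runs unpair_loop (list_store v) 5 (list_store (v(0 := tl (v 0), 1 := [])))"
proof -
  let ?w = "v(0 := tl (v 0))"
  let ?c = "if_true 0
     (Seq (pop 0) (if_nonempty 0
        (if_true 0 (Seq (pop 0) (push 2 True)) (Seq (pop 0) (push 2 False))) (pop 1)))
     (Seq (pop 0) (pop 1))"
  have "runs (Seq (pop 0) (pop 1)) (list_store v) (1 + 1) (list_store (?w(1 := tl (?w 1))))"
    by (rule runs_Seq[OF runs_pop runs_pop])
  then have "runs ?c (list_store v) (Suc (1 + 1)) (list_store (?w(1 := tl (?w 1))))"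
    using assms(1) by (intro runs_if_true) auto
  then have "runs unpair_loop (list_store v) (Suc (Suc (1 + 1) + 1)) (list_store (?w(1 := tl (?w 1))))"
    unfolding unpair_loop_def using assms
    by (intro runs_while_step[OF _ _ runs_while_empty]) auto
  then show ?thesis by (rule runs_list_cong) (use assms in auto)
qed

lemma runs_unpair_stop2:
  assumes "v 0 = [True]" "v 1 = [True]"
  shows "runs unpair_loop (list_store v) 6 (list_store (v(0 := [], 1 := [])))"
proof -
  let ?w = "v(0 := tl (v 0))"
  let ?c = "if_true 0
     (Seq (pop 0) (if_nonempty 0
        (if_true 0 (Seq (pop 0) (push 2 True)) (Seq (pop 0) (push 2 False))) (pop 1)))
     (Seq (pop 0) (pop 1))"
  have "runs (if_nonempty 0
        (if_true 0 (Seq (pop 0) (push 2 True)) (Seq (pop 0) (push 2 False))) (pop 1))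
      (list_store ?w) (Suc 1) (list_store (?w(1 := tl (?w 1))))"
    using assms(1) by (intro runs_if_nonempty runs_pop) auto
  then have "runs ?c (list_store v) (Suc (1 + Suc 1)) (list_store (?w(1 := tl (?w 1))))"
    using assms(1) by (intro runs_if_true runs_Seq[OF runs_pop]) auto
  then have "runs unpair_loop (list_store v) (Suc (Suc (1 + Suc 1) + 1)) (list_store (?w(1 := tl (?w 1))))"
    unfolding unpair_loop_def using assms
    by (intro runs_while_step[OF _ _ runs_while_empty]) auto
  then show ?thesis by (rule runs_list_cong) (use assms in auto)
qed

lemma runs_unpair_loop:
  "v 0 = x \<Longrightarrow> v 1 = [True] \<Longrightarrow> runs unpair_loop (list_store v) (7 * length x + 7)
     (list_store (v(0 := pair_snd x, 1 := [], 2 := rev (pair_fst x) @ v 2)))"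
proof (induction x arbitrary: v rule: pair_fst.induct)
  case (1 b xs)
  let ?w = "v(0 := xs, 2 := b # v 2)"
  have "runs (Seq (pop 0) (push 2 b)) (list_store (v(0 := b # xs))) (1 + 2) (list_store ?w)"
    using runs_Seq[OF runs_pop runs_push, of 0 2 b "v(0 := b # xs)"] by simp
  then have "runs (if_true 0 (Seq (pop 0) (push 2 True)) (Seq (pop 0) (push 2 False)))
     (list_store (v(0 := b # xs))) (Suc (1 + 2)) (list_store ?w)"
    by (intro runs_if_true) auto
  then have "runs (if_nonempty 0
        (if_true 0 (Seq (pop 0) (push 2 True)) (Seq (pop 0) (push 2 False))) (pop 1))
     (list_store (v(0 := b # xs))) (Suc (Suc (1 + 2))) (list_store ?w)"
    by (intro runs_if_nonempty) auto
  moreover have "runs (pop 0) (list_store v) 1 (list_store (v(0 := b # xs)))"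
    using runs_pop[of 0 v] 1 by simp
  ultimately have "runs (if_true 0
     (Seq (pop 0) (if_nonempty 0
        (if_true 0 (Seq (pop 0) (push 2 True)) (Seq (pop 0) (push 2 False))) (pop 1)))
     (Seq (pop 0) (pop 1))) (list_store v) (Suc (1 + Suc (Suc (1 + 2)))) (list_store ?w)"
    using 1 by (intro runs_if_true runs_Seq) auto
  moreover have "runs unpair_loop (list_store ?w) (7 * length xs + 7)
     (list_store (?w(0 := pair_snd xs, 1 := [], 2 := rev (pair_fst xs) @ ?w 2)))"
    using 1 by (intro "1.IH") auto
  ultimately have "runs unpair_loop (list_store v)
     (Suc (Suc (1 + Suc (Suc (1 + 2))) + (7 * length xs + 7)))
     (list_store (?w(0 := pair_snd xs, 1 := [], 2 := rev (pair_fst xs) @ ?w 2)))"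
    unfolding unpair_loop_def using 1 by (intro runs_while_step) auto
  then show ?case by (rule runs_list_cong) auto
next
  case "2_1"
  show ?case by (rule runs_list_cong[OF runs_unpair_stop]) (use "2_1" in auto)
next
  case ("2_2" xs)
  show ?case by (rule runs_list_cong[OF runs_unpair_stop]) (use "2_2" in auto)
next
  case ("2_3" b)
  show ?case
  proof (cases b)
    case True
    show ?thesis by (rule runs_list_cong[OF runs_unpair_stop2]) (use True "2_3" in auto)
  next
    case False
    show ?thesis by (rule runs_list_cong[OF runs_unpair_stop]) (use False "2_3" in auto)
  qed
qed

definition unpair :: prog where
  "unpair = Seq (push 1 True) unpair_loop"

lemma runs_unpair:
  assumes "v 0 = x" "v 1 = []" "v 2 = []"
  shows "runs unpair (list_store v) (2 + (7 * length x + 7))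
     (list_store (v(0 := pair_snd x, 2 := rev (pair_fst x))))"
proof -
  let ?w = "v(1 := [True])"
  have "runs (push 1 True) (list_store v) 2 (list_store ?w)"
    using runs_push[of 1 True v] assms by simp
  moreover have "runs unpair_loop (list_store ?w) (7 * length x + 7)
     (list_store (?w(0 := pair_snd x, 1 := [], 2 := rev (pair_fst x) @ ?w 2)))"
    using assms by (intro runs_unpair_loop) auto
  moreover have "?w(0 := pair_snd x, 1 := [], 2 := rev (pair_fst x) @ ?w 2)
    = v(0 := pair_snd x, 2 := rev (pair_fst x))"
    using assms by (auto simp: fun_eq_iff)
  ultimately show ?thesis unfolding unpair_def by (metis runs_Seq)
qed

lemma wf_unpair [simp]: "3 \<le> K \<Longrightarrow> wf_prog K 3 unpair"
  by (simp add: unpair_def unpair_loop_def)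

lemma fp_pair_snd_arg: "fp pair_snd"
proof (rule fpI)
  show "poly_bounded (\<lambda>x. length (pair_snd x))"
    by (rule poly_bounded_mono[OF poly_bounded_length length_pair_snd])
  show "poly_bounded (\<lambda>x. (2 + (7 * length x + 7)) + (2 * length x + 1))"
    by (intro poly_bounded_intros)
  show "wf_prog 3 3 (Seq unpair (clear 2))" by simp
  fix v :: "nat \<Rightarrow> bool list" and x
  assume v: "\<And>j. 0 < j \<Longrightarrow> j < 3 \<Longrightarrow> v j = []" "v 0 = x"
  let ?w = "v(0 := pair_snd x, 2 := rev (pair_fst x))"
  have "runs unpair (list_store v) (2 + (7 * length x + 7)) (list_store ?w)"
    using v by (intro runs_unpair) auto
  moreover have "runs (clear 2) (list_store ?w) (2 * length x + 1) (list_store (v(0 := pair_snd x)))"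
    by (rule runs_list_cong[OF runs_clear]) (use v length_pair_fst[of x] in auto)
  ultimately show "runs (Seq unpair (clear 2)) (list_store v)
      ((2 + (7 * length x + 7)) + (2 * length x + 1)) (list_store (v(0 := pair_snd x)))"
    by (rule runs_Seq)
qed simp

lemma fp_pair_fst_arg: "fp pair_fst"
proof (rule fpI)
  show "poly_bounded (\<lambda>x. length (pair_fst x))"
    by (rule poly_bounded_mono[OF poly_bounded_length length_pair_fst])
  show "poly_bounded (\<lambda>x. (2 + (7 * length x + 7)) + ((2 * length x + 1) + (5 * length x + 1)))"
    by (intro poly_bounded_intros)
  show "wf_prog 3 3 (Seq unpair (Seq (clear 0) (reverse_move 2 0)))" by simp
  fix v :: "nat \<Rightarrow> bool list" and x
  assume v: "\<And>j. 0 < j \<Longrightarrow> j < 3 \<Longrightarrow> v j = []" "v 0 = x"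
  let ?w = "v(0 := pair_snd x, 2 := rev (pair_fst x))"
  let ?u = "v(0 := [], 2 := rev (pair_fst x))"
  have "runs unpair (list_store v) (2 + (7 * length x + 7)) (list_store ?w)"
    using v by (intro runs_unpair) auto
  moreover have "runs (clear 0) (list_store ?w) (2 * length x + 1) (list_store ?u)"
    by (rule runs_list_cong[OF runs_clear]) (use v length_pair_snd[of x] in auto)
  moreover have "runs (reverse_move 2 0) (list_store ?u) (5 * length x + 1) (list_store (v(0 := pair_fst x)))"
    by (rule runs_list_cong[OF runs_reverse_move]) (use v length_pair_fst[of x] in auto)
  ultimately show "runs (Seq unpair (Seq (clear 0) (reverse_move 2 0))) (list_store v)
      ((2 + (7 * length x + 7)) + ((2 * length x + 1) + (5 * length x + 1)))
      (list_store (v(0 := pair_fst x)))"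
    by (intro runs_Seq)
qed simp

lemma fp_pair_fst: "fp f \<Longrightarrow> fp (\<lambda>x. pair_fst (f x))"
  using fp_comp[OF fp_pair_fst_arg] .

lemma fp_pair_snd: "fp f \<Longrightarrow> fp (\<lambda>x. pair_snd (f x))"
  using fp_comp[OF fp_pair_snd_arg] .

section \<open>Programming with polynomial-time functions\<close>

abbreviation fp_pred :: "(bool list \<Rightarrow> bool) \<Rightarrow> bool" where
  "fp_pred Q \<equiv> fp (\<lambda>x. [Q x])"

lemma fp_const: "fp (\<lambda>x. c)"
  by (induction c) (auto intro: fp_Nil fp_Cons)

lemma fp_if:
  assumes "fp_pred Q" "fp f" "fp g" shows "fp (\<lambda>x. if Q x then f x else g x)"
  using fp_if_top_true[OF assms] by simp

lemma fp_pred_top_true: assumes "fp f" shows "fp_pred (\<lambda>x. top_true (f x))"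
proof -
  have "(\<lambda>x. [top_true (f x)]) = (\<lambda>x. if top_true (f x) then [True] else [False])"
    by auto
  then show ?thesis using fp_if_top_true[OF assms fp_const fp_const] by metis
qed

lemma fp_pred_Nil: assumes "fp f" shows "fp_pred (\<lambda>x. f x = [])"
proof -
  have "(\<lambda>x. [f x = []]) = (\<lambda>x. if f x \<noteq> [] then [False] else [True])"
    by auto
  then show ?thesis using fp_if_nonempty[OF assms fp_const fp_const] by metis
qed

lemma fp_pred_not: assumes "fp_pred P" shows "fp_pred (\<lambda>x. \<not> P x)"
proof -
  have "(\<lambda>x. [\<not> P x]) = (\<lambda>x. if P x then [False] else [True])"
    by auto
  then show ?thesis using fp_if[OF assms fp_const fp_const] by metis
qed

lemma fp_pred_conj: assumes "fp_pred P" "fp_pred Q" shows "fp_pred (\<lambda>x. P x \<and> Q x)"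
proof -
  have "(\<lambda>x. [P x \<and> Q x]) = (\<lambda>x. if P x then [Q x] else [False])"
    by auto
  then show ?thesis using fp_if[OF assms fp_const] by metis
qed

lemma fp_pred_disj: assumes "fp_pred P" "fp_pred Q" shows "fp_pred (\<lambda>x. P x \<or> Q x)"
proof -
  have "(\<lambda>x. [P x \<or> Q x]) = (\<lambda>x. if P x then [True] else [Q x])"
    by auto
  then show ?thesis using fp_if[OF assms(1) fp_const assms(2)] by metis
qed

lemma fp_pred_eq: assumes "fp_pred P" "fp_pred Q" shows "fp_pred (\<lambda>x. P x = Q x)"
proof -
  have "(\<lambda>x. [P x = Q x]) = (\<lambda>x. if P x then [Q x] else [\<not> Q x])"
    by auto
  then show ?thesis using fp_if[OF assms fp_pred_not[OF assms(2)]] by metis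
qed

lemma fp_Cons_pred: assumes "fp_pred Q" "fp f" shows "fp (\<lambda>x. Q x # f x)"
proof -
  have "(\<lambda>x. Q x # f x) = (\<lambda>x. if Q x then True # f x else False # f x)"
    by auto
  then show ?thesis using fp_if[OF assms(1) fp_Cons fp_Cons, OF assms(2) assms(2)] by metis
qed

text \<open>
  The rule \<open>fp_Cons_pred\<close> must be tried last: it applies to every goal \<open>fp_pred Q\<close> and reproduces it.
\<close>

lemmas fp_basic_intros =
  fp_id fp_const fp_pred_top_true fp_pred_Nil fp_pred_not fp_pred_conj fp_pred_disj fp_pred_eq
  fp_pair fp_pair_fst fp_pair_snd fp_tl fp_if fp_Cons_pred

text \<open>The step may depend on the input \<open>x\<close>, which travels along as the first
  component of a pair. Growth by at most \<open>h x\<close> per round keeps all values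
  polynomial.\<close>

lemma fp_iterate:
  assumes F: "fp (\<lambda>z. F (pair_fst z) (pair_snd z))" and "fp f" "fp g" "poly_bounded h"
    and le: "\<And>x a. length (F x a) \<le> length a + h x"
  shows "fp (\<lambda>x. (F x ^^ length (g x)) (f x))"
proof -
  let ?s = "\<lambda>z. pair_code (pair_fst z) (F (pair_fst z) (pair_snd z))"
  have iter: "(?s ^^ n) (pair_code x a) = pair_code x ((F x ^^ n) a)" for n x a
    by (induction n) auto
  have len: "length ((F x ^^ n) a) \<le> length a + n * h x" for n x a
  proof (induction n)
    case (Suc n)
    then show ?case using le[of x "(F x ^^ n) a"] by simp
  qed simp
  have "fp (\<lambda>x. (?s ^^ length (g x)) (pair_code x (f x)))"
  proof (rule fp_funpow_bounded)
    show "fp ?s" by (intro fp_pair fp_pair_fst fp_id F)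
    show "fp (\<lambda>x. pair_code x (f x))" by (intro fp_pair fp_id assms)
    show "poly_bounded (\<lambda>x. 2 * length x + 1 + (length (f x) + length (g x) * h x))"
      by (intro poly_bounded_intros fp_length assms)
    show "length ((?s ^^ n) (pair_code x (f x))) \<le> 2 * length x + 1 + (length (f x) + length (g x) * h x)"
      if "n \<le> length (g x)" for x n
    proof -
      have "length (f x) + n * h x \<le> length (f x) + length (g x) * h x"
        using that by simp
      then show ?thesis
        using len[of n x "f x"] unfolding iter length_pair_code by linarith
    qed
  qed fact
  from fp_pair_snd[OF this] show ?thesis
    by (simp add: iter)
qed

text \<open>A first component counts twice in a code. With this sharper bound, functions that take
  nested pairs apart and rebuild them are seen to lengthen their argument by a constant
  only.\<close>

lemma length_pair_parts: "2 * length (pair_fst x) + length (pair_snd x) \<le> length x"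
proof (induction x rule: pair_fst.induct)
  case ("2_3" b)
  then show ?case by (cases b) auto
qed auto

text \<open>Bounded recursion on notation in the manner of Cobham, as an iteration on pairs of the
  bits still to be read and the accumulator. Taking a bit from the first component shortens the
  code, so only the growth of the accumulator counts.\<close>

lemma fp_foldl:
  assumes F: "fp (\<lambda>z. F (pair_fst z) (top_true (pair_snd z)) (tl (pair_snd z)))"
    and "fp f" "fp g" "poly_bounded h"
    and le: "\<And>x b a. length (F x b a) \<le> length a + h x"
  shows "fp (\<lambda>x. foldl (\<lambda>a b. F x b a) (f x) (g x))"
proof -
  define G where "G x s = (if pair_fst s = [] then s
    else pair_code (tl (pair_fst s)) (F x (top_true (pair_fst s)) (pair_snd s)))" for x s
  have iter: "(G x ^^ length bs) (pair_code bs a) = pair_code [] (foldl (\<lambda>a b. F x b a) a bs)"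
    for x bs a
    by (induction bs arbitrary: a) (simp_all add: G_def funpow_Suc_right del: funpow.simps(2))
  have F': "fp (\<lambda>z. F (pair_fst z) (top_true (pair_fst (pair_snd z))) (pair_snd (pair_snd z)))"
    using fp_comp[OF F, of "\<lambda>z. pair_code (pair_fst z)
      (top_true (pair_fst (pair_snd z)) # pair_snd (pair_snd z))"]
    by (simp add: fp_basic_intros)
  have "fp (\<lambda>x. (G x ^^ length (g x)) (pair_code (g x) (f x)))"
  proof (rule fp_iterate)
    show "fp (\<lambda>z. G (pair_fst z) (pair_snd z))"
      unfolding G_def by (intro fp_basic_intros F')
    show "fp (\<lambda>x. pair_code (g x) (f x))" by (intro fp_pair assms)
    show "length (G x a) \<le> length a + h x" for x a
    proof (cases "pair_fst a")
      case Nil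
      then show ?thesis by (simp add: G_def)
    next
      case (Cons b bs)
      have "length (G x a) = 2 * length bs + 1 + length (F x b (pair_snd a))"
        using Cons by (simp add: G_def length_pair_code)
      then show ?thesis
        using le[of x b "pair_snd a"] length_pair_parts[of a] Cons by simp
    qed
  qed fact+
  from fp_pair_snd[OF this] show ?thesis
    by (simp add: iter)
qed

section \<open>Reversal, segments, unary polynomials and equality of words\<close>

lemma foldl_Cons_rev: "foldl (\<lambda>a b. b # a) a xs = rev xs @ a"
  by (induction xs arbitrary: a) auto

lemma fp_rev: assumes "fp f" shows "fp (\<lambda>x. rev (f x))"
proof -
  have "fp (\<lambda>x. foldl (\<lambda>a b. b # a) [] x)"
    by (rule fp_foldl[where F = "\<lambda>x b a. b # a" and h = "\<lambda>_. 1"])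
      (simp_all add: fp_basic_intros poly_bounded_const)
  then have "fp rev" by (simp add: foldl_Cons_rev)
  from fp_comp[OF this assms] show ?thesis .
qed

lemma fp_append: assumes "fp f" "fp g" shows "fp (\<lambda>x. f x @ g x)"
proof -
  have "fp (\<lambda>x. foldl (\<lambda>a b. b # a) (g x) (rev (f x)))"
    by (rule fp_foldl[where F = "\<lambda>x b a. b # a" and h = "\<lambda>_. 1"])
      (simp_all add: fp_basic_intros poly_bounded_const fp_rev assms)
  then show ?thesis by (simp add: foldl_Cons_rev)
qed

lemma fp_drop: assumes "fp f" "fp g" shows "fp (\<lambda>x. drop (length (f x)) (g x))"
proof -
  have "fp (\<lambda>x. (tl ^^ length (f x)) (g x))"
    by (rule fp_iterate[where F = "\<lambda>x. tl" and h = "\<lambda>_. 0"])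
      (simp_all add: fp_basic_intros poly_bounded_const assms)
  moreover have "(tl ^^ n) xs = drop n xs" for n and xs :: "bool list"
    by (induction n arbitrary: xs) (simp_all add: funpow_Suc_right drop_Suc del: funpow.simps(2))
  ultimately show ?thesis by simp
qed

lemma fp_take: assumes "fp f" "fp g" shows "fp (\<lambda>x. take (length (f x)) (g x))"
proof -
  have "fp (\<lambda>x. rev (drop (length (drop (length (f x)) (g x))) (rev (g x))))"
    by (intro fp_rev fp_drop assms)
  moreover have "rev (drop (length (drop n xs)) (rev xs)) = take n xs" for n and xs :: "bool list"
    by (cases "n \<le> length xs") (simp_all add: drop_rev)
  ultimately show ?thesis by simp
qed

text \<open>Horner's scheme: \<open>poly (pCons a p) n = a + n * poly p n\<close>, and a fold over
  \<open>x\<close> concatenates \<open>length x\<close> copies of the unary value of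
  \<open>p\<close>.\<close>

lemma fp_replicate_poly: "fp (\<lambda>x. replicate (poly p (length x)) True)"
proof (induction p)
  case 0
  then show ?case by (simp add: fp_const)
next
  case (pCons a p)
  have "fp (\<lambda>x. foldl (\<lambda>acc b. replicate (poly p (length x)) True @ acc) [] x)"
  proof (rule fp_foldl[where F = "\<lambda>x b acc. replicate (poly p (length x)) True @ acc"
        and h = "\<lambda>x. poly p (length x)"])
    show "fp (\<lambda>z. replicate (poly p (length (pair_fst z))) True @ tl (pair_snd z))"
      using fp_comp[OF pCons.IH fp_pair_fst[OF fp_id]]
      by (intro fp_append fp_tl fp_pair_snd fp_id)
  qed (simp_all add: fp_basic_intros poly_bounded_poly poly_bounded_length)
  moreover have "foldl (\<lambda>acc b. replicate m True @ acc) (replicate k True) x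
      = replicate (k + length x * m) True" for m k and x :: "bool list"
    by (induction x arbitrary: k) (auto simp: replicate_add[symmetric] ac_simps)
  from this[of _ 0] have "foldl (\<lambda>acc b. replicate m True @ acc) [] x
      = replicate (length x * m) True" for m and x :: "bool list" by simp
  ultimately have "fp (\<lambda>x. replicate a True @ replicate (length x * poly p (length x)) True)"
    by (intro fp_append fp_const) simp
  then show ?case by (simp add: replicate_add)
qed

lemma fp_take_poly:
  assumes "fp f" "fp g" shows "fp (\<lambda>x. take (poly p (length (f x))) (g x))"
  using fp_take[OF fp_comp[OF fp_replicate_poly assms(1)] assms(2), of p] by simp

lemma fp_pred_list_eq:
  assumes "fp f" "fp g" shows "fp_pred (\<lambda>x. f x = g x)"
proof -
  \<comment> \<open>The state is \<open>[]\<close> after a mismatch and otherwise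
    \<open>True\<close> followed by what is left of \<open>g x\<close>; so the words agree if just
    the \<open>True\<close> remains.\<close>
  define F where "F c st = (if st \<noteq> [] \<and> tl st \<noteq> [] \<and> top_true (tl st) = c then True # tl (tl st) else [])"
    for c st
  have fail: "foldl (\<lambda>st c. F c st) [] xs = []" for xs
    by (induction xs) (auto simp: F_def)
  have step: "F c (True # ys) = (if ys \<noteq> [] \<and> hd ys = c then True # tl ys else [])" for c ys
    by (cases ys) (auto simp: F_def)
  have run: "foldl (\<lambda>st c. F c st) (True # ys) xs
      = (if take (length xs) ys = xs then True # drop (length xs) ys else [])" for xs ys
  proof (induction xs arbitrary: ys)
    case (Cons x xs)
    show ?case by (cases ys) (auto simp: step fail Cons.IH)
  qed simp
  have "fp (\<lambda>x. foldl (\<lambda>st c. F c st) (True # g x) (f x))"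
  proof (rule fp_foldl[where F = "\<lambda>x. F" and h = "\<lambda>_. 0"])
    show "fp (\<lambda>z. F (top_true (pair_snd z)) (tl (pair_snd z)))"
      unfolding F_def by (intro fp_basic_intros)
    show "length (F b a) \<le> length a + 0" for b a
      by (cases a) (auto simp: F_def)
  qed (simp_all add: fp_basic_intros fp_Cons poly_bounded_const assms)
  then have "fp_pred (\<lambda>x. foldl (\<lambda>st c. F c st) (True # g x) (f x) \<noteq> [] \<and>
      tl (foldl (\<lambda>st c. F c st) (True # g x) (f x)) = [])"
    by (intro fp_basic_intros)
  moreover have "(foldl (\<lambda>st c. F c st) (True # ys) xs \<noteq> [] \<and>
      tl (foldl (\<lambda>st c. F c st) (True # ys) xs) = []) \<longleftrightarrow> xs = ys" for xs ys
    by (auto simp: run)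
  ultimately show ?thesis by simp
qed

lemmas fp_intros = fp_rev fp_append fp_drop fp_take fp_take_poly fp_pred_list_eq fp_basic_intros

section \<open>Closure properties of the polynomial hierarchy\<close>

lemma fp_pred_P:
  assumes "fp_pred Q" shows "{x. Q x} \<in> P_class"
proof -
  obtain c K T where c: "poly_bounded T" "computes c K (\<lambda>x. [Q x]) T" "0 < K"
    using fpD[OF assms] by blast
  show ?thesis
  proof (rule prog_decides_P)
    show "wf_prog K 3 c" using computes_wf[OF c(2)] by simp
    show "local_guard K (\<lambda>r. r 0 = 2)" using c(3) by simp
    show "\<exists>\<tau>. runs c (input_store x) (T x) \<tau> \<and> (reads \<tau> 0 = 2 \<longleftrightarrow> x \<in> {x. Q x})" for x
    proof (intro exI conjI)
      show "runs c (input_store x) (T x) (list_store ((\<lambda>_. [])(0 := [Q x])))"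
        unfolding input_store_def by (rule computes_runs[OF c(2)]) auto
      show "reads (list_store ((\<lambda>_. [])(0 := [Q x]))) 0 = 2 \<longleftrightarrow> x \<in> {x. Q x}"
        by (simp add: reads_true)
    qed
  qed (use c in auto)
qed

text \<open>Turns membership in the class into a subroutine that can be placed on any block of
  tapes, next to others; the verdict is read off the state cell.\<close>

lemma P_classE:
  assumes "A \<in> P_class"
  obtains M p where "wf_tm M"
    "\<And>b x \<sigma>. \<sigma> b = list_tape x \<Longrightarrow> (\<And>j. b < j \<Longrightarrow> j \<le> b + num_tapes M \<Longrightarrow> \<sigma> j = list_tape []) \<Longrightarrow>
      \<exists>\<tau>. runs (tm_prog M b) \<sigma> (2 * poly p (length x) + 1) \<tau> \<and>
        reads \<tau> (b + num_tapes M) = (if x \<in> A then 1 else 2) \<and>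
        (\<forall>j. j < b \<or> b + num_tapes M < j \<longrightarrow> \<tau> j = \<sigma> j)"
proof -
  obtain M and p :: "nat poly" where M: "wf_tm M"
    "\<And>x. \<exists>t \<le> poly p (length x). tm_state_after M x t = (if x \<in> A then 1 else 2)"
    using assms unfolding P_class_def by blast
  have k: "0 < num_tapes M" and s: "3 \<le> num_symbols M" "3 \<le> num_states M"
    using M(1) by (auto simp: wf_tm_def)
  show ?thesis
  proof (rule that[OF M(1)])
    fix b x and \<sigma> :: store
    assume \<sigma>: "\<sigma> b = list_tape x"
      "\<And>j. b < j \<Longrightarrow> j \<le> b + num_tapes M \<Longrightarrow> \<sigma> j = list_tape []"
    obtain t where t: "t \<le> poly p (length x)" "tm_state_after M x t = (if x \<in> A then 1 else 2)"
      using M(2) by blast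
    obtain q' ts' where e: "(tm_step M ^^ t) (init_config M x) = (q', ts')" by fastforce
    have q': "q' = (if x \<in> A then 1 else 2)" using t(2) e by (simp add: tm_state_after_def)
    define ts where "ts = input_tape x # replicate (num_tapes M - 1) blank_tape"
    have init: "init_config M x = (0, ts)" by (simp add: init_config_def ts_def)
    have "\<exists>\<tau>. runs (tm_prog M b) \<sigma> (2 * t + 1) \<tau> \<and> \<tau> (b + num_tapes M) 0 = q' \<and>
        (\<forall>j. j < b \<or> b + num_tapes M < j \<longrightarrow> \<tau> j = \<sigma> j)"
    proof (rule tm_prog_correct[OF M(1)])
      show "(tm_step M ^^ t) (0, ts) = (q', ts')" using e init by simp
      show "q' \<in> {1, 2}" using q' by simp
      show "valid_config M (0, ts)"
        using k s by (auto simp: valid_config_def ts_def input_tape_def blank_tape_def)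
      show "rel_tape (ts ! j) = \<sigma> (b + j)" if "j < num_tapes M" for j
        using that \<sigma> by (cases j) (simp_all add: ts_def rel_tape_input rel_tape_blank)
      \<comment> \<open>The state cell lies on an empty tape, and the blank is the number of the
        start state.\<close>
      show "\<sigma> (b + num_tapes M) 0 = 0"
        using \<sigma>(2)[of "b + num_tapes M"] k by (simp add: list_tape_def)
    qed
    then obtain \<tau> where \<tau>: "runs (tm_prog M b) \<sigma> (2 * t + 1) \<tau>" "\<tau> (b + num_tapes M) 0 = q'"
      "\<forall>j. j < b \<or> b + num_tapes M < j \<longrightarrow> \<tau> j = \<sigma> j" by blast
    show "\<exists>\<tau>. runs (tm_prog M b) \<sigma> (2 * poly p (length x) + 1) \<tau> \<and>
        reads \<tau> (b + num_tapes M) = (if x \<in> A then 1 else 2) \<and>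
        (\<forall>j. j < b \<or> b + num_tapes M < j \<longrightarrow> \<tau> j = \<sigma> j)"
    proof (intro exI[of _ \<tau>] conjI)
      show "runs (tm_prog M b) \<sigma> (2 * poly p (length x) + 1) \<tau>"
        using \<tau>(1) by (rule runs_mono) (use t in simp)
      show "reads \<tau> (b + num_tapes M) = (if x \<in> A then 1 else 2)"
        using \<tau>(2) q' by (simp add: reads_def)
    qed (use \<tau>(3) in simp)
  qed
qed

lemma P_vimage:
  assumes "A \<in> P_class" "fp f" shows "{x. f x \<in> A} \<in> P_class"
proof -
  obtain c K T where c: "poly_bounded (\<lambda>x. length (f x))" "poly_bounded T" "computes c K f T" "0 < K"
    using fpD[OF assms(2)] by blast
  obtain M p where M: "wf_tm M"
    "\<And>b x \<sigma>. \<sigma> b = list_tape x \<Longrightarrow> (\<And>j. b < j \<Longrightarrow> j \<le> b + num_tapes M \<Longrightarrow> \<sigma> j = list_tape []) \<Longrightarrow>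
      \<exists>\<tau>. runs (tm_prog M b) \<sigma> (2 * poly p (length x) + 1) \<tau> \<and>
        reads \<tau> (b + num_tapes M) = (if x \<in> A then 1 else 2) \<and>
        (\<forall>j. j < b \<or> b + num_tapes M < j \<longrightarrow> \<tau> j = \<sigma> j)"
    using P_classE[OF assms(1)] by blast
  let ?k = "num_tapes M" and ?S = "3 + num_states M + num_symbols M"
  show ?thesis
  proof (rule prog_decides_P[where c = "Seq c (tm_prog M 0)" and K = "K + ?k + 1" and S = ?S
        and P = "\<lambda>r. r ?k = 1" and T = "\<lambda>x. T x + (2 * poly p (length (f x)) + 1)"])
    show "wf_prog (K + ?k + 1) ?S (Seq c (tm_prog M 0))"
      using wf_tm_prog[OF M(1), of 0 "K + ?k + 1" ?S]
        wf_prog_mono[OF computes_wf[OF c(3) order_refl], of "K + ?k + 1" ?S] by simp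
    show "poly_bounded (\<lambda>x. T x + (2 * poly p (length (f x)) + 1))"
      by (intro poly_bounded_intros c)
    fix x
    have r: "runs c (input_store x) (T x) (list_store ((\<lambda>_. [])(0 := f x)))"
      unfolding input_store_def by (rule computes_runs[OF c(3)]) auto
    obtain \<tau> where \<tau>: "runs (tm_prog M 0) (list_store ((\<lambda>_. [])(0 := f x)))
        (2 * poly p (length (f x)) + 1) \<tau>" "reads \<tau> ?k = (if f x \<in> A then 1 else 2)"
      using M(2)[of "list_store ((\<lambda>_. [])(0 := f x))" 0 "f x"] by (auto simp: list_store_def)
    then have "runs (Seq c (tm_prog M 0)) (input_store x) (T x + (2 * poly p (length (f x)) + 1)) \<tau> \<and>
        (reads \<tau> ?k = 1 \<longleftrightarrow> x \<in> {x. f x \<in> A})"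
      using runs_Seq[OF r \<tau>(1)] by simp
    then show "\<exists>\<tau>. runs (Seq c (tm_prog M 0)) (input_store x)
        (T x + (2 * poly p (length (f x)) + 1)) \<tau> \<and> (reads \<tau> ?k = 1 \<longleftrightarrow> x \<in> {x. f x \<in> A})"
      by (intro exI[of _ \<tau>])
  qed (use c in auto)
qed

text \<open>Both machines run on copies of the input, and the final guard reads both verdicts. An
  arbitrary \<open>\<Phi>\<close> yields intersection, union and complement at once.\<close>

lemma P_combine:
  assumes "A \<in> P_class" "B \<in> P_class"
  shows "{x. \<Phi> (x \<in> A) (x \<in> B)} \<in> P_class"
proof -
  obtain M p where M: "wf_tm M"
    "\<And>b x \<sigma>. \<sigma> b = list_tape x \<Longrightarrow> (\<And>j. b < j \<Longrightarrow> j \<le> b + num_tapes M \<Longrightarrow> \<sigma> j = list_tape []) \<Longrightarrow>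
      \<exists>\<tau>. runs (tm_prog M b) \<sigma> (2 * poly p (length x) + 1) \<tau> \<and>
        reads \<tau> (b + num_tapes M) = (if x \<in> A then 1 else 2) \<and>
        (\<forall>j. j < b \<or> b + num_tapes M < j \<longrightarrow> \<tau> j = \<sigma> j)"
    using P_classE[OF assms(1)] by blast
  obtain N q where N: "wf_tm N"
    "\<And>b x \<sigma>. \<sigma> b = list_tape x \<Longrightarrow> (\<And>j. b < j \<Longrightarrow> j \<le> b + num_tapes N \<Longrightarrow> \<sigma> j = list_tape []) \<Longrightarrow>
      \<exists>\<tau>. runs (tm_prog N b) \<sigma> (2 * poly q (length x) + 1) \<tau> \<and>
        reads \<tau> (b + num_tapes N) = (if x \<in> B then 1 else 2) \<and>
        (\<forall>j. j < b \<or> b + num_tapes N < j \<longrightarrow> \<tau> j = \<sigma> j)"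
    using P_classE[OF assms(2)] by blast
  \<comment> \<open>Tapes 0 to \<open>m\<close> serve the first machine and \<open>b\<close> to
    \<open>n\<close> the second, each block ending in a state cell; tape \<open>n + 1\<close> is
    scratch space of \<open>copy\<close>.\<close>
  define m where "m = num_tapes M"
  define b where "b = m + 1"
  define n where "n = b + num_tapes N"
  let ?S = "3 + num_states M + num_symbols M + num_states N + num_symbols N"
  let ?c = "Seq (copy 0 (n + 1) b) (Seq (tm_prog M 0) (tm_prog N b))"
  let ?T = "\<lambda>x. (12 * length x + 2) + ((2 * poly p (length x) + 1) + (2 * poly q (length x) + 1))"
  show ?thesis
  proof (rule prog_decides_P[where c = ?c and K = "n + 2" and S = ?S
        and P = "\<lambda>r. \<Phi> (r m = 1) (r n = 1)" and T = ?T])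
    show "wf_prog (n + 2) ?S ?c"
      using wf_tm_prog[OF M(1), of 0 "n + 2" ?S] wf_tm_prog[OF N(1), of b "n + 2" ?S]
      by (simp add: m_def n_def b_def)
    show "local_guard (n + 2) (\<lambda>r. \<Phi> (r m = 1) (r n = 1))"
      by (simp add: local_guard_def m_def n_def b_def)
    show "poly_bounded ?T" by (intro poly_bounded_intros)
    fix x
    let ?v = "(\<lambda>_. [])(0 := x, b := x) :: nat \<Rightarrow> bool list"
    have r1: "runs (copy 0 (n + 1) b) (input_store x) (12 * length x + 2) (list_store ?v)"
      using runs_copy[of 0 "n + 1" b "(\<lambda>_. [])(0 := x)"]
      by (simp add: input_store_def n_def b_def del: fun_upd_apply)
        (simp add: fun_upd_def)
    have "\<exists>\<tau>. runs (tm_prog M 0) (list_store ?v) (2 * poly p (length x) + 1) \<tau> \<and>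
        reads \<tau> (0 + num_tapes M) = (if x \<in> A then 1 else 2) \<and>
        (\<forall>j. j < 0 \<or> 0 + num_tapes M < j \<longrightarrow> \<tau> j = list_store ?v j)"
      by (rule M(2)) (auto simp: list_store_def b_def m_def)
    then obtain \<tau> where \<tau>: "runs (tm_prog M 0) (list_store ?v) (2 * poly p (length x) + 1) \<tau>"
      "reads \<tau> m = (if x \<in> A then 1 else 2)" "\<And>j. m < j \<Longrightarrow> \<tau> j = list_store ?v j"
      unfolding m_def by auto
    have "\<exists>\<rho>. runs (tm_prog N b) \<tau> (2 * poly q (length x) + 1) \<rho> \<and>
        reads \<rho> (b + num_tapes N) = (if x \<in> B then 1 else 2) \<and>
        (\<forall>j. j < b \<or> b + num_tapes N < j \<longrightarrow> \<rho> j = \<tau> j)"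
      by (rule N(2)) (auto simp: \<tau>(3) list_store_def b_def)
    then obtain \<rho> where \<rho>: "runs (tm_prog N b) \<tau> (2 * poly q (length x) + 1) \<rho>"
      "reads \<rho> n = (if x \<in> B then 1 else 2)" "\<rho> m = \<tau> m"
      unfolding n_def by (auto simp: b_def)
    show "\<exists>\<tau>. runs ?c (input_store x) (?T x) \<tau> \<and>
        (\<Phi> (reads \<tau> m = 1) (reads \<tau> n = 1) \<longleftrightarrow> x \<in> {x. \<Phi> (x \<in> A) (x \<in> B)})"
    proof (intro exI[of _ \<rho>] conjI)
      show "runs ?c (input_store x) (?T x) \<rho>"
        by (rule runs_Seq[OF r1 runs_Seq[OF \<tau>(1) \<rho>(1)]])
      have "reads \<rho> m = (if x \<in> A then 1 else 2)"
        using \<tau>(2) \<rho>(3) by (simp add: reads_def)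
      then show "\<Phi> (reads \<rho> m = 1) (reads \<rho> n = 1) \<longleftrightarrow> x \<in> {x. \<Phi> (x \<in> A) (x \<in> B)}"
        using \<rho>(2) by simp
    qed
  qed simp_all
qed

section \<open>The levels of the hierarchy\<close>

lemma Sigma_p_SucI:
  assumes "- L' \<in> Sigma_p i"
    "\<And>x. x \<in> L \<longleftrightarrow> (\<exists>u. length u \<le> poly p (length x) \<and> pair_code x u \<in> L')"
  shows "L \<in> Sigma_p (Suc i)"
  using assms by auto

lemma Sigma_p_SucE:
  assumes "L \<in> Sigma_p (Suc i)"
  obtains L' p where "- L' \<in> Sigma_p i"
    "\<And>x. x \<in> L \<longleftrightarrow> (\<exists>u. length u \<le> poly p (length x) \<and> pair_code x u \<in> L')"
  using assms by auto

text \<open>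
  A certificate is cut to the length allowed for the original problem; this replaces a test of its
  length.
\<close>

lemma Sigma_p_vimage:
  assumes "A \<in> Sigma_p i" "fp f" shows "{x. f x \<in> A} \<in> Sigma_p i"
  using assms
proof (induction i arbitrary: A f)
  case 0
  then show ?case by (simp add: P_vimage)
next
  case (Suc i)
  obtain L' p where L': "- L' \<in> Sigma_p i"
    "\<And>x. x \<in> A \<longleftrightarrow> (\<exists>u. length u \<le> poly p (length x) \<and> pair_code x u \<in> L')"
    using Sigma_p_SucE[OF Suc.prems(1)] by blast
  obtain q where q: "\<And>x. poly p (length (f x)) \<le> poly q (length x)"
    using poly_bounded_poly[OF fp_length[OF Suc.prems(2)], of p] unfolding poly_bounded_def by blast
  let ?g = "\<lambda>z. pair_code (f (pair_fst z)) (take (poly p (length (f (pair_fst z)))) (pair_snd z))"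
  have f: "fp (\<lambda>z. f (pair_fst z))" by (rule fp_comp[OF Suc.prems(2) fp_pair_fst[OF fp_id]])
  have "fp ?g" by (intro fp_intros f)
  from Suc.IH[OF L'(1) this] have "- {z. ?g z \<in> L'} \<in> Sigma_p i"
    by (simp add: Collect_neg_eq)
  then show ?case
  proof (rule Sigma_p_SucI)
    fix x
    show "x \<in> {x. f x \<in> A} \<longleftrightarrow> (\<exists>u. length u \<le> poly q (length x) \<and> pair_code x u \<in> {z. ?g z \<in> L'})"
      (is "_ \<longleftrightarrow> ?R")
    proof
      assume "x \<in> {x. f x \<in> A}"
      then obtain u where u: "length u \<le> poly p (length (f x))" "pair_code (f x) u \<in> L'"
        using L'(2) by blast
      show ?R
        by (rule exI[of _ u]) (use u q[of x] in simp)
    next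
      assume ?R
      then obtain u where "pair_code (f x) (take (poly p (length (f x))) u) \<in> L'" by auto
      moreover have "length (take (poly p (length (f x))) u) \<le> poly p (length (f x))" by simp
      ultimately show "x \<in> {x. f x \<in> A}" using L'(2) by blast
    qed
  qed
qed

lemma Pi_p_vimage: "A \<in> Pi_p i \<Longrightarrow> fp f \<Longrightarrow> {x. f x \<in> A} \<in> Pi_p i"
  using Sigma_p_vimage[of "- A" i f] by (simp add: Pi_p_def Collect_neg_eq)

text \<open>The two claims need each other: the quantified language enters through its complement,
  so intersection at one level rests on union at the level below, and conversely. Certificates are
  combined into a pair, one half of which may be empty for a union.\<close>

lemma Sigma_p_Int_Un:
  assumes "A \<in> Sigma_p i" "B \<in> Sigma_p i" shows "A \<inter> B \<in> Sigma_p i \<and> A \<union> B \<in> Sigma_p i"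
  using assms
proof (induction i arbitrary: A B)
  case 0
  then show ?case
    using P_combine[of A B "(\<and>)"] P_combine[of A B "(\<or>)"] by (simp add: Int_def Un_def)
next
  case (Suc i)
  obtain A' p where A': "- A' \<in> Sigma_p i"
    "\<And>x. x \<in> A \<longleftrightarrow> (\<exists>u. length u \<le> poly p (length x) \<and> pair_code x u \<in> A')"
    using Sigma_p_SucE[OF Suc.prems(1)] by blast
  obtain B' q where B': "- B' \<in> Sigma_p i"
    "\<And>x. x \<in> B \<longleftrightarrow> (\<exists>u. length u \<le> poly q (length x) \<and> pair_code x u \<in> B')"
    using Sigma_p_SucE[OF Suc.prems(2)] by blast
  let ?g = "\<lambda>z. pair_code (pair_fst z) (take (poly p (length (pair_fst z))) (pair_fst (pair_snd z)))"
  let ?h = "\<lambda>z. pair_code (pair_fst z) (take (poly q (length (pair_fst z))) (pair_snd (pair_snd z)))"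
  have "fp ?g" "fp ?h" by (intro fp_intros)+
  then have "- {z. ?g z \<in> A'} \<in> Sigma_p i" "- {z. ?h z \<in> B'} \<in> Sigma_p i"
    using Sigma_p_vimage[OF A'(1)] Sigma_p_vimage[OF B'(1)] by (simp_all add: Collect_neg_eq)
  from Suc.IH[OF this] have
    "- ({z. ?g z \<in> A'} \<union> {z. ?h z \<in> B'}) \<in> Sigma_p i" "- ({z. ?g z \<in> A'} \<inter> {z. ?h z \<in> B'}) \<in> Sigma_p i"
    by (simp_all only: Compl_Un Compl_Int)
  have A_take: "pair_code x (take (poly p (length x)) u) \<in> A' \<Longrightarrow> x \<in> A" for x u
    using A'(2)[of x] by (metis length_take min.cobounded2)
  have B_take: "pair_code x (take (poly q (length x)) u) \<in> B' \<Longrightarrow> x \<in> B" for x u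
    using B'(2)[of x] by (metis length_take min.cobounded2)
  \<comment> \<open>The length of a pair code: the first component doubled, one separator, the
    second component.\<close>
  let ?r = "[:2:] * p + 1 + q"
  have r: "length (pair_code u v) \<le> poly ?r (length x)"
    if "length u \<le> poly p (length x)" "length v \<le> poly q (length x)" for u v x :: "bool list"
    using that by (simp add: length_pair_code)
  show ?case
  proof
    show "A \<inter> B \<in> Sigma_p (Suc i)"
    proof (rule Sigma_p_SucI)
      show "- ({z. ?g z \<in> A'} \<inter> {z. ?h z \<in> B'}) \<in> Sigma_p i" by fact
      fix x
      show "x \<in> A \<inter> B \<longleftrightarrow> (\<exists>u. length u \<le> poly ?r (length x) \<and>
          pair_code x u \<in> {z. ?g z \<in> A'} \<inter> {z. ?h z \<in> B'})" (is "_ \<longleftrightarrow> ?R")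
      proof
        assume "x \<in> A \<inter> B"
        then obtain u v where "length u \<le> poly p (length x)" "pair_code x u \<in> A'"
          "length v \<le> poly q (length x)" "pair_code x v \<in> B'"
          using A'(2) B'(2) by blast
        then show ?R using r[of u x v] by (intro exI[of _ "pair_code u v"]) auto
      qed (use A_take B_take in auto)
    qed
    show "A \<union> B \<in> Sigma_p (Suc i)"
    proof (rule Sigma_p_SucI)
      show "- ({z. ?g z \<in> A'} \<union> {z. ?h z \<in> B'}) \<in> Sigma_p i" by fact
      fix x
      show "x \<in> A \<union> B \<longleftrightarrow> (\<exists>u. length u \<le> poly ?r (length x) \<and>
          pair_code x u \<in> {z. ?g z \<in> A'} \<union> {z. ?h z \<in> B'})" (is "_ \<longleftrightarrow> ?R")
      proof
        assume "x \<in> A \<union> B"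
        then consider u where "length u \<le> poly p (length x)" "pair_code x u \<in> A'"
          | v where "length v \<le> poly q (length x)" "pair_code x v \<in> B'"
          using A'(2) B'(2) by blast
        then show ?R
        proof cases
          case 1
          then show ?R using r[of u x "[]"] by (intro exI[of _ "pair_code u []"]) auto
        next
          case 2
          then show ?R using r[of "[]" x v] by (intro exI[of _ "pair_code [] v"]) auto
        qed
      qed (use A_take B_take in auto)
    qed
  qed
qed

lemma Sigma_p_Int: "A \<in> Sigma_p i \<Longrightarrow> B \<in> Sigma_p i \<Longrightarrow> A \<inter> B \<in> Sigma_p i"
  and Sigma_p_Un: "A \<in> Sigma_p i \<Longrightarrow> B \<in> Sigma_p i \<Longrightarrow> A \<union> B \<in> Sigma_p i"
  using Sigma_p_Int_Un by blast+

text \<open>A dummy quantifier, with the empty word as the only certificate allowed.\<close>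

lemma Pi_p_subset_Sigma_p: assumes "A \<in> Pi_p i" shows "A \<in> Sigma_p (Suc i)"
proof (rule Sigma_p_SucI[where p = 0])
  show "- {z. pair_fst z \<in> A} \<in> Sigma_p i"
    using Pi_p_vimage[OF assms fp_pair_fst[OF fp_id]] by (simp add: Pi_p_def)
qed simp

text \<open>For monotonicity only the innermost level is changed: there P is closed under
  complement, so a dummy quantifier can be added. The outer quantifiers keep their bounds.\<close>

lemma P_subset_Sigma_p: "A \<in> P_class \<Longrightarrow> A \<in> Sigma_p i"
  and Sigma_p_mono: "A \<in> Sigma_p i \<Longrightarrow> A \<in> Sigma_p (Suc i)"
proof -
  have compl: "- A \<in> P_class" if "A \<in> P_class" for A
    using P_combine[OF that that, of "\<lambda>a b. \<not> a"] by (simp add: Collect_neg_eq)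
  show mono: "A \<in> Sigma_p (Suc i)" if "A \<in> Sigma_p i" for A i
    using that
  proof (induction i arbitrary: A)
    case 0
    then show ?case using compl by (intro Pi_p_subset_Sigma_p) (simp add: Pi_p_def)
  next
    case (Suc i)
    obtain L' p where L': "- L' \<in> Sigma_p i"
      "\<And>x. x \<in> A \<longleftrightarrow> (\<exists>u. length u \<le> poly p (length x) \<and> pair_code x u \<in> L')"
      using Sigma_p_SucE[OF Suc.prems(1)] by blast
    show ?case by (rule Sigma_p_SucI[OF Suc.IH[OF L'(1)] L'(2)])
  qed
  show "A \<in> Sigma_p i" if "A \<in> P_class" for A
    by (induction i) (use that mono in simp_all)
qed

text \<open>Two adjacent existential quantifiers merge into one over pairs.\<close>

lemma Sigma_p_ex:
  assumes "A \<in> Sigma_p (Suc i)"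
  shows "{x. \<exists>u. length u \<le> poly p (length x) \<and> pair_code x u \<in> A} \<in> Sigma_p (Suc i)"
proof -
  obtain L' q where L': "- L' \<in> Sigma_p i"
    "\<And>x. x \<in> A \<longleftrightarrow> (\<exists>u. length u \<le> poly q (length x) \<and> pair_code x u \<in> L')"
    using Sigma_p_SucE[OF assms] by blast
  let ?w = "\<lambda>z. pair_code (pair_fst z) (take (poly p (length (pair_fst z))) (pair_fst (pair_snd z)))"
  let ?g = "\<lambda>z. pair_code (?w z) (take (poly q (length (?w z))) (pair_snd (pair_snd z)))"
  have "fp ?g" by (intro fp_intros)
  from Sigma_p_vimage[OF L'(1) this] have g: "- {z. ?g z \<in> L'} \<in> Sigma_p i"
    by (simp add: Collect_neg_eq)
  \<comment> \<open>\<open>?s\<close> bounds the length of \<open>pair_code x u\<close>, on which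
    the bound for the inner certificate depends; \<open>?r\<close> bounds the pair of both
    certificates.\<close>
  let ?s = "[:1, 2:] + p"
  let ?r = "[:2:] * p + 1 + pcompose q ?s"
  show ?thesis
  proof (rule Sigma_p_SucI[OF g])
    fix x
    show "x \<in> {x. \<exists>u. length u \<le> poly p (length x) \<and> pair_code x u \<in> A} \<longleftrightarrow>
      (\<exists>u. length u \<le> poly ?r (length x) \<and> pair_code x u \<in> {z. ?g z \<in> L'})" (is "_ \<longleftrightarrow> ?R")
    proof
      assume "x \<in> {x. \<exists>u. length u \<le> poly p (length x) \<and> pair_code x u \<in> A}"
      then obtain u v where u: "length u \<le> poly p (length x)" and
        v: "length v \<le> poly q (length (pair_code x u))" "pair_code (pair_code x u) v \<in> L'"
        using L'(2) by blast
      have "length (pair_code x u) \<le> poly ?s (length x)"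
        using u by (simp add: length_pair_code)
      then have "length v \<le> poly (pcompose q ?s) (length x)"
        using v(1) poly_nat_mono[of _ _ q] unfolding poly_pcompose by (meson le_trans)
      then have "length (pair_code u v) \<le> poly ?r (length x)"
        using u by (simp add: length_pair_code)
      then show ?R using u v by (intro exI[of _ "pair_code u v"]) auto
    next
      assume ?R
      then obtain w where w: "pair_code (pair_code x (take (poly p (length x)) (pair_fst w)))
        (take (poly q (length (pair_code x (take (poly p (length x)) (pair_fst w))))) (pair_snd w)) \<in> L'"
        by auto
      let ?u = "take (poly p (length x)) (pair_fst w)"
      have "pair_code x ?u \<in> A" using w L'(2)[of "pair_code x ?u"] by (metis length_take min.cobounded2)
      moreover have "length ?u \<le> poly p (length x)" by simp
      ultimately show "x \<in> {x. \<exists>u. length u \<le> poly p (length x) \<and> pair_code x u \<in> A}" by blast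
    qed
  qed
qed

section \<open>Arithmetic in binary notation\<close>

text \<open>Zeros at the significant end are harmless, so every word denotes a number.
  \<open>nat_code (bits_val w)\<close> is the normal form that queries need.\<close>

fun bits_val :: "bool list \<Rightarrow> nat" where
  "bits_val [] = 0"
| "bits_val (b # bs) = of_bool b + 2 * bits_val bs"

lemma nat_code_0 [simp]: "nat_code 0 = []"
  by (simp add: nat_code.simps)

lemma nat_code_bit: "nat_code (of_bool b + 2 * m) = (if \<not> b \<and> m = 0 then [] else b # nat_code m)"
  by (cases b) (subst nat_code.simps, simp)+

lemma nat_code_Nil_iff [simp]: "nat_code n = [] \<longleftrightarrow> n = 0"
  by (subst nat_code.simps) simp

lemma bits_val_nat_code [simp]: "bits_val (nat_code n) = n"
proof (induction n rule: nat_code.induct)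
  case (1 n)
  show ?case
  proof (cases "n = 0")
    case False
    then have "bits_val (nat_code n) = of_bool (odd n) + 2 * (n div 2)"
      by (subst nat_code.simps) (simp add: 1)
    then show ?thesis by simp
  qed simp
qed

lemma nat_code_inject [simp]: "nat_code m = nat_code n \<longleftrightarrow> m = n"
  by (metis bits_val_nat_code)

lemma bits_val_less: "bits_val bs < 2 ^ length bs"
  by (induction bs) (auto simp: of_bool_def)

lemma length_nat_code_le: "n < 2 ^ k \<Longrightarrow> length (nat_code n) \<le> k"
proof (induction k arbitrary: n)
  case (Suc k)
  show ?case
  proof (cases "n = 0")
    case False
    then have "length (nat_code n) = Suc (length (nat_code (n div 2)))"
      by (subst nat_code.simps) simp
    moreover have "n div 2 < 2 ^ k" using Suc.prems by simp
    ultimately show ?thesis using Suc.IH by simp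
  qed simp
qed simp

lemma length_nat_code_mono: "m \<le> n \<Longrightarrow> length (nat_code m) \<le> length (nat_code n)"
  using bits_val_less[of "nat_code n"] by (intro length_nat_code_le) simp

lemma bits_val_split: "bits_val xs = of_bool (top_true xs) + 2 * bits_val (tl xs)"
  by (cases xs) auto

abbreviation fp_nat :: "(bool list \<Rightarrow> nat) \<Rightarrow> bool" where
  "fp_nat N \<equiv> fp (\<lambda>x. nat_code (N x))"

text \<open>Normalisation from the most significant bit on: zeros are dropped as long as nothing has
  been kept.\<close>

lemma fp_nat_bits_val: assumes "fp f" shows "fp_nat (\<lambda>x. bits_val (f x))"
proof -
  let ?F = "\<lambda>b acc. if \<not> b \<and> acc = [] then [] else b # acc"
  have "fp (\<lambda>x. foldl (\<lambda>acc b. ?F b acc) [] (rev (f x)))"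
  proof (rule fp_foldl[where F = "\<lambda>x. ?F" and h = "\<lambda>_. 1"])
    show "fp (\<lambda>z. ?F (top_true (pair_snd z)) (tl (pair_snd z)))"
      by (intro fp_intros)
  qed (simp_all add: fp_const fp_rev assms poly_bounded_const)
  moreover have "foldr ?F bs [] = nat_code (bits_val bs)" for bs
    by (induction bs) (auto simp: nat_code_bit)
  ultimately show ?thesis by (simp add: foldr_conv_foldl)
qed

text \<open>A full adder: the carry is the majority of three bits and \<open>(x = y) = c\<close>
  their exclusive or. The last component is the carry in front of the sum bits produced so far,
  latest first.\<close>

definition add_step :: "bool list \<Rightarrow> bool list" where
  "add_step s = (let x = top_true (pair_fst s); y = top_true (pair_fst (pair_snd s));
      c = top_true (pair_snd (pair_snd s)) in
    pair_code (tl (pair_fst s)) (pair_code (tl (pair_fst (pair_snd s)))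
      ((x \<and> y \<or> (x \<or> y) \<and> c) # ((x = y) = c) # tl (pair_snd (pair_snd s)))))"

lemma add_steps:
  "\<exists>ds c'. (add_step ^^ n) (pair_code xs (pair_code ys (c # out)))
      = pair_code (drop n xs) (pair_code (drop n ys) (c' # rev ds @ out)) \<and> length ds = n \<and>
    bits_val ds + 2 ^ n * (of_bool c' + bits_val (drop n xs) + bits_val (drop n ys))
      = of_bool c + bits_val xs + bits_val ys"
proof (induction n arbitrary: xs ys c out)
  case 0
  show ?case by (intro exI[of _ "[]"] exI[of _ c]) simp
next
  case (Suc n)
  let ?x = "top_true xs" and ?y = "top_true ys"
  let ?c = "?x \<and> ?y \<or> (?x \<or> ?y) \<and> c" and ?d = "(?x = ?y) = c"
  obtain ds c' where IH: "(add_step ^^ n) (pair_code (tl xs) (pair_code (tl ys) (?c # ?d # out)))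
      = pair_code (drop n (tl xs)) (pair_code (drop n (tl ys)) (c' # rev ds @ ?d # out))"
    "length ds = n"
    "bits_val ds + 2 ^ n * (of_bool c' + bits_val (drop n (tl xs)) + bits_val (drop n (tl ys)))
      = of_bool ?c + bits_val (tl xs) + bits_val (tl ys)"
    using Suc.IH by blast
  have "(add_step ^^ Suc n) (pair_code xs (pair_code ys (c # out)))
    = (add_step ^^ n) (pair_code (tl xs) (pair_code (tl ys) (?c # ?d # out)))"
    by (simp add: funpow_Suc_right add_step_def Let_def del: funpow.simps)
  moreover have "of_bool ?d + 2 * of_bool ?c = (of_bool c + of_bool ?x + of_bool ?y :: nat)"
    by auto
  then have "bits_val (?d # ds) + 2 ^ Suc n *
      (of_bool c' + bits_val (drop (Suc n) xs) + bits_val (drop (Suc n) ys))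
      = of_bool c + bits_val xs + bits_val ys"
    using IH(3) bits_val_split[of xs] bits_val_split[of ys] by (simp add: drop_Suc algebra_simps)
  ultimately show ?case
    using IH(1,2) by (intro exI[of _ "?d # ds"] exI[of _ c']) (simp add: drop_Suc)
qed

lemma bits_val_append: "bits_val (xs @ ys) = bits_val xs + 2 ^ length xs * bits_val ys"
  by (induction xs) auto

lemma fp_nat_add: assumes "fp_nat M" "fp_nat N" shows "fp_nat (\<lambda>x. M x + N x)"
proof -
  have "fp (\<lambda>x. (add_step ^^ length (nat_code (M x) @ nat_code (N x)))
      (pair_code (nat_code (M x)) (pair_code (nat_code (N x)) [False])))"
  proof (rule fp_iterate[where F = "\<lambda>x. add_step" and h = "\<lambda>_. 4"])
    show "fp (\<lambda>z. add_step (pair_snd z))"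
      unfolding add_step_def Let_def by (intro fp_intros)
    show "length (add_step a) \<le> length a + 4" for a
      using length_pair_parts[of a] length_pair_parts[of "pair_snd a"]
      by (simp add: add_step_def Let_def length_pair_code)
  qed (intro fp_intros assms poly_bounded_const)+
  then have "fp_nat (\<lambda>x. bits_val (rev (pair_snd (pair_snd
      ((add_step ^^ length (nat_code (M x) @ nat_code (N x)))
      (pair_code (nat_code (M x)) (pair_code (nat_code (N x)) [False])))))))"
    by (intro fp_nat_bits_val fp_rev fp_pair_snd)
  \<comment> \<open>Both words are exhausted after this many rounds, and reversal makes the last
    carry the most significant bit.\<close>
  moreover have "bits_val (rev (pair_snd (pair_snd ((add_step ^^ length (nat_code m @ nat_code n))
      (pair_code (nat_code m) (pair_code (nat_code n) [False])))))) = m + n" for m n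
    using add_steps[of "length (nat_code m @ nat_code n)" "nat_code m" "nat_code n" False "[]"]
    by (auto simp: bits_val_append)
  ultimately show ?thesis by simp
qed

lemma fp_nat_const: "fp_nat (\<lambda>x. n)"
  by (rule fp_const)

lemma fp_nat_if: assumes "fp_pred P" "fp_nat M" "fp_nat N" shows "fp_nat (\<lambda>x. if P x then M x else N x)"
proof -
  have "(\<lambda>x. nat_code (if P x then M x else N x)) = (\<lambda>x. if P x then nat_code (M x) else nat_code (N x))"
    by auto
  then show ?thesis using fp_if[OF assms] by simp
qed

text \<open>Double-and-add from the most significant bit on.\<close>

lemma fp_nat_mult: assumes "fp_nat M" "fp_nat N" shows "fp_nat (\<lambda>x. M x * N x)"
proof -
  define F where "F x b acc = nat_code (bits_val acc + bits_val acc + (if b then N x else 0))"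
    for x b acc
  have "fp (\<lambda>x. foldl (\<lambda>acc b. F x b acc) [] (rev (nat_code (M x))))"
  proof (rule fp_foldl[where h = "\<lambda>x. length (nat_code (N x)) + 2"])
    have "fp_nat (\<lambda>z. N (pair_fst z))"
      by (rule fp_comp[OF assms(2) fp_pair_fst[OF fp_id]])
    then show "fp (\<lambda>z. F (pair_fst z) (top_true (pair_snd z)) (tl (pair_snd z)))"
      unfolding F_def by (intro fp_nat_add fp_nat_bits_val fp_nat_if fp_nat_const fp_intros)
    show "length (F x b acc) \<le> length acc + (length (nat_code (N x)) + 2)" for x b acc
    proof -
      \<comment> \<open>Accumulator and summand are both below \<open>2 ^ k\<close>, so the new
        value is below \<open>4 * 2 ^ k\<close>; this is the 2 in the growth bound.\<close>
      define k where "k = length acc + length (nat_code (N x))"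
      have "bits_val acc < 2 ^ k"
        using bits_val_less[of acc] by (rule less_le_trans) (simp add: k_def)
      moreover have "N x < 2 ^ k"
        using bits_val_less[of "nat_code (N x)"] unfolding bits_val_nat_code
        by (rule less_le_trans) (simp add: k_def)
      ultimately have "bits_val acc + bits_val acc + (if b then N x else 0) < 4 * 2 ^ k"
        by auto
      also have "4 * 2 ^ k = (2::nat) ^ (length acc + (length (nat_code (N x)) + 2))"
        by (simp add: k_def power_add)
      finally show ?thesis
        unfolding F_def by (rule length_nat_code_le)
    qed
    show "poly_bounded (\<lambda>x. length (nat_code (N x)) + 2)"
      by (intro poly_bounded_intros fp_length assms)
  qed (intro fp_intros assms)+
  moreover have "foldr (F x) bs [] = nat_code (bits_val bs * N x)" for x bs
    by (induction bs) (simp_all add: F_def algebra_simps)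
  ultimately show ?thesis by (simp add: foldr_conv_foldl)
qed

text \<open>Going up from the least significant bit, a position with different bits overrules all
  earlier ones. The initial verdict decides about equality.\<close>

definition le_step :: "bool list \<Rightarrow> bool list" where
  "le_step s = (let x = top_true (pair_fst s); y = top_true (pair_fst (pair_snd s)) in
    pair_code (tl (pair_fst s)) (pair_code (tl (pair_fst (pair_snd s)))
      [if x = y then top_true (pair_snd (pair_snd s)) else y]))"

lemma le_steps:
  "length xs \<le> n \<Longrightarrow> length ys \<le> n \<Longrightarrow>
    top_true (pair_snd (pair_snd ((le_step ^^ n) (pair_code xs (pair_code ys [b])))))
      = (if bits_val xs = bits_val ys then b else bits_val xs < bits_val ys)"
proof (induction n arbitrary: xs ys b)
  case (Suc n)
  let ?b = "if top_true xs = top_true ys then b else top_true ys"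
  have "(le_step ^^ Suc n) (pair_code xs (pair_code ys [b])) =
      (le_step ^^ n) (pair_code (tl xs) (pair_code (tl ys) [?b]))"
    by (simp add: funpow_Suc_right le_step_def Let_def del: funpow.simps)
  moreover have "length (tl xs) \<le> n" "length (tl ys) \<le> n" using Suc.prems by auto
  ultimately have "top_true (pair_snd (pair_snd ((le_step ^^ Suc n) (pair_code xs (pair_code ys [b])))))
      = (if bits_val (tl xs) = bits_val (tl ys) then ?b else bits_val (tl xs) < bits_val (tl ys))"
    using Suc.IH[of "tl xs" "tl ys" ?b] by simp
  then show ?case
    using bits_val_split[of xs] bits_val_split[of ys]
    by (cases "top_true xs"; cases "top_true ys") auto
qed simp

lemma fp_pred_le: assumes "fp_nat M" "fp_nat N" shows "fp_pred (\<lambda>x. M x \<le> N x)"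
proof -
  have "fp (\<lambda>x. (le_step ^^ length (nat_code (M x) @ nat_code (N x)))
      (pair_code (nat_code (M x)) (pair_code (nat_code (N x)) [True])))"
  proof (rule fp_iterate[where F = "\<lambda>x. le_step" and h = "\<lambda>_. 3"])
    have e: "le_step = (\<lambda>s. pair_code (tl (pair_fst s)) (pair_code (tl (pair_fst (pair_snd s)))
      (if top_true (pair_fst s) = top_true (pair_fst (pair_snd s))
       then [top_true (pair_snd (pair_snd s))] else [top_true (pair_fst (pair_snd s))])))"
      by (auto simp: le_step_def Let_def)
    show "fp (\<lambda>z. le_step (pair_snd z))"
      unfolding e by (intro fp_intros)
    show "length (le_step a) \<le> length a + 3" for a
      using length_pair_parts[of a] length_pair_parts[of "pair_snd a"]
      by (simp add: le_step_def Let_def length_pair_code)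
  qed (intro fp_intros assms poly_bounded_const)+
  then have "fp_pred (\<lambda>x. top_true (pair_snd (pair_snd
      ((le_step ^^ length (nat_code (M x) @ nat_code (N x)))
      (pair_code (nat_code (M x)) (pair_code (nat_code (N x)) [True]))))))"
    by (intro fp_intros)
  moreover have "top_true (pair_snd (pair_snd ((le_step ^^ length (nat_code m @ nat_code n))
      (pair_code (nat_code m) (pair_code (nat_code n) [True]))))) \<longleftrightarrow> m \<le> n" for m n
    by (subst le_steps) auto
  ultimately show ?thesis by (simp only:)
qed

lemma fp_pred_less: assumes "fp_nat M" "fp_nat N" shows "fp_pred (\<lambda>x. M x < N x)"
  using fp_pred_not[OF fp_pred_le[OF assms(2,1)]] by (simp add: not_le)

lemmas fp_nat_intros = fp_nat_bits_val fp_nat_add fp_nat_mult fp_nat_const fp_nat_if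
  fp_pred_le fp_pred_less

section \<open>Interpretations and formulae\<close>

lemma var_code_append: "var_code v @ xs = pair_code (nat_code v) xs"
  by (simp add: var_code_def pair_code_def)

lemma pair_code_append [simp]: "pair_code x y @ z = pair_code x (y @ z)"
  by (simp add: pair_code_def)

lemma pair_code_not_Nil [simp]: "pair_code x y \<noteq> []"
  by (simp add: pair_code_def delimit_def)

text \<open>
  Any string of bits selects a subset of a list of variables: missing bits count as \<open>False\<close> and
  surplus bits are ignored, so that no certificate is malformed.
\<close>

fun selected :: "nat list \<Rightarrow> bool list \<Rightarrow> nat set" where
  "selected [] u = {}"
| "selected (v # vs) u = (if top_true u then {v} else {}) \<union> selected vs (tl u)"

definition select_step :: "bool list \<Rightarrow> bool list" where
  "select_step s = (if pair_fst s = [] then s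
    else pair_code (pair_snd (pair_fst s)) (pair_code (tl (pair_fst (pair_snd s)))
      (pair_snd (pair_snd s) @
        pair_code (pair_fst (pair_fst s)) [top_true (pair_fst (pair_snd s))])))"

text \<open>For \<open>V\<close> the code of a set of variables, the result is the code of an
  interpretation whatever \<open>u\<close> is, so queries built from it are well formed. The rounds
  suffice because each variable takes up at least one bit of \<open>V\<close>; surplus rounds do
  nothing.\<close>

definition select_code :: "bool list \<Rightarrow> bool list \<Rightarrow> bool list" where
  "select_code V u = pair_snd (pair_snd ((select_step ^^ length V) (pair_code V (pair_code u []))))"

lemma fp_select_code: assumes "fp f" "fp g" shows "fp (\<lambda>x. select_code (f x) (g x))"
proof -
  have "fp (\<lambda>x. (select_step ^^ length (f x)) (pair_code (f x) (pair_code (g x) [])))"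
  proof (rule fp_iterate[where F = "\<lambda>x. select_step" and h = "\<lambda>_. 4"])
    show "fp (\<lambda>z. select_step (pair_snd z))"
      unfolding select_step_def by (intro fp_intros)
    show "length (select_step a) \<le> length a + 4" for a
      using length_pair_parts[of a] length_pair_parts[of "pair_snd a"] length_pair_parts[of "pair_fst a"]
      by (auto simp: select_step_def length_pair_code)
  qed (intro fp_intros assms poly_bounded_const)+
  then show ?thesis
    unfolding select_code_def by (intro fp_pair_snd)
qed

lemma selected_subset: "selected vs u \<subseteq> set vs"
  by (induction vs arbitrary: u) auto

lemma selected_map: "selected vs (map (\<lambda>v. v \<in> I) vs) = set vs \<inter> I"
  by (induction vs) auto

text \<open>By \<open>distinct\<close>, the bit that meets a variable alone decides whether it is
  selected.\<close>

lemma select_steps: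
  assumes "length vs \<le> n" "distinct vs"
  shows "\<exists>u'. (select_step ^^ n) (pair_code (concat (map var_code vs)) (pair_code u acc))
    = pair_code [] (pair_code u' (acc @ concat (map (\<lambda>v. var_code v @ [v \<in> selected vs u]) vs)))"
  using assms
proof (induction n arbitrary: vs u acc)
  case 0
  then show ?case by (intro exI[of _ u]) simp
next
  case (Suc n)
  show ?case
  proof (cases vs)
    case Nil
    have "(select_step ^^ m) (pair_code [] y) = pair_code [] y" for m y
      by (induction m) (simp_all add: select_step_def)
    then show ?thesis using Nil by (intro exI[of _ u]) (simp del: funpow.simps)
  next
    case (Cons w ws)
    have "(select_step ^^ Suc n) (pair_code (concat (map var_code vs)) (pair_code u acc))
      = (select_step ^^ n) (pair_code (concat (map var_code ws))
          (pair_code (tl u) (acc @ var_code w @ [top_true u])))"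
      using Cons by (simp add: funpow_Suc_right select_step_def var_code_append del: funpow.simps)
    moreover obtain u' where
      "(select_step ^^ n) (pair_code (concat (map var_code ws))
          (pair_code (tl u) (acc @ var_code w @ [top_true u])))
      = pair_code [] (pair_code u' ((acc @ var_code w @ [top_true u]) @
          concat (map (\<lambda>v. var_code v @ [v \<in> selected ws (tl u)]) ws)))"
      using Suc.IH[of ws "tl u"] Suc.prems Cons by fastforce
    moreover have "w \<notin> set ws" using Suc.prems Cons by simp
    then have "map (\<lambda>v. var_code v @ [v \<in> selected ws (tl u)]) ws
        = map (\<lambda>v. var_code v @ [v \<in> selected vs u]) ws"
      "w \<in> selected vs u \<longleftrightarrow> top_true u"
      using Cons selected_subset[of ws "tl u"] by auto
    ultimately show ?thesis using Cons by (intro exI[of _ u']) simp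
  qed
qed

lemma length_var_code: "1 \<le> length (var_code v)"
  by (simp add: var_code_def length_delimit)

lemma length_vars_code: "length vs \<le> length (concat (map var_code vs))"
proof (induction vs)
  case (Cons v vs)
  then show ?case using length_var_code[of v] by simp
qed simp

lemma select_code_vars_code:
  "finite X \<Longrightarrow> select_code (vars_code X) u = interp_code X (selected (sorted_list_of_set X) u)"
  using select_steps[OF length_vars_code, of "sorted_list_of_set X" u "[]"]
  by (auto simp: select_code_def vars_code_def interp_code_def)

section \<open>Truth values of variables and formulae\<close>

definition lookup_step :: "bool list \<Rightarrow> bool list \<Rightarrow> bool list" where
  "lookup_step w s = (if pair_fst s = [] then s
    else pair_code (tl (pair_snd (pair_fst s)))
      (if pair_fst (pair_fst s) = w then [top_true (pair_snd (pair_fst s))] else pair_snd s))"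

definition lookup :: "bool list \<Rightarrow> bool list \<Rightarrow> bool" where
  "lookup w ic = top_true (pair_snd ((lookup_step w ^^ length ic) (pair_code ic [])))"

lemma fp_pred_lookup: assumes "fp f" "fp g" shows "fp_pred (\<lambda>x. lookup (f x) (g x))"
proof -
  have "fp (\<lambda>z. (lookup_step (pair_fst z) ^^ length (pair_snd z)) (pair_code (pair_snd z) []))"
  proof (rule fp_iterate[where F = "\<lambda>z. lookup_step (pair_fst z)" and h = "\<lambda>_. 2"
        and f = "\<lambda>z. pair_code (pair_snd z) []" and g = "\<lambda>z. pair_snd z"])
    show "fp (\<lambda>z. lookup_step (pair_fst (pair_fst z)) (pair_snd z))"
      unfolding lookup_step_def by (intro fp_intros)
    show "length (lookup_step (pair_fst z) a) \<le> length a + 2" for z a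
      using length_pair_parts[of a] length_pair_parts[of "pair_fst a"]
      by (auto simp: lookup_step_def length_pair_code)
    show "fp (\<lambda>z. pair_code (pair_snd z) [])" "fp (\<lambda>z. pair_snd z)"
      by (intro fp_intros)+
  qed (rule poly_bounded_const)
  then have "fp_pred (\<lambda>z. lookup (pair_fst z) (pair_snd z))"
    unfolding lookup_def by (intro fp_pred_top_true fp_pair_snd)
  from fp_comp[OF this fp_pair[OF assms]] show ?thesis by simp
qed

text \<open>A later match would overwrite an earlier one, which \<open>distinct\<close>
  excludes.\<close>

lemma lookup_steps:
  assumes "length vs \<le> n" "distinct vs"
  shows "(lookup_step (nat_code w) ^^ n)
      (pair_code (concat (map (\<lambda>v. var_code v @ [v \<in> I]) vs)) res)
    = pair_code [] (if w \<in> set vs then [w \<in> I] else res)"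
  using assms
proof (induction n arbitrary: vs res)
  case 0
  then show ?case by simp
next
  case (Suc n)
  show ?case
  proof (cases vs)
    case Nil
    have "(lookup_step k ^^ m) (pair_code [] y) = pair_code [] y" for k m y
      by (induction m) (simp_all add: lookup_step_def)
    then show ?thesis using Nil by (simp del: funpow.simps)
  next
    case (Cons v ws)
    have "(lookup_step (nat_code w) ^^ Suc n)
        (pair_code (concat (map (\<lambda>v. var_code v @ [v \<in> I]) vs)) res)
      = (lookup_step (nat_code w) ^^ n) (pair_code (concat (map (\<lambda>v. var_code v @ [v \<in> I]) ws))
          (if v = w then [v \<in> I] else res))"
      using Cons by (simp add: funpow_Suc_right lookup_step_def var_code_append del: funpow.simps)
    also have "\<dots> = pair_code [] (if w \<in> set ws then [w \<in> I] else if v = w then [v \<in> I] else res)"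
      using Suc.prems Cons by (intro Suc.IH) auto
    finally show ?thesis using Suc.prems Cons by auto
  qed
qed

lemma lookup_interp_code:
  assumes "finite X" "v \<in> X" shows "lookup (nat_code v) (interp_code X I) \<longleftrightarrow> v \<in> I"
proof -
  have "length vs \<le> length (concat (map (\<lambda>v. var_code v @ [v \<in> I]) vs))" for vs
    by (induction vs) auto
  from lookup_steps[OF this] show ?thesis
    using assms by (simp add: lookup_def interp_code_def)
qed

text \<open>Postfix notation is evaluated with a stack of truth values; tokens have three bits, and
  the right operand lies on top.\<close>

definition eval_step :: "bool list \<Rightarrow> bool list \<Rightarrow> bool list" where
  "eval_step ic s = (let F = pair_fst s; st = pair_snd s; r = tl (tl (tl F)) in
    if F = [] then s
    else if top_true F then pair_code r ((top_true (tl st) \<or> top_true st) # tl (tl st))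
    else if top_true (tl F) then
      (if top_true (tl (tl F)) then pair_code r ((top_true (tl st) \<and> top_true st) # tl (tl st))
       else pair_code r ((\<not> top_true st) # tl st))
    else
      (if top_true (tl (tl F)) then pair_code (pair_snd r) (lookup (pair_fst r) ic # st)
       else pair_code r (False # st)))"

lemma eval_step_token:
  "eval_step ic (pair_code (False # False # False # r) st) = pair_code r (False # st)"
  "eval_step ic (pair_code (False # False # True # r) st)
    = pair_code (pair_snd r) (lookup (pair_fst r) ic # st)"
  "eval_step ic (pair_code (False # True # False # r) (a # st)) = pair_code r ((\<not> a) # st)"
  "eval_step ic (pair_code (False # True # True # r) (b # a # st)) = pair_code r ((a \<and> b) # st)"
  "eval_step ic (pair_code (True # x # y # r) (b # a # st)) = pair_code r ((a \<or> b) # st)"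
  by (simp_all add: eval_step_def)

definition eval_code :: "bool list \<Rightarrow> bool list \<Rightarrow> bool" where
  "eval_code F ic = top_true (pair_snd ((eval_step ic ^^ length F) (pair_code F [])))"

lemma fp_pred_eval_code: assumes "fp f" "fp g" shows "fp_pred (\<lambda>x. eval_code (f x) (g x))"
proof -
  have "fp (\<lambda>z. (eval_step (pair_snd z) ^^ length (pair_fst z)) (pair_code (pair_fst z) []))"
  proof (rule fp_iterate[where F = "\<lambda>z. eval_step (pair_snd z)" and h = "\<lambda>_. 2"
        and f = "\<lambda>z. pair_code (pair_fst z) []" and g = "\<lambda>z. pair_fst z"])
    show "fp (\<lambda>z. eval_step (pair_snd (pair_fst z)) (pair_snd z))"
      unfolding eval_step_def Let_def by (intro fp_pred_lookup fp_intros)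
    show "length (eval_step (pair_snd z) a) \<le> length a + 2" for z a
      using length_pair_parts[of a] length_pair_snd[of "tl (tl (tl (pair_fst a)))"]
      by (auto simp: eval_step_def Let_def length_pair_code)
    show "fp (\<lambda>z. pair_code (pair_fst z) [])" "fp (\<lambda>z. pair_fst z)"
      by (intro fp_intros)+
  qed (rule poly_bounded_const)
  then have "fp_pred (\<lambda>z. eval_code (pair_fst z) (pair_snd z))"
    unfolding eval_code_def by (intro fp_pred_top_true fp_pair_snd)
  from fp_comp[OF this fp_pair[OF assms]] show ?thesis by simp
qed

text \<open>The induction needs a formula followed by more tokens, over any stack. A bound on the
  number of rounds is enough, as the surplus rounds of \<open>eval_code\<close> change
  nothing.\<close>

lemma eval_steps:
  assumes "finite X" "vars F \<subseteq> X"
  shows "\<exists>n\<le>length (form_code F).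
    (eval_step (interp_code X I) ^^ n) (pair_code (form_code F @ rest) st) = pair_code rest (sat I F # st)"
  using assms(2)
proof (induction F arbitrary: rest st)
  case Falsum
  show ?case by (rule exI[of _ 1]) (simp add: eval_step_token)
next
  case (Atom v)
  then show ?case
    using lookup_interp_code[OF assms(1), of v I]
    by (intro exI[of _ 1]) (simp add: eval_step_token var_code_append)
next
  case (Neg F)
  then obtain n where "n \<le> length (form_code F)"
    "(eval_step (interp_code X I) ^^ n) (pair_code (form_code F @ [False, True, False] @ rest) st)
      = pair_code ([False, True, False] @ rest) (sat I F # st)"
    using Neg.IH Neg.prems by (metis vars.simps(3))
  then show ?case by (intro exI[of _ "Suc n"]) (simp add: eval_step_token)
next
  case (Conj F G)
  let ?t = "[False, True, True] @ rest"
  have sub: "vars F \<subseteq> X" "vars G \<subseteq> X" using Conj.prems by auto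
  obtain n where n: "n \<le> length (form_code F)"
    "(eval_step (interp_code X I) ^^ n) (pair_code (form_code F @ form_code G @ ?t) st)
      = pair_code (form_code G @ ?t) (sat I F # st)"
    using Conj.IH(1)[OF sub(1)] by blast
  obtain m where m: "m \<le> length (form_code G)"
    "(eval_step (interp_code X I) ^^ m) (pair_code (form_code G @ ?t) (sat I F # st))
      = pair_code ?t (sat I G # sat I F # st)"
    using Conj.IH(2)[OF sub(2)] by blast
  show ?case using n m by (intro exI[of _ "Suc (m + n)"]) (simp add: funpow_add eval_step_token)
next
  case (Disj F G)
  let ?t = "[True, False, False] @ rest"
  have sub: "vars F \<subseteq> X" "vars G \<subseteq> X" using Disj.prems by auto
  obtain n where n: "n \<le> length (form_code F)"
    "(eval_step (interp_code X I) ^^ n) (pair_code (form_code F @ form_code G @ ?t) st)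
      = pair_code (form_code G @ ?t) (sat I F # st)"
    using Disj.IH(1)[OF sub(1)] by blast
  obtain m where m: "m \<le> length (form_code G)"
    "(eval_step (interp_code X I) ^^ m) (pair_code (form_code G @ ?t) (sat I F # st))
      = pair_code ?t (sat I G # sat I F # st)"
    using Disj.IH(2)[OF sub(2)] by blast
  show ?case using n m by (intro exI[of _ "Suc (m + n)"]) (simp add: funpow_add eval_step_token)
qed

lemma eval_code_correct:
  assumes "finite X" "vars F \<subseteq> X"
  shows "eval_code (form_code F) (interp_code X I) \<longleftrightarrow> sat I F"
proof -
  obtain n where n: "n \<le> length (form_code F)"
    "(eval_step (interp_code X I) ^^ n) (pair_code (form_code F) []) = pair_code [] [sat I F]"
    using eval_steps[OF assms, of I "[]" "[]"] by auto
  have stop: "(eval_step ic ^^ m) (pair_code [] y) = pair_code [] y" for ic m y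
    by (induction m) (simp_all add: eval_step_def)
  have "(eval_step (interp_code X I) ^^ (length (form_code F) - n + n)) (pair_code (form_code F) [])
      = pair_code [] [sat I F]"
    unfolding funpow_add using n(2) stop by simp
  then show ?thesis using n(1) by (simp add: eval_code_def)
qed

section \<open>Realisable weights\<close>

text \<open>
  Helly's theorem on the line: rays are given by an end point and a flag for its exclusion.
\<close>

lemma separating_rational:
  fixes L R :: "(rat \<times> bool) set"
  assumes fin: "finite L" "finite R"
    and pos: "\<And>q s. (q, s) \<in> R \<Longrightarrow> 0 < q"
    and LR: "\<And>q s q' s'. (q, s) \<in> L \<Longrightarrow> (q', s') \<in> R \<Longrightarrow> q \<le> q' \<and> (s \<or> s' \<longrightarrow> q < q')"
  shows "\<exists>r>0. (\<forall>(q, s) \<in> L. q \<le> r \<and> (s \<longrightarrow> q < r)) \<and> (\<forall>(q, s) \<in> R. r \<le> q \<and> (s \<longrightarrow> r < q))"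
proof -
  \<comment> \<open>Positivity of \<open>r\<close> is one more lower ray, open at 0.\<close>
  define L0 where "L0 = insert (0, True) L"
  have LR0: "q \<le> q' \<and> (s \<or> s' \<longrightarrow> q < q')" if "(q, s) \<in> L0" "(q', s') \<in> R" for q s q' s'
    using that LR pos unfolding L0_def by fastforce
  define lo where "lo = Max (fst ` L0)"
  have fin0: "finite (fst ` L0)" "fst ` L0 \<noteq> {}" using fin by (auto simp: L0_def)
  have le_lo: "q \<le> lo" if "(q, s) \<in> L0" for q s
    unfolding lo_def using fin0 that by (intro Max_ge) force+
  obtain sl where lo: "(lo, sl) \<in> L0"
    using Max_in[OF fin0] unfolding lo_def by fastforce
  have "\<exists>r. (\<forall>(q, s) \<in> L0. q \<le> r \<and> (s \<longrightarrow> q < r)) \<and> (\<forall>(q, s) \<in> R. r \<le> q \<and> (s \<longrightarrow> r < q))"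
  proof (cases "R = {}")
    case True
    then show ?thesis using le_lo by (intro exI[of _ "lo + 1"]) force
  next
    case False
    define hi where "hi = Min (fst ` R)"
    have hi_le: "hi \<le> q" if "(q, s) \<in> R" for q s
      unfolding hi_def using fin that by (intro Min_le) force+
    have "Min (fst ` R) \<in> fst ` R" using fin False by (intro Min_in) auto
    then obtain sh where hi: "(hi, sh) \<in> R" unfolding hi_def by fastforce
    show ?thesis
    proof (cases "lo < hi")
      case True
      have "q < (lo + hi) / 2" if "(q, s) \<in> L0" for q s
        using le_lo[OF that] True by simp
      moreover have "(lo + hi) / 2 < q" if "(q, s) \<in> R" for q s
        using hi_le[OF that] True by simp
      ultimately show ?thesis by (intro exI[of _ "(lo + hi) / 2"]) force
    next
      case False
      \<comment> \<open>If the extreme end points coincide, no ray excludes this point: each is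
        compared with the extreme ray of the other side.\<close>
      then have "lo = hi" using LR0[OF lo hi] by simp
      then show ?thesis
        using le_lo hi_le LR0[OF _ hi] LR0[OF lo] by (intro exI[of _ lo]) fastforce
    qed
  qed
  then obtain r where r: "\<forall>(q, s) \<in> L0. q \<le> r \<and> (s \<longrightarrow> q < r)"
    "\<forall>(q, s) \<in> R. r \<le> q \<and> (s \<longrightarrow> r < q)" by blast
  show ?thesis
    using r by (intro exI[of _ r]) (auto simp: L0_def)
qed

text \<open>
  For \<open>p, s, \<sigma>\<close> taken from a pair of points and \<open>p', s', \<sigma>'\<close> from another, this says that no positive
  weights satisfy both \<open>w2 * s \<le> w1 * p\<close> and \<open>w1 * s' \<le> w2 * p'\<close>, where \<open>\<sigma>\<close> and \<open>\<sigma>'\<close> make the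
  respective inequality strict.
\<close>

definition infeasible :: "nat \<Rightarrow> nat \<Rightarrow> bool \<Rightarrow> nat \<Rightarrow> nat \<Rightarrow> bool \<Rightarrow> bool" where
  "infeasible p s \<sigma> p' s' \<sigma>' \<longleftrightarrow> p = 0 \<and> (0 < s \<or> \<sigma>) \<or> p' = 0 \<and> (0 < s' \<or> \<sigma>') \<or>
     p * p' < s * s' \<or> p * p' \<le> s * s' \<and> (\<sigma> \<or> \<sigma>') \<and> 0 < s \<and> 0 < s'"

text \<open>In the product of the two inequalities the weights cancel, which leaves
  \<open>s * s' \<le> p * p'\<close>. Strictness of one inequality survives if the left side of the
  other is positive.\<close>

lemma infeasible_sound:
  fixes w1 w2 :: nat
  assumes w: "0 < w1" "0 < w2" and le: "w2 * s \<le> w1 * p" "w1 * s' \<le> w2 * p'"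
    and less: "\<sigma> \<Longrightarrow> w2 * s < w1 * p" "\<sigma>' \<Longrightarrow> w1 * s' < w2 * p'"
  shows "\<not> infeasible p s \<sigma> p' s' \<sigma>'"
proof
  have prod: "w1 * w2 * (s * s') \<le> w1 * w2 * (p * p')"
    using mult_mono[OF le] by (simp add: ac_simps)
  then have ge: "s * s' \<le> p * p'" using w by simp
  assume "infeasible p s \<sigma> p' s' \<sigma>'"
  then consider "p = 0" "0 < s \<or> \<sigma>" | "p' = 0" "0 < s' \<or> \<sigma>'" | "p * p' < s * s'"
    | "p * p' \<le> s * s'" "\<sigma>" "0 < s'" | "p * p' \<le> s * s'" "\<sigma>'" "0 < s"
    unfolding infeasible_def by blast
  then show False
  proof cases
    case 1
    then show False using le(1) less(1) w by auto
  next
    case 2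
    then show False using le(2) less(2) w by auto
  next
    case 3
    then show False using ge by simp
  next
    case 4
    then have "w2 * s * (w1 * s') < w1 * p * (w1 * s')" using less(1) w by simp
    also have "\<dots> \<le> w1 * p * (w2 * p')" using le(2) by simp
    finally have "w1 * w2 * (s * s') < w1 * w2 * (p * p')" by (simp add: ac_simps)
    then show False using 4(1) w by simp
  next
    case 5
    then have "w2 * s * (w1 * s') < w2 * s * (w2 * p')" using less(2) w by simp
    also have "\<dots> \<le> w1 * p * (w2 * p')" using le(1) by simp
    finally have "w1 * w2 * (s * s') < w1 * w2 * (p * p')" by (simp add: ac_simps)
    then show False using 5(1) w by simp
  qed
qed

text \<open>Merging stripped of logic: \<open>a\<close> and \<open>b\<close> stand for the distances
  to the two formulae.\<close>

definition weight_set :: "'a set \<Rightarrow> ('a \<Rightarrow> nat) \<Rightarrow> ('a \<Rightarrow> nat) \<Rightarrow> nat \<Rightarrow> nat \<Rightarrow> 'a set" where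
  "weight_set U a b w1 w2 = {i \<in> U. \<forall>j\<in>U. w1 * a i + w2 * b i \<le> w1 * a j + w2 * b j}"

text \<open>Stated for a growth of at most \<open>p\<close> and a drop of at least \<open>s\<close>,
  because distance queries establish such bounds and not the exact differences.\<close>

lemma weight_set_infeasible:
  assumes w: "0 < w1" "0 < w2" and M: "M = weight_set U a b w1 w2"
    and I: "I \<in> M" "J \<in> U" "a J \<le> a I + p" "b J + s \<le> b I"
    and I': "I' \<in> M" "J' \<in> U" "b J' \<le> b I' + p'" "a J' + s' \<le> a I'"
  shows "\<not> infeasible p s (J \<notin> M) p' s' (J' \<notin> M)"
proof -
  have le: "w1 * a i + w2 * b i \<le> w1 * a j + w2 * b j" if "i \<in> M" "j \<in> U" for i j
    using that unfolding M weight_set_def by blast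
  have less: "w1 * a i + w2 * b i < w1 * a j + w2 * b j" if "i \<in> M" "j \<in> U" "j \<notin> M" for i j
    using that le unfolding M weight_set_def by (force simp: not_le)
  have I1: "w1 * a J \<le> w1 * a I + w1 * p" "w2 * b J + w2 * s \<le> w2 * b I"
    using mult_le_mono2[OF I(3), of w1] mult_le_mono2[OF I(4), of w2] by (simp_all add: algebra_simps)
  have I2: "w2 * b J' \<le> w2 * b I' + w2 * p'" "w1 * a J' + w1 * s' \<le> w1 * a I'"
    using mult_le_mono2[OF I'(3), of w2] mult_le_mono2[OF I'(4), of w1] by (simp_all add: algebra_simps)
  show ?thesis
  proof (rule infeasible_sound[OF w])
    show "w2 * s \<le> w1 * p" using le[OF I(1,2)] I1 by linarith
    show "w1 * s' \<le> w2 * p'" using le[OF I'(1,2)] I2 by linarith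
    show "w2 * s < w1 * p" if "J \<notin> M" using less[OF I(1,2) that] I1 by linarith
    show "w1 * s' < w2 * p'" if "J' \<notin> M" using less[OF I'(1,2) that] I2 by linarith
  qed
qed

text \<open>For r = w1/w2, a pair for which \<open>b\<close> drops and \<open>a\<close> grows is a
  lower ray, a pair of the opposite kind an upper ray, and \<open>feas\<close> says that these rays
  meet pairwise. If neither cost grows, the pair taken in both roles forces equal costs; if neither
  drops and one grows, any positive weights will do.\<close>

lemma weight_set_exists:
  assumes fin: "finite U" and M: "M \<subseteq> U" "M \<noteq> {}"
    and feas: "\<And>I J I' J'. I \<in> M \<Longrightarrow> J \<in> U \<Longrightarrow> I' \<in> M \<Longrightarrow> J' \<in> U \<Longrightarrow> b J \<le> b I \<Longrightarrow> a J' \<le> a I' \<Longrightarrow>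
      \<not> infeasible (a J - a I) (b I - b J) (J \<notin> M) (b J' - b I') (a I' - a J') (J' \<notin> M)"
  shows "\<exists>w1 w2. 0 < w1 \<and> 0 < w2 \<and> M = weight_set U a b w1 w2"
proof -
  define fr :: "nat \<Rightarrow> nat \<Rightarrow> rat" where "fr m n = of_nat m / of_nat n" for m n
  define L where "L = (\<lambda>(I, J). (fr (b I - b J) (a J - a I), J \<notin> M)) `
    {(I, J). I \<in> M \<and> J \<in> U \<and> b J < b I \<and> a I < a J}"
  define R where "R = (\<lambda>(I, J). (fr (b J - b I) (a I - a J), J \<notin> M)) `
    {(I, J). I \<in> M \<and> J \<in> U \<and> b I < b J \<and> a J < a I}"
  have "finite (M \<times> U)" using fin M finite_subset by blast
  then have "finite {(I, J). I \<in> M \<and> J \<in> U \<and> b J < b I \<and> a I < a J}"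
    "finite {(I, J). I \<in> M \<and> J \<in> U \<and> b I < b J \<and> a J < a I}"
    by (auto elim!: finite_subset[rotated])
  then have finLR: "finite L" "finite R" unfolding L_def R_def by auto
  have posR: "0 < q" if "(q, s) \<in> R" for q s using that unfolding R_def by (auto simp: fr_def)
  have LR: "q \<le> q' \<and> (s \<or> s' \<longrightarrow> q < q')" if q: "(q, s) \<in> L" "(q', s') \<in> R" for q s q' s'
  proof -
    obtain I J where IJ: "I \<in> M" "J \<in> U" "b J < b I" "a I < a J" "s = (J \<notin> M)"
      "q = fr (b I - b J) (a J - a I)" using q(1) unfolding L_def by auto
    obtain I' J' where IJ': "I' \<in> M" "J' \<in> U" "b I' < b J'" "a J' < a I'" "s' = (J' \<notin> M)"
      "q' = fr (b J' - b I') (a I' - a J')" using q(2) unfolding R_def by auto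
    define p v p' v' where d: "p = a J - a I" "v = b I - b J" "p' = b J' - b I'" "v' = a I' - a J'"
    have pos: "0 < p" "0 < v" "0 < p'" "0 < v'" using IJ IJ' d by auto
    have "\<not> infeasible p v s p' v' s'"
      unfolding d IJ(5) IJ'(5) using IJ IJ' by (intro feas) auto
    then have nat: "v * v' \<le> p' * p" "s \<or> s' \<Longrightarrow> v * v' < p' * p"
      using pos unfolding infeasible_def by (auto simp: ac_simps not_less not_le)
    have "of_nat (v * v') \<le> (of_nat (p' * p) :: rat)" using nat(1) by (simp only: of_nat_le_iff)
    moreover have "of_nat (v * v') < (of_nat (p' * p) :: rat)" if "s \<or> s'"
      using nat(2)[OF that] by (simp only: of_nat_less_iff)
    ultimately show ?thesis
      unfolding IJ(6) IJ'(6) d[symmetric] fr_def using pos by (simp add: field_simps)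
  qed
  have "\<exists>r>0. (\<forall>(q, s) \<in> L. q \<le> r \<and> (s \<longrightarrow> q < r)) \<and> (\<forall>(q, s) \<in> R. r \<le> q \<and> (s \<longrightarrow> r < q))"
    by (rule separating_rational[OF finLR]) (fact posR, fact LR)
  then obtain r where r: "0 < r" "\<forall>(q, s) \<in> L. q \<le> r \<and> (s \<longrightarrow> q < r)"
    "\<forall>(q, s) \<in> R. r \<le> q \<and> (s \<longrightarrow> r < q)" by blast
  obtain x y where xy: "r = Fract x y" "0 < y" "coprime x y" by (cases r) auto
  have "0 < x" using r(1) xy by (simp add: zero_less_Fract_iff)
  define w1 w2 where w: "w1 = nat x" "w2 = nat y"
  have pos: "0 < w1" "0 < w2" using \<open>0 < x\<close> xy w by auto
  have r_eq: "r = of_nat w1 / of_nat w2"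
    using xy \<open>0 < x\<close> w by (simp add: Fract_of_int_quotient)
  have key: "w1 * a I + w2 * b I \<le> w1 * a J + w2 * b J \<and>
      (J \<notin> M \<longrightarrow> w1 * a I + w2 * b I < w1 * a J + w2 * b J)" if IJ: "I \<in> M" "J \<in> U" for I J
  proof -
    consider "a I < a J" "b J < b I" | "a J < a I" "b I < b J" | "a J \<le> a I" "b J \<le> b I"
      | "a I \<le> a J" "b I \<le> b J" "a I \<noteq> a J \<or> b I \<noteq> b J"
      by linarith
    then show ?thesis
    proof cases
      case 1
      define p v where d: "p = a J - a I" "v = b I - b J"
      have "(fr v p, J \<notin> M) \<in> L"
        unfolding L_def d using IJ 1 by auto
      from bspec[OF r(2) this] have "(of_nat (v * w2) :: rat) \<le> of_nat (w1 * p)"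
        "J \<notin> M \<Longrightarrow> (of_nat (v * w2) :: rat) < of_nat (w1 * p)"
        using 1 pos d unfolding r_eq fr_def by (auto simp: field_simps)
      then have "v * w2 \<le> w1 * p" "J \<notin> M \<Longrightarrow> v * w2 < w1 * p"
        unfolding of_nat_le_iff of_nat_less_iff by blast+
      moreover have "a J = a I + p" "b I = b J + v" using 1 d by auto
      ultimately show ?thesis by (auto simp: algebra_simps)
    next
      case 2
      define p v where d: "p = b J - b I" "v = a I - a J"
      have "(fr p v, J \<notin> M) \<in> R"
        unfolding R_def d using IJ 2 by auto
      from bspec[OF r(3) this] have "(of_nat (w1 * v) :: rat) \<le> of_nat (p * w2)"
        "J \<notin> M \<Longrightarrow> (of_nat (w1 * v) :: rat) < of_nat (p * w2)"
        using 2 pos d unfolding r_eq fr_def by (auto simp: field_simps)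
      then have "w1 * v \<le> p * w2" "J \<notin> M \<Longrightarrow> w1 * v < p * w2"
        unfolding of_nat_le_iff of_nat_less_iff by blast+
      moreover have "b J = b I + p" "a I = a J + v" using 2 d by auto
      ultimately show ?thesis by (auto simp: algebra_simps)
    next
      case 3
      \<comment> \<open>Both growths are truncated to 0, so any drop, or \<open>J\<close> outside
        \<open>M\<close>, would be infeasible.\<close>
      from feas[OF IJ IJ 3(2,1)] have "a J = a I" "b J = b I" "J \<in> M"
        using 3 unfolding infeasible_def by auto
      then show ?thesis by simp
    next
      case 4
      then have "w1 * a I \<le> w1 * a J" "w2 * b I \<le> w2 * b J"
        "w1 * a I < w1 * a J \<or> w2 * b I < w2 * b J" using pos by auto
      then show ?thesis by linarith
    qed
  qed
  have "M = weight_set U a b w1 w2"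
  proof
    show "M \<subseteq> weight_set U a b w1 w2" using key M unfolding weight_set_def by blast
    show "weight_set U a b w1 w2 \<subseteq> M"
    proof
      fix i assume i: "i \<in> weight_set U a b w1 w2"
      \<comment> \<open>An element of \<open>U\<close> outside \<open>M\<close> is strictly worse
        than \<open>m\<close> and hence not minimal.\<close>
      obtain m where "m \<in> M" using M by blast
      then show "i \<in> M" using key[of m i] i M unfolding weight_set_def by force
    qed
  qed
  then show ?thesis using pos by blast
qed

section \<open>Non-obtainability\<close>

lemma Sigma_p_conj:
  "{x. P x} \<in> Sigma_p i \<Longrightarrow> {x. Q x} \<in> Sigma_p i \<Longrightarrow> {x. P x \<and> Q x} \<in> Sigma_p i"
  using Sigma_p_Int[of "{x. P x}" i "{x. Q x}"] by (simp add: Collect_conj_eq)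

lemma Sigma_p_disj:
  "{x. P x} \<in> Sigma_p i \<Longrightarrow> {x. Q x} \<in> Sigma_p i \<Longrightarrow> {x. P x \<or> Q x} \<in> Sigma_p i"
  using Sigma_p_Un[of "{x. P x}" i "{x. Q x}"] by (simp add: Collect_disj_eq)

lemma Sigma_p_pred: "fp_pred Q \<Longrightarrow> {x. Q x} \<in> Sigma_p i"
  by (intro P_subset_Sigma_p fp_pred_P)

lemma Sigma_p_not_vimage: "- A \<in> Sigma_p i \<Longrightarrow> fp f \<Longrightarrow> {x. f x \<notin> A} \<in> Sigma_p i"
  using Sigma_p_vimage[of "- A" i f] by simp

section \<open>Certificates of non-obtainability and their verification\<close>

lemma tuple_code_Nil: "tuple_code [] = []"
  by (simp add: tuple_code_def)

lemma tuple_code_Cons: "tuple_code (x # xs) = pair_code x (tuple_code xs)"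
  by (simp add: tuple_code_def pair_code_def)

primrec component :: "nat \<Rightarrow> bool list \<Rightarrow> bool list" where
  "component 0 x = pair_fst x"
| "component (Suc n) x = component n (pair_snd x)"

lemma component_tuple_code [simp]: "n < length xs \<Longrightarrow> component n (tuple_code xs) = xs ! n"
  by (induction n arbitrary: xs; case_tac xs) (auto simp: tuple_code_Cons)

declare component.simps [simp del]

lemma fp_component: "fp f \<Longrightarrow> fp (\<lambda>x. component n (f x))"
  by (induction n arbitrary: f) (auto simp: component.simps intro: fp_pair_fst fp_pair_snd)

text \<open>
  A lower bound on a distance is certified by a negative query, hence the encoding of \<open>n + 1\<close> by a
  string for \<open>n\<close> with a bit in front.
\<close>

definition lower :: "bool list \<Rightarrow> nat" where
  "lower w = (if w = [] then 0 else bits_val (tl w) + 1)"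

definition lower_code :: "nat \<Rightarrow> bool list" where
  "lower_code n = (if n = 0 then [] else True # nat_code (n - 1))"

lemma lower_lower_code [simp]: "lower (lower_code n) = n"
  by (simp add: lower_def lower_code_def)

lemma length_lower_code: "length (lower_code n) \<le> Suc (length (nat_code n))"
  using length_nat_code_mono[of "n - 1" n] by (simp add: lower_code_def)

text \<open>
  With \<open>D\<close> deciding the distance problem, this certifies \<open>p\<close> and \<open>s\<close> for interpretations \<open>I\<close>, a model
  of \<open>R\<close>, and \<open>J\<close>: the distance to \<open>K\<close> grows by at most \<open>p\<close> from \<open>I\<close> to \<open>J\<close> and the distance to
  \<open>K'\<close> drops by at least \<open>s\<close>.
\<close>

definition certified :: "language \<Rightarrow> bool list \<Rightarrow> bool list \<Rightarrow> bool list \<Rightarrow> bool list \<Rightarrow>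
    bool list \<Rightarrow> bool list \<Rightarrow> bool list \<Rightarrow> bool list \<Rightarrow> bool list \<Rightarrow> bool list \<Rightarrow> bool list \<Rightarrow> bool" where
  "certified D V K K' R I J a p b c s \<longleftrightarrow>
     eval_code R (select_code V I) \<and> bits_val c + bits_val s \<le> lower b \<and>
     (a = [] \<or> tuple_code [select_code V I, K, nat_code (bits_val (tl a))] \<notin> D) \<and>
     (b = [] \<or> tuple_code [select_code V I, K', nat_code (bits_val (tl b))] \<notin> D) \<and>
     tuple_code [select_code V J, K, nat_code (lower a + bits_val p)] \<in> D \<and>
     tuple_code [select_code V J, K', nat_code (bits_val c)] \<in> D"

text \<open>The first pair limits the ratio of the weights from below. In the second the formulae
  are exchanged, so it limits the ratio from above. Each takes seven components; the strictness
  flags are not certified but found by evaluating \<open>R\<close>.\<close>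

definition refutation :: "language \<Rightarrow> bool list \<Rightarrow> bool list \<Rightarrow> bool" where
  "refutation D x u \<longleftrightarrow>
     certified D (component 0 x) (component 1 x) (component 2 x) (component 3 x)
       (component 0 u) (component 1 u) (component 2 u) (component 3 u) (component 4 u)
       (component 5 u) (component 6 u) \<and>
     certified D (component 0 x) (component 2 x) (component 1 x) (component 3 x)
       (component 7 u) (component 8 u) (component 9 u) (component 10 u) (component 11 u)
       (component 12 u) (component 13 u) \<and>
     infeasible (bits_val (component 3 u)) (bits_val (component 6 u))
       (\<not> eval_code (component 3 x) (select_code (component 0 x) (component 1 u)))
       (bits_val (component 10 u)) (bits_val (component 13 u))
       (\<not> eval_code (component 3 x) (select_code (component 0 x) (component 8 u)))"

lemma fp_nat_lower: assumes "fp f" shows "fp_nat (\<lambda>x. lower (f x))"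
  unfolding lower_def by (intro fp_nat_intros fp_intros assms)

lemma fp_pred_zero: assumes "fp_nat N" shows "fp_pred (\<lambda>x. N x = 0)"
  using fp_pred_le[OF assms fp_nat_const[of 0]] by simp

text \<open>Upper bounds on distances are queries to \<open>D\<close>, lower bounds are queries to
  its complement, so both must lie in the class.\<close>

lemma Sigma_p_certified:
  assumes D: "D \<in> Sigma_p i" "- D \<in> Sigma_p i"
    and f: "fp V" "fp K" "fp K'" "fp R" "fp I" "fp J" "fp a" "fp p" "fp b" "fp c" "fp s"
  shows "{x. certified D (V x) (K x) (K' x) (R x) (I x) (J x) (a x) (p x) (b x) (c x) (s x)} \<in> Sigma_p i"
  unfolding certified_def tuple_code_Cons tuple_code_Nil
  by (intro Sigma_p_conj Sigma_p_disj Sigma_p_vimage[OF D(1)] Sigma_p_not_vimage[OF D(2)] Sigma_p_pred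
      fp_pred_eval_code fp_select_code fp_nat_lower fp_nat_intros fp_intros f)

lemma Sigma_p_refutation:
  assumes "D \<in> Sigma_p i" "- D \<in> Sigma_p i"
  shows "{z. refutation D (pair_fst z) (pair_snd z)} \<in> Sigma_p i"
  unfolding refutation_def infeasible_def
  by (intro Sigma_p_conj[OF Sigma_p_certified[OF assms] Sigma_p_conj[OF Sigma_p_certified[OF assms]]]
      Sigma_p_pred fp_pred_zero fp_pred_eval_code fp_select_code fp_component fp_nat_intros fp_intros)

text \<open>Whatever words the certificate consists of, all queries are codes of instances of the
  distance problem, where \<open>D\<close> is known: interpretations are selected subsets of
  \<open>X\<close>, and numbers are normalised.\<close>

lemma certified_correct:
  assumes X: "finite X" "consistent_over X K" "consistent_over X K'" "vars R \<subseteq> X"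
    and D: "\<And>I K x. I \<subseteq> X \<Longrightarrow> consistent_over X K \<Longrightarrow>
      dist_code X I K x \<in> D \<longleftrightarrow> form_dist d X I K \<le> x"
  defines "S \<equiv> selected (sorted_list_of_set X)"
  shows "certified D (vars_code X) (form_code K) (form_code K') (form_code R) I J a p b c s \<longleftrightarrow>
    sat (S I) R \<and> bits_val c + bits_val s \<le> lower b \<and>
    lower a \<le> form_dist d X (S I) K \<and> lower b \<le> form_dist d X (S I) K' \<and>
    form_dist d X (S J) K \<le> lower a + bits_val p \<and> form_dist d X (S J) K' \<le> bits_val c"
proof -
  have S: "S u \<subseteq> X" for u
    using selected_subset[of "sorted_list_of_set X" u] X(1) by (simp add: S_def)
  have code: "tuple_code [select_code (vars_code X) u, form_code F, nat_code n] = dist_code X (S u) F n"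
    for u F n
    using X(1) by (simp add: select_code_vars_code dist_code_def S_def)
  have low: "w = [] \<or> \<not> form_dist d X (S I) F \<le> bits_val (tl w) \<longleftrightarrow> lower w \<le> form_dist d X (S I) F"
    for w F by (auto simp: lower_def)
  show ?thesis
    unfolding certified_def code D[OF S X(2)] D[OF S X(3)] low
    using X eval_code_correct[OF X(1,4)] by (simp add: select_code_vars_code S_def)
qed

lemma length_vars_code_obtain: "length (vars_code X) \<le> length (obtain_code X K1 K2 R)"
  by (simp add: obtain_code_def tuple_code_Cons length_pair_code)

text \<open>A variable contributes one bit more than in \<open>vars_code\<close>, where it already
  has at least one.\<close>

lemma length_interp_code: "length (interp_code X I) \<le> 2 * length (vars_code X)"
proof -
  have "length (concat (map (\<lambda>v. var_code v @ [v \<in> I]) vs)) \<le> 2 * length (concat (map var_code vs))" for vs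
  proof (induction vs)
    case (Cons v vs)
    then show ?case using length_var_code[of v] by simp
  qed simp
  then show ?thesis by (simp add: interp_code_def vars_code_def)
qed

text \<open>A certificate excludes weights by \<open>weight_set_infeasible\<close>. If there are no
  weights, \<open>weight_set_exists\<close> supplies the two pairs, certified with their true
  distances.\<close>

lemma refutation_iff:
  fixes d :: distance
  assumes X: "finite X" "consistent_over X K1" "consistent_over X K2" "consistent_over X R"
    and D: "\<And>I K x. I \<subseteq> X \<Longrightarrow> consistent_over X K \<Longrightarrow>
      dist_code X I K x \<in> D \<longleftrightarrow> form_dist d X I K \<le> x"
    and bound: "\<And>I K. I \<subseteq> X \<Longrightarrow> consistent_over X K \<Longrightarrow> length (nat_code (form_dist d X I K)) \<le> B"
    and B: "length (vars_code X) \<le> B" and n: "28 * B + 42 \<le> n"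
  shows "(\<exists>u. length u \<le> n \<and> refutation D (obtain_code X K1 K2 R) u) \<longleftrightarrow> \<not> obtainable d X K1 K2 R"
proof -
  define a b where ab: "a I = form_dist d X I K1" "b I = form_dist d X I K2" for I
  define vs where "vs = sorted_list_of_set X"
  have vs: "set vs = X" using X(1) by (simp add: vs_def)
  have M: "models X R \<subseteq> Pow X" "models X R \<noteq> {}" "vars R \<subseteq> X"
    using X(4) by (auto simp: models_def consistent_over_def)
  have obt: "obtainable d X K1 K2 R \<longleftrightarrow>
      (\<exists>w1 w2. 0 < w1 \<and> 0 < w2 \<and> models X R = weight_set (Pow X) a b w1 w2)"
  proof -
    have "merge_models d X w1 w2 K1 K2 = weight_set (Pow X) a b w1 w2" for w1 w2
      unfolding merge_models_def weighted_dist_def weight_set_def ab by (simp add: Ball_def)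
    then show ?thesis unfolding obtainable_def by simp
  qed
  have sel: "selected vs u \<subseteq> X" for u using selected_subset[of vs u] vs by simp
  have ev: "eval_code (form_code R) (select_code (vars_code X) u) \<longleftrightarrow> selected vs u \<in> models X R" for u
    using sel[of u] eval_code_correct[OF X(1) M(3)]
    by (simp add: select_code_vars_code[OF X(1)] models_def vs_def)
  have in_models: "sat (selected vs u) R \<longleftrightarrow> selected vs u \<in> models X R" for u
    using sel[of u] by (simp add: models_def)
  have cert: "certified D (vars_code X) (form_code K) (form_code K') (form_code R) I J l p m c s \<longleftrightarrow>
    sat (selected vs I) R \<and> bits_val c + bits_val s \<le> lower m \<and>
    lower l \<le> form_dist d X (selected vs I) K \<and> lower m \<le> form_dist d X (selected vs I) K' \<and>
    form_dist d X (selected vs J) K \<le> lower l + bits_val p \<and>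
    form_dist d X (selected vs J) K' \<le> bits_val c"
    if "consistent_over X K" "consistent_over X K'" for K K' I J l p m c s
    unfolding vs_def by (rule certified_correct[OF X(1) that M(3)]) (fact D)
  have comps: "component 0 (obtain_code X K1 K2 R) = vars_code X"
    "component 1 (obtain_code X K1 K2 R) = form_code K1"
    "component 2 (obtain_code X K1 K2 R) = form_code K2"
    "component 3 (obtain_code X K1 K2 R) = form_code R"
    unfolding obtain_code_def by simp_all
  show ?thesis
  proof
    assume "\<exists>u. length u \<le> n \<and> refutation D (obtain_code X K1 K2 R) u"
    then obtain u where u: "refutation D (obtain_code X K1 K2 R) u" by blast
    let ?S = "\<lambda>k. selected vs (component k u)" and ?v = "\<lambda>k. bits_val (component k u)"
    have 1: "?S 0 \<in> models X R" "a (?S 1) \<le> a (?S 0) + ?v 3" "b (?S 1) + ?v 6 \<le> b (?S 0)"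
      and 2: "?S 7 \<in> models X R" "b (?S 8) \<le> b (?S 7) + ?v 10" "a (?S 8) + ?v 13 \<le> a (?S 7)"
      and inf: "infeasible (?v 3) (?v 6) (?S 1 \<notin> models X R) (?v 10) (?v 13) (?S 8 \<notin> models X R)"
    proof -
      note U = u[unfolded refutation_def comps cert[OF X(2,3)] cert[OF X(3,2)] ev in_models]
      show "?S 0 \<in> models X R" using U by (elim conjE)
      show "?S 7 \<in> models X R" using U by (elim conjE)
      show "a (?S 1) \<le> a (?S 0) + ?v 3" using U unfolding ab by (elim conjE) linarith
      show "b (?S 1) + ?v 6 \<le> b (?S 0)" using U unfolding ab by (elim conjE) linarith
      show "b (?S 8) \<le> b (?S 7) + ?v 10" using U unfolding ab by (elim conjE) linarith
      show "a (?S 8) + ?v 13 \<le> a (?S 7)" using U unfolding ab by (elim conjE) linarith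
      show "infeasible (?v 3) (?v 6) (?S 1 \<notin> models X R) (?v 10) (?v 13) (?S 8 \<notin> models X R)"
        using U by (elim conjE)
    qed
    show "\<not> obtainable d X K1 K2 R"
    proof
      assume "obtainable d X K1 K2 R"
      then obtain w1 w2 where "0 < w1" "0 < w2" "models X R = weight_set (Pow X) a b w1 w2"
        unfolding obt by blast
      from weight_set_infeasible[OF this 1(1) _ 1(2,3) 2(1) _ 2(2,3)] show False
        using inf sel by simp
    qed
  next
    assume "\<not> obtainable d X K1 K2 R"
    then obtain I J I' J' where IJ: "I \<in> models X R" "J \<in> Pow X" "I' \<in> models X R" "J' \<in> Pow X"
      "b J \<le> b I" "a J' \<le> a I'" and
      inf: "infeasible (a J - a I) (b I - b J) (J \<notin> models X R)
        (b J' - b I') (a I' - a J') (J' \<notin> models X R)"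
    proof -
      have "\<exists>I\<in>models X R. \<exists>J\<in>Pow X. \<exists>I'\<in>models X R. \<exists>J'\<in>Pow X. b J \<le> b I \<and> a J' \<le> a I' \<and>
        infeasible (a J - a I) (b I - b J) (J \<notin> models X R)
          (b J' - b I') (a I' - a J') (J' \<notin> models X R)"
      proof (rule ccontr)
        assume none: "\<not> ?thesis"
        have "\<exists>w1 w2. 0 < w1 \<and> 0 < w2 \<and> models X R = weight_set (Pow X) a b w1 w2"
          by (rule weight_set_exists) (use X(1) M(1,2) none in blast)+
        then show False using \<open>\<not> obtainable d X K1 K2 R\<close> unfolding obt by blast
      qed
      then show thesis using that by blast
    qed
    have sub: "I \<subseteq> X" "J \<subseteq> X" "I' \<subseteq> X" "J' \<subseteq> X" using IJ M by auto
    define bits where "bits I = map (\<lambda>v. v \<in> I) vs" for I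
    have sel_bits: "selected vs (bits I) = I" if "I \<subseteq> X" for I
      using that selected_map[of vs I] vs by (auto simp: bits_def)
    \<comment> \<open>Truncated subtraction is exact for the drops, by \<open>b J \<le> b I\<close>
      and \<open>a J' \<le> a I'\<close>, and still an upper bound for the growths.\<close>
    define us where "us = [bits I, bits J, lower_code (a I), nat_code (a J - a I), lower_code (b I),
      nat_code (b J), nat_code (b I - b J), bits I', bits J', lower_code (b I'),
      nat_code (b J' - b I'), lower_code (a I'), nat_code (a J'), nat_code (a I' - a J')]"
    have us: "length us = 14" by (simp add: us_def)
    have len_a: "length (nat_code m) \<le> B" if "m \<le> a K" "K \<subseteq> X" for m K
      using length_nat_code_mono[OF that(1)] bound[OF that(2) X(2)] unfolding ab by linarith
    have len_b: "length (nat_code m) \<le> B" if "m \<le> b K" "K \<subseteq> X" for m K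
      using length_nat_code_mono[OF that(1)] bound[OF that(2) X(3)] unfolding ab by linarith
    have len_bits: "length (bits K) \<le> B" for K
      using length_vars_code[of vs] B by (simp add: bits_def vars_code_def vs_def)
    have low: "length (lower_code m) \<le> Suc B" if "length (nat_code m) \<le> B" for m
      using length_lower_code[of m] that by linarith
    have "\<forall>w\<in>set us. length w \<le> Suc B"
      unfolding us_def
      using len_bits[of I] len_bits[of J] len_bits[of I'] len_bits[of J']
        low[OF len_a[OF le_refl sub(1)]] low[OF len_b[OF le_refl sub(1)]]
        low[OF len_a[OF le_refl sub(3)]] low[OF len_b[OF le_refl sub(3)]]
        len_a[of "a J - a I" J] len_b[of "b J" J] len_b[of "b I - b J" I] sub
        len_b[of "b J' - b I'" J'] len_a[of "a J'" J'] len_a[of "a I' - a J'" I']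
      by simp
    moreover have "length (tuple_code ws) \<le> length ws * (2 * C + 1)" if "\<forall>w\<in>set ws. length w \<le> C" for ws C
      using that by (induction ws) (auto simp: tuple_code_Nil tuple_code_Cons length_pair_code)
    \<comment> \<open>Each of the 14 components has at most \<open>Suc B\<close> bits, which
      delimiting turns into at most \<open>2 * Suc B + 1\<close>; hence
      \<open>28 * B + 42\<close>.\<close>
    ultimately have "length (tuple_code us) \<le> 14 * (2 * Suc B + 1)" using us by metis
    then have "length (tuple_code us) \<le> n" using n by simp
    moreover have "refutation D (obtain_code X K1 K2 R) (tuple_code us)"
    proof -
      have c: "component k (tuple_code us) = us ! k" if "k < 14" for k
        using that us by simp
      have "component 0 (tuple_code us) = bits I" "component 1 (tuple_code us) = bits J"
        "component 2 (tuple_code us) = lower_code (a I)" "component 3 (tuple_code us) = nat_code (a J - a I)"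
        "component 4 (tuple_code us) = lower_code (b I)" "component 5 (tuple_code us) = nat_code (b J)"
        "component 6 (tuple_code us) = nat_code (b I - b J)" "component 7 (tuple_code us) = bits I'"
        "component 8 (tuple_code us) = bits J'" "component 9 (tuple_code us) = lower_code (b I')"
        "component 10 (tuple_code us) = nat_code (b J' - b I')"
        "component 11 (tuple_code us) = lower_code (a I')" "component 12 (tuple_code us) = nat_code (a J')"
        "component 13 (tuple_code us) = nat_code (a I' - a J')"
        by (subst c; simp add: us_def)+
      note cs = this
      show ?thesis
        unfolding refutation_def comps cert[OF X(2,3)] cert[OF X(3,2)] ev in_models cs
          sel_bits[OF sub(1)] sel_bits[OF sub(2)] sel_bits[OF sub(3)] sel_bits[OF sub(4)]
          bits_val_nat_code lower_lower_code ab[symmetric]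
        using IJ inf by (auto simp: models_def)
    qed
    ultimately show "\<exists>u. length u \<le> n \<and> refutation D (obtain_code X K1 K2 R) u" by blast
  qed
qed

theorem theorem1:
  fixes d :: distance and i :: nat
  assumes "poly_size_distance d"
    and "problem_in (dist_problem d) (Pi_p i) \<or> problem_in (dist_problem d) (Sigma_p i)"
  shows "problem_in (obtain_problem d) (Pi_p (Suc i))"
proof -
  obtain D where D: "D \<in> Pi_p i \<or> D \<in> Sigma_p i" "fst (dist_problem d) \<subseteq> D" "snd (dist_problem d) \<inter> D = {}"
    using assms(2) unfolding problem_in_def by blast
  \<comment> \<open>If \<open>D\<close> is in \<open>Sigma_p i\<close>, its complement is in
    \<open>Pi_p i\<close>, and vice versa; one level higher both are covered.\<close>
  have D_Sigma: "D \<in> Sigma_p (Suc i)" "- D \<in> Sigma_p (Suc i)"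
    using D(1) Pi_p_subset_Sigma_p[of D i] Pi_p_subset_Sigma_p[of "- D" i] Sigma_p_mono[of D i]
      Sigma_p_mono[of "- D" i] by (auto simp: Pi_p_def simp del: Sigma_p.simps)
  have D_iff: "dist_code X I K x \<in> D \<longleftrightarrow> form_dist d X I K \<le> x"
    if X: "finite X" "I \<subseteq> X" "consistent_over X K" for X I K x
  proof
    assume "form_dist d X I K \<le> x"
    then have "dist_code X I K x \<in> fst (dist_problem d)"
      using X unfolding dist_problem_def fst_conv by blast
    then show "dist_code X I K x \<in> D" using D(2) by blast
  next
    assume *: "dist_code X I K x \<in> D"
    show "form_dist d X I K \<le> x"
    proof (rule ccontr)
      assume "\<not> form_dist d X I K \<le> x"
      then have "dist_code X I K x \<in> snd (dist_problem d)"
        using X unfolding dist_problem_def snd_conv by blast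
      then show False using D(3) * by blast
    qed
  qed
  obtain p :: "nat poly" where p: "\<forall>X I J. finite X \<and> I \<subseteq> X \<and> J \<subseteq> X \<longrightarrow>
      length (nat_code (d X I J)) \<le> poly p (length (interp_code X I))"
    using assms(1) unfolding poly_size_distance_def by (elim exE)
  \<comment> \<open>The factor 2 is that of \<open>length_interp_code\<close>; 28 and 42 come from
    the length of a certificate.\<close>
  have "poly_bounded (\<lambda>x. 28 * (poly p (2 * length x) + length x) + 42)"
    by (intro poly_bounded_intros)
  then obtain q :: "nat poly" where
    q: "\<forall>x :: bool list. 28 * (poly p (2 * length x) + length x) + 42 \<le> poly q (length x)"
    unfolding poly_bounded_def by (elim exE)
  \<comment> \<open>Words that encode no instance may fall on either side of \<open>N\<close>, since
    the restricted problem does not constrain them.\<close>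
  define N where "N = {x. \<exists>u. length u \<le> poly q (length x) \<and>
    pair_code x u \<in> {z. refutation D (pair_fst z) (pair_snd z)}}"
  have "N \<in> Sigma_p (Suc i)"
    unfolding N_def by (rule Sigma_p_ex[OF Sigma_p_refutation[OF D_Sigma]])
  then have "- N \<in> Pi_p (Suc i)" by (simp add: Pi_p_def)
  moreover have N: "obtain_code X K1 K2 R \<in> N \<longleftrightarrow> \<not> obtainable d X K1 K2 R"
    if X: "finite X" "consistent_over X K1" "consistent_over X K2" "consistent_over X R" for X K1 K2 R
  proof -
    let ?x = "obtain_code X K1 K2 R"
    let ?B = "poly p (2 * length ?x) + length ?x"
    have bound: "length (nat_code (form_dist d X I K)) \<le> ?B" if "I \<subseteq> X" "consistent_over X K" for I K
    proof -
      have "models X K \<subseteq> Pow X" "models X K \<noteq> {}"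
        using that by (auto simp: models_def consistent_over_def)
      then have "finite (d X I ` models X K)" "d X I ` models X K \<noteq> {}"
        using finite_subset[of "models X K" "Pow X"] X(1) by simp_all
      from Min_in[OF this] obtain J where J: "J \<subseteq> X" "form_dist d X I K = d X I J"
        unfolding form_dist_def by (auto simp: models_def)
      have "length (interp_code X I) \<le> 2 * length ?x"
        using length_interp_code[of X I] length_vars_code_obtain[of X K1 K2 R] by linarith
      then show ?thesis
        using p[rule_format, of X I J] X(1) that(1) J(1) poly_nat_mono[of "length (interp_code X I)" "2 * length ?x" p] J(2)
        by simp
    qed
    have "length (vars_code X) \<le> ?B"
      using length_vars_code_obtain[of X K1 K2 R] by simp
    then have "(\<exists>u. length u \<le> poly q (length ?x) \<and> refutation D ?x u) \<longleftrightarrow> \<not> obtainable d X K1 K2 R"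
      by (intro refutation_iff[OF X D_iff[OF X(1)] bound _ q[rule_format]])
    then show ?thesis by (simp add: N_def)
  qed
  ultimately show ?thesis
    unfolding problem_in_def obtain_problem_def by (intro bexI[of _ "- N"]) auto
qed

end
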